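(* Let $p\in(0,\infty)$ and let $T\in L^p(\mathcal M,\tau)$. Then $$\int_{\mathbb C}|z|^p\,d\mu_T(z)\le\|T\|_p^p,$$ where $\mu_T$ is the Brown measure of $T$.
   Context: $\mathcal M$ is a finite von Neumann algebra with a faithful, normal, tracial state $\tau$, and $\tilde{\mathcal M}$ is the $*$-algebra of closed, densely defined operators affiliated with $\mathcal M$. For $T\in\tilde{\mathcal M}$ with $|T|=(T^*T)^{1/2}$ having spectral measure $E_{|T|}$, put $\mu_{|T|}(B)=\tau(E_{|T|}(B))$, a Borel probability measure on $[0,\infty)$. $\mathcal M^\Delta$ is the set of $T\in\tilde{\mathcal M}$ with $\int_0^\infty\log^+(t)\,d\mu_{|T|}(t)<\infty$, where $\log^+t=\max\{\log t,0\}$. For $T\in\mathcal M^\Delta$, $\Delta(T)=\exp\big(\int_{[0,\infty)}\log t\,d\mu_{|T|}(t)\big)\in[0,\infty)$ (with $\log0=-\infty$, $\exp(-\infty)=0$). If $T\in\mathcal M^\Delta$ then $T-\lambda\mathbf 1\in\mathcal M^\Delta$ for all $\lambda\in\mathbb C$. Brown measure: for $T\in\mathcal M^\Delta$, $\mu_T$ is the Borel probability measure on $\mathbb C$ given by $d\mu_T=\frac1{2\pi}\nabla^2\log\Delta(T-\lambda\mathbf 1)\,d\lambda$ in the distribution sense; equivalently, it is the unique Borel probability measure on $\mathbb C$ with $\int_{\mathbb C}\log^+|z|\,d\mu_T(z)<\infty$ and $\log\Delta(T-\lambda\mathbf 1)=\int_{\mathbb C}\log|\lambda-z|\,d\mu_T(z)$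 for all $\lambda\in\mathbb C$. For $p\in(0,\infty)$, $L^p(\mathcal M,\tau)$ is the set of $T\in\tilde{\mathcal M}$ with $\|T\|_p^p:=\tau(|T|^p)=\int_0^\infty t^p\,d\mu_{|T|}(t)<\infty$; it is contained in $\mathcal M^\Delta$. *)

theory Defs
  imports "HOL-Probability.Probability"
begin

section \<open>Complex Hilbert spaces\<close>

text \<open>The norm and topology are those of the underlying real Hilbert space, whose inner product
  is the real part of \<^term>\<open>cinner\<close>; \<^term>\<open>cinner\<close> is linear in its first argument.\<close>

class complex_hilbert = real_inner + complete_space +
  fixes scaleC :: "complex \<Rightarrow> 'a \<Rightarrow> 'a"  (infixr \<open>*\<^sub>C\<close> 75)
    and cinner :: "'a \<Rightarrow> 'a \<Rightarrow> complex"
  assumes scaleC_add_right: "c *\<^sub>C (x + y) = c *\<^sub>C x + c *\<^sub>C y"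
    and scaleC_add_left: "(c + d) *\<^sub>C x = c *\<^sub>C x + d *\<^sub>C x"
    and scaleC_scaleC: "c *\<^sub>C d *\<^sub>C x = (c * d) *\<^sub>C x"
    and scaleC_of_real: "complex_of_real r *\<^sub>C x = r *\<^sub>R x"
    and cinner_commute: "cinner x y = cnj (cinner y x)"
    and cinner_add_left: "cinner (x + y) z = cinner x z + cinner y z"
    and cinner_scaleC_left: "cinner (c *\<^sub>C x) y = c * cinner x y"
    and Re_cinner: "Re (cinner x y) = inner x y"

instantiation complex :: complex_hilbert
begin

definition "scaleC_complex c (x::complex) = c * x"
definition "cinner_complex x (y::complex) = x * cnj y"

instance
  by standard
     (auto simp: scaleC_complex_def cinner_complex_def algebra_simps scaleR_conv_of_real
        inner_complex_def)

end


section \<open>Bounded operators and von Neumann algebras\<close>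

definition bounded_clinear :: "('h::complex_hilbert \<Rightarrow> 'h) \<Rightarrow> bool" where
  "bounded_clinear A \<longleftrightarrow> bounded_linear A \<and> (\<forall>c x. A (c *\<^sub>C x) = c *\<^sub>C A x)"

definition is_adjoint :: "('h::complex_hilbert \<Rightarrow> 'h) \<Rightarrow> ('h \<Rightarrow> 'h) \<Rightarrow> bool" where
  "is_adjoint A B \<longleftrightarrow> (\<forall>x y. cinner (A x) y = cinner x (B y))"

definition positive_op :: "('h::complex_hilbert \<Rightarrow> 'h) \<Rightarrow> bool" where
  "positive_op A \<longleftrightarrow> bounded_clinear A \<and> (\<forall>x. cinner (A x) x \<in> \<real>\<^sub>\<ge>\<^sub>0)"

abbreviation op_le :: "('h::complex_hilbert \<Rightarrow> 'h) \<Rightarrow> ('h \<Rightarrow> 'h) \<Rightarrow> bool" where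
  "op_le A B \<equiv> positive_op (\<lambda>x. B x - A x)"

definition commutant :: "('h::complex_hilbert \<Rightarrow> 'h) set \<Rightarrow> ('h \<Rightarrow> 'h) set" where
  "commutant M = {A. bounded_clinear A \<and> (\<forall>B\<in>M. A \<circ> B = B \<circ> A)}"

text \<open>A von Neumann algebra is a self-adjoint set of bounded operators that equals its
  bicommutant; this makes it a unital, weakly closed \<open>*\<close>-subalgebra.\<close>

definition von_neumann_algebra :: "('h::complex_hilbert \<Rightarrow> 'h) set \<Rightarrow> bool" where
  "von_neumann_algebra M \<longleftrightarrow>
     (\<forall>A\<in>M. bounded_clinear A) \<and>
     (\<forall>A\<in>M. \<exists>B\<in>M. is_adjoint A B) \<and>
     commutant (commutant M) = M"

locale tracial_von_neumann_algebra =
  fixes M :: "('h::complex_hilbert \<Rightarrow> 'h) set" and \<tau> :: "('h \<Rightarrow> 'h) \<Rightarrow> complex"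
  assumes von_neumann: "von_neumann_algebra M"
    and trace_add: "A \<in> M \<Longrightarrow> B \<in> M \<Longrightarrow> \<tau> (\<lambda>x. A x + B x) = \<tau> A + \<tau> B"
    and trace_scale: "A \<in> M \<Longrightarrow> \<tau> (\<lambda>x. c *\<^sub>C A x) = c * \<tau> A"
    and trace_positive: "A \<in> M \<Longrightarrow> positive_op A \<Longrightarrow> \<tau> A \<in> \<real>\<^sub>\<ge>\<^sub>0"
    and trace_unit: "\<tau> id = 1"
    and trace_commute: "A \<in> M \<Longrightarrow> B \<in> M \<Longrightarrow> \<tau> (A \<circ> B) = \<tau> (B \<circ> A)"
    and trace_faithful: "A \<in> M \<Longrightarrow> positive_op A \<Longrightarrow> \<tau> A = 0 \<Longrightarrow> A = (\<lambda>x. 0)"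
    and trace_normal: \<comment> \<open>\<open>\<tau>\<close> preserves suprema of bounded upward directed sets of positive elements\<close>
      "D \<subseteq> M \<Longrightarrow> D \<noteq> {} \<Longrightarrow> (\<forall>A\<in>D. positive_op A) \<Longrightarrow>
       (\<forall>A\<in>D. \<forall>B\<in>D. \<exists>C\<in>D. op_le A C \<and> op_le B C) \<Longrightarrow>
       S \<in> M \<Longrightarrow> (\<forall>A\<in>D. op_le A S) \<Longrightarrow>
       (\<forall>R\<in>M. (\<forall>A\<in>D. op_le A R) \<longrightarrow> op_le S R) \<Longrightarrow>
       Re (\<tau> S) = (SUP A\<in>D. Re (\<tau> A))"


section \<open>Unbounded operators\<close>

text \<open>An unbounded operator is represented by its graph. Composition of graphs is relational
  composition, so that \<^term>\<open>S O T\<close> is the operator ``first \<open>S\<close>, then \<open>T\<close>'' on its natural domain.\<close>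

type_synonym 'h operator = "('h \<times> 'h) set"

definition linear_operator :: "('h::complex_hilbert) operator \<Rightarrow> bool" where
  "linear_operator T \<longleftrightarrow>
     (0, 0) \<in> T \<and>
     (\<forall>x y x' y'. (x, y) \<in> T \<longrightarrow> (x', y') \<in> T \<longrightarrow> (x + x', y + y') \<in> T) \<and>
     (\<forall>c x y. (x, y) \<in> T \<longrightarrow> (c *\<^sub>C x, c *\<^sub>C y) \<in> T) \<and>
     single_valued T"

definition closed_densely_defined :: "('h::complex_hilbert) operator \<Rightarrow> bool" where
  "closed_densely_defined T \<longleftrightarrow> linear_operator T \<and> closed T \<and> closure (Domain T) = UNIV"

definition adj :: "('h::complex_hilbert) operator \<Rightarrow> 'h operator" where
  "adj T = {(y, z). \<forall>(x, w)\<in>T. cinner w y = cinner x z}"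

definition positive_self_adjoint :: "('h::complex_hilbert) operator \<Rightarrow> bool" where
  "positive_self_adjoint A \<longleftrightarrow>
     closed_densely_defined A \<and> adj A = A \<and> (\<forall>(x, y)\<in>A. cinner y x \<in> \<real>\<^sub>\<ge>\<^sub>0)"

text \<open>\<open>A = (T\<^sup>*T)\<^sup>1\<^sup>/\<^sup>2\<close>\<close>

definition is_modulus :: "('h::complex_hilbert) operator \<Rightarrow> 'h operator \<Rightarrow> bool" where
  "is_modulus T A \<longleftrightarrow> positive_self_adjoint A \<and> A O A = T O adj T"

definition shift :: "('h::complex_hilbert) operator \<Rightarrow> complex \<Rightarrow> 'h operator" where
  "shift T c = {(x, y - c *\<^sub>C x) | x y. (x, y) \<in> T}"

text \<open>Closed densely defined \<open>T\<close> affiliated with \<open>M\<close>: \<open>AT \<subseteq> TA\<close> for every \<open>A\<close> in the commutant.\<close>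

definition affiliated :: "('h::complex_hilbert \<Rightarrow> 'h) set \<Rightarrow> 'h operator set" where
  "affiliated M = {T. closed_densely_defined T \<and>
     (\<forall>A\<in>commutant M. \<forall>(x, y)\<in>T. (A x, A y) \<in> T)}"


section \<open>Spectral measures\<close>

definition projection_valued_measure :: "(real set \<Rightarrow> 'h::complex_hilbert \<Rightarrow> 'h) \<Rightarrow> bool" where
  "projection_valued_measure E \<longleftrightarrow>
     (\<forall>B\<in>sets borel. bounded_clinear (E B) \<and> E B \<circ> E B = E B \<and> is_adjoint (E B) (E B)) \<and>
     E UNIV = id \<and>
     (\<forall>F :: nat \<Rightarrow> real set. range F \<subseteq> sets borel \<longrightarrow> disjoint_family F \<longrightarrow>
        (\<forall>x. (\<lambda>n. E (F n) x) sums E (\<Union>n. F n) x))"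

definition scalar_measure :: "(real set \<Rightarrow> 'h::complex_hilbert \<Rightarrow> 'h) \<Rightarrow> 'h \<Rightarrow> real measure" where
  "scalar_measure E x = measure_of UNIV (sets borel) (\<lambda>B. ennreal (Re (cinner (E B x) x)))"

text \<open>\<open>A = \<integral> t dE(t)\<close>. Since \<open>A\<close> will be a linear operator, by polarization its domain and its
  quadratic form determine it.\<close>

definition is_spectral_measure ::
  "('h::complex_hilbert) operator \<Rightarrow> (real set \<Rightarrow> 'h \<Rightarrow> 'h) \<Rightarrow> bool" where
  "is_spectral_measure A E \<longleftrightarrow>
     projection_valued_measure E \<and>
     Domain A = {x. (\<integral>\<^sup>+t. ennreal (t\<^sup>2) \<partial>scalar_measure E x) < \<infinity>} \<and>
     (\<forall>(x, y)\<in>A. cinner y x = complex_of_real (\<integral>t. t \<partial>scalar_measure E x))"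

text \<open>\<open>\<mu>\<^bsub>|T|\<^esub>(B) = \<tau>(E\<^bsub>|T|\<^esub>(B))\<close>, regarded as a Borel measure on the whole line; it is
  concentrated on \<open>[0,\<infinity>)\<close> because \<open>|T|\<close> is positive.\<close>

definition is_modulus_distribution ::
  "(('h::complex_hilbert \<Rightarrow> 'h) \<Rightarrow> complex) \<Rightarrow> 'h operator \<Rightarrow> real measure \<Rightarrow> bool" where
  "is_modulus_distribution \<tau> T \<nu> \<longleftrightarrow>
     (\<exists>A E. is_modulus T A \<and> is_spectral_measure A E \<and>
        \<nu> = measure_of UNIV (sets borel) (\<lambda>B. ennreal (Re (\<tau> (E B)))))"

definition modulus_distribution ::
  "(('h::complex_hilbert \<Rightarrow> 'h) \<Rightarrow> complex) \<Rightarrow> 'h operator \<Rightarrow> real measure" where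
  "modulus_distribution \<tau> T = (THE \<nu>. is_modulus_distribution \<tau> T \<nu>)"


section \<open>Fuglede--Kadison determinant, Brown measure and \<open>L\<^sup>p\<close>\<close>

text \<open>The logarithm on \<open>[0,\<infinity>)\<close> with \<open>log 0 = -\<infinity>\<close>. Note that
  \<^term>\<open>e2ennreal (elog t)\<close> is \<open>log\<^sup>+ t\<close>.\<close>

definition elog :: "real \<Rightarrow> ereal" where
  "elog t = (if t \<le> 0 then -\<infinity> else ereal (ln t))"

definition ext_integral :: "'a measure \<Rightarrow> ('a \<Rightarrow> ereal) \<Rightarrow> ereal" where
  "ext_integral \<nu> f =
     enn2ereal (\<integral>\<^sup>+x. e2ennreal (f x) \<partial>\<nu>) - enn2ereal (\<integral>\<^sup>+x. e2ennreal (- f x) \<partial>\<nu>)"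

definition M_Delta ::
  "('h::complex_hilbert \<Rightarrow> 'h) set \<Rightarrow> (('h \<Rightarrow> 'h) \<Rightarrow> complex) \<Rightarrow> 'h operator set" where
  "M_Delta M \<tau> = {T \<in> affiliated M. \<exists>\<nu>. is_modulus_distribution \<tau> T \<nu> \<and>
     (\<integral>\<^sup>+t. e2ennreal (elog t) \<partial>\<nu>) < \<infinity>}"

definition Delta :: "(('h::complex_hilbert \<Rightarrow> 'h) \<Rightarrow> complex) \<Rightarrow> 'h operator \<Rightarrow> real" where
  "Delta \<tau> T = (let L = ext_integral (modulus_distribution \<tau> T) elog
                in if L = -\<infinity> then 0 else exp (real_of_ereal L))"

text \<open>The Brown measure is the unique Borel probability measure that integrates \<open>log\<^sup>+|z|\<close> and
  satisfies \<open>log \<Delta>(T - c1) = \<integral> log|c - z| d\<mu>(z)\<close> for all \<open>c\<close>, an identity in \<open>[-\<infinity>,\<infinity>)\<close>;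
  equivalently, \<open>1/2\<pi>\<close> times the distributional Laplacian of \<open>c \<mapsto> log \<Delta>(T - c1)\<close>.
  Membership of \<open>T - c1\<close> in \<^const>\<open>M_Delta\<close> says that its left-hand side is
  meaningful.\<close>

definition is_brown_measure ::
  "('h::complex_hilbert \<Rightarrow> 'h) set \<Rightarrow> (('h \<Rightarrow> 'h) \<Rightarrow> complex) \<Rightarrow> 'h operator \<Rightarrow>
   complex measure \<Rightarrow> bool" where
  "is_brown_measure M \<tau> T \<mu> \<longleftrightarrow>
     prob_space \<mu> \<and> sets \<mu> = sets borel \<and>
     (\<integral>\<^sup>+z. e2ennreal (elog (cmod z)) \<partial>\<mu>) < \<infinity> \<and>
     (\<forall>c. shift T c \<in> M_Delta M \<tau> \<and>
        elog (Delta \<tau> (shift T c)) = ext_integral \<mu> (\<lambda>z. elog (cmod (c - z))))"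

definition Lp_norm_powr ::
  "(('h::complex_hilbert \<Rightarrow> 'h) \<Rightarrow> complex) \<Rightarrow> real \<Rightarrow> 'h operator \<Rightarrow> ennreal" where
  "Lp_norm_powr \<tau> p T = (\<integral>\<^sup>+t. ennreal (t powr p) \<partial>modulus_distribution \<tau> T)"

definition Lp_space ::
  "('h::complex_hilbert \<Rightarrow> 'h) set \<Rightarrow> (('h \<Rightarrow> 'h) \<Rightarrow> complex) \<Rightarrow> real \<Rightarrow> 'h operator set" where
  "Lp_space M \<tau> p = {T \<in> affiliated M. \<exists>\<nu>. is_modulus_distribution \<tau> T \<nu> \<and>
     (\<integral>\<^sup>+t. ennreal (t powr p) \<partial>\<nu>) < \<infinity>}"

end

theory Submission
  imports Defs
begin

text \<open>
  Integrating the submajorization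
  \<open>\<integral> log\<^sup>+ (|z|/r) d\<mu>\<^sub>T \<le> \<integral> log\<^sup>+ (t/r) d\<mu>\<^bsub>|T|\<^esub>\<close>
  against \<open>p\<^sup>2 r\<^sup>p\<^sup>-\<^sup>1 dr\<close> gives the theorem. By Jensen's formula, its left-hand side plus \<open>log r\<close>
  is the mean of \<open>log \<Delta>(T - \<zeta>)\<close> over the circle \<open>|\<zeta>| = r\<close>.

  For \<open>q > 1\<close> let \<open>h(t) = q max(t, r)\<close>, \<open>G = h(|T|)\<^sup>-\<^sup>1\<close> and \<open>u = TG\<close>, so that
  \<open>T - \<zeta> = (u - \<zeta>G) G\<^sup>-\<^sup>1\<close>, where \<open>u\<close> and \<open>\<zeta>G\<close> have norm at most \<open>1/q\<close>. A Moebius transform shows that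
  \<open>(u - \<zeta>G)(1 - \<zeta>\<^sup>*Gu)\<^sup>-\<^sup>1\<close> is similar to a contraction, hence
  \<open>\<Delta>(T - \<zeta>) \<le> \<Delta>(h(|T|)) \<Delta>(1 - \<zeta>\<^sup>*Gu)\<close>. The logarithm of the last factor is the real part of a
  power series in \<open>\<zeta>\<^sup>*\<close> without constant term, so its mean over the circle vanishes. Then
  \<open>q \<rightarrow> 1\<close>.

  The determinant of \<open>T - \<zeta>\<close> is only ever used through the bounded resolvents
  \<open>(|T - \<zeta>|\<^sup>2 + \<epsilon>)\<^sup>-\<^sup>1\<close>; for bounded positive invertible elements the trace of the logarithm is
  given by the power series of the logarithm, and its identities follow by comparing derivatives
  along line segments.
\<close>

text \<open>The modulus of T - \<zeta> is not a function of |T|, and G^{-1} is unbounded, so the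
  determinant of the product cannot be split directly. A Schur complement takes the place of
  multiplicativity: with b the bounded resolvent of |T - \<zeta>|^2 and Z = u - \<zeta>G, the
  inequality G (b + \<delta>)^{-1} G \<le> Z*Z + \<epsilon>G^2 bounds det G^2 by det(Z*Z +
  \<epsilon>G^2) det(b + \<delta>), up to regularisation, and only bounded operators occur in it.
  The cut-off max(t, r) is dictated by Jensen's formula: the mean of log|\<zeta> - z| over the
  circle is log max(|z|, r), so both sides of the estimate acquire the same shape. The factor q
  turns u and \<zeta>G into strict contractions, which the Neumann and logarithm series require. No
  polar decomposition or operator square root is formed. What is needed about |T| is drawn from
  |T|^2 = T*T: the norm of T g(|T|) x, the membership of the spectral projections in the algebra and
  their uniqueness.\<close>

instance complex_hilbert \<subseteq> banach ..

section \<open>Complex inner products, Riesz representation and adjoints\<close>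

lemma cinner_add_right: "cinner x (y + z) = cinner x y + cinner x z"
  by (metis cinner_add_left cinner_commute complex_cnj_add)

lemma cinner_scaleC_right: "cinner x (c *\<^sub>C y) = cnj c * cinner x y"
  by (metis cinner_scaleC_left cinner_commute complex_cnj_mult complex_cnj_cnj)

lemma cinner_scaleR_left: "cinner (r *\<^sub>R x) y = of_real r * cinner x y"
  by (metis scaleC_of_real cinner_scaleC_left)

lemma cinner_scaleR_right: "cinner x (r *\<^sub>R y) = of_real r * cinner x y"
  by (metis scaleC_of_real cinner_scaleC_right complex_cnj_complex_of_real)

lemma cinner_zero_left [simp]: "cinner 0 y = 0"
  using cinner_scaleR_left[of 0 0 y] by simp

lemma cinner_zero_right [simp]: "cinner y 0 = 0"
  using cinner_scaleR_right[of y 0 0] by simp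

lemma cinner_minus_left: "cinner (- x) y = - cinner x y"
  using cinner_scaleR_left[of "-1" x y] by simp

lemma cinner_minus_right: "cinner x (- y) = - cinner x y"
  using cinner_scaleR_right[of x "-1" y] by simp

lemma cinner_diff_left: "cinner (x - y) z = cinner x z - cinner y z"
  using cinner_add_left[of x "-y" z] by (simp add: cinner_minus_left)

lemma cinner_diff_right: "cinner z (x - y) = cinner z x - cinner z y"
  using cinner_add_right[of z x "-y"] by (simp add: cinner_minus_right)

lemmas cinner_simps = cinner_add_left cinner_add_right cinner_diff_left cinner_diff_right
  cinner_scaleC_left cinner_scaleC_right cinner_scaleR_left cinner_scaleR_right
  cinner_minus_left cinner_minus_right

lemma scaleC_one [simp]: "1 *\<^sub>C x = x"
  using scaleC_of_real[of 1 x] by simp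

lemma scaleC_zero_left [simp]: "0 *\<^sub>C x = 0"
  using scaleC_of_real[of 0 x] by simp

lemma scaleC_zero_right [simp]: "c *\<^sub>C 0 = 0"
  using scaleC_add_right[of c 0 0] by simp

lemma scaleC_minus_right: "c *\<^sub>C (- x) = - (c *\<^sub>C x)"
  using scaleC_add_right[of c x "-x"] by (simp add: eq_neg_iff_add_eq_0 add.commute)

lemma scaleC_diff_right: "c *\<^sub>C (x - y) = c *\<^sub>C x - c *\<^sub>C y"
  using scaleC_add_right[of c x "-y"] by (simp add: scaleC_minus_right)

lemma scaleC_scaleR: "c *\<^sub>C r *\<^sub>R x = r *\<^sub>R c *\<^sub>C x"
  by (metis scaleC_of_real scaleC_scaleC mult.commute)

lemma scaleR_eq_scaleC: "r *\<^sub>R (x::'a::complex_hilbert) = of_real r *\<^sub>C x"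
  by (simp add: scaleC_of_real)

lemma cinner_self: "cinner x x = of_real ((norm x)\<^sup>2)"
proof -
  have "cinner x x = cnj (cinner x x)" by (rule cinner_commute)
  hence "Im (cinner x x) = 0"
    by (metis cnj.simps(2) equal_neg_zero)
  moreover have "Re (cinner x x) = (norm x)\<^sup>2"
    by (simp add: Re_cinner power2_norm_eq_inner)
  ultimately show ?thesis by (simp add: complex_eq_iff)
qed

lemma norm_scaleC [simp]: "norm (c *\<^sub>C x) = cmod c * norm x"
proof -
  have "of_real ((norm (c *\<^sub>C x))\<^sup>2) = (c * cnj c) * of_real ((norm x)\<^sup>2)"
    by (simp only: cinner_self[symmetric] cinner_simps mult_ac)
  also have "\<dots> = of_real ((cmod c * norm x)\<^sup>2)"
    by (simp add: complex_norm_square[symmetric] power_mult_distrib)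
  finally have "(norm (c *\<^sub>C x))\<^sup>2 = (cmod c * norm x)\<^sup>2"
    using of_real_eq_iff by blast
  thus ?thesis by (simp add: power2_eq_iff_nonneg)
qed

text \<open>Rotating \<open>y\<close> by a phase makes the complex inner product real and
  nonnegative, where the real inequality applies.\<close>

lemma cinner_Cauchy_Schwarz: "cmod (cinner x y) \<le> norm x * norm y"
proof (cases "cinner x y = 0")
  case False
  define c where "c = cinner x y / of_real (cmod (cinner x y))"
  have c: "cmod c = 1" using False by (simp add: c_def norm_divide)
  have "cinner x (c *\<^sub>C y) = cnj c * cinner x y" by (simp add: cinner_simps)
  also have "\<dots> = of_real (cmod (cinner x y))"
    using False by (simp add: c_def complex_norm_square[symmetric] power2_eq_square divide_simps
        mult.commute)
  finally have "cmod (cinner x y) = inner x (c *\<^sub>C y)"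
    by (metis Re_cinner Re_complex_of_real)
  also have "\<dots> \<le> norm x * norm (c *\<^sub>C y)" by (rule norm_cauchy_schwarz)
  finally show ?thesis using c by simp
qed simp

lemma bounded_bilinear_cinner: "bounded_bilinear cinner"
  by (rule bounded_bilinear.intro)
     (auto simp: cinner_simps scaleR_conv_of_real intro!: exI[of _ 1] cinner_Cauchy_Schwarz)

lemmas tendsto_cinner = bounded_bilinear.tendsto[OF bounded_bilinear_cinner]

lemma bounded_linear_scaleC: "bounded_linear ((*\<^sub>C) c :: 'a::complex_hilbert \<Rightarrow> 'a)"
  by (rule bounded_linear_intro[where K="cmod c"]) (auto simp: scaleC_add_right scaleC_scaleR)

lemmas tendsto_scaleC = bounded_linear.tendsto[OF bounded_linear_scaleC]

lemma cinner_eqI: "(\<And>z. cinner x z = cinner y z) \<Longrightarrow> x = y"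
  by (metis Re_cinner inner_commute vector_eq_ldot)

text \<open>The representing vector minimises \<open>\<phi>\<close> x = |x|^2 - 2 f(x). The
  parallelogram law makes a minimising sequence Cauchy, and the first variation vanishes at its
  limit.\<close>

lemma Riesz_representation:
  fixes f :: "'a::{real_inner,complete_space} \<Rightarrow> real"
  assumes "bounded_linear f"
  shows "\<exists>z. \<forall>x. f x = inner x z"
proof -
  interpret f: bounded_linear f by fact
  obtain K where K: "\<And>x. norm (f x) \<le> norm x * K" "K > 0"
    using f.pos_bounded by blast
  define \<phi> where "\<phi> x = (norm x)\<^sup>2 - 2 * f x" for x
  define m where "m = Inf (range \<phi>)"
  have lower: "- K\<^sup>2 \<le> \<phi> x" for x
  proof -
    have "\<phi> x \<ge> (norm x)\<^sup>2 - 2 * (norm x * K)" using K(1)[of x] by (simp add: \<phi>_def)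
    moreover have "(norm x - K)\<^sup>2 \<ge> 0" by simp
    ultimately show ?thesis unfolding power2_diff by simp
  qed
  hence bdd: "bdd_below (range \<phi>)" by (auto intro!: bdd_belowI)
  have m_le: "m \<le> \<phi> x" for x unfolding m_def using bdd by (auto intro: cInf_lower)
  have "\<exists>x. \<phi> x < m + 1 / real (Suc n)" for n
  proof -
    have "m < m + 1 / real (Suc n)" by simp
    thus ?thesis unfolding m_def using cInf_lessD[of "range \<phi>"] by auto
  qed
  then obtain X where X: "\<And>n. \<phi> (X n) < m + 1 / real (Suc n)" by metis
  have par: "(norm (x - y))\<^sup>2 = 2 * \<phi> x + 2 * \<phi> y - 4 * \<phi> ((1/2) *\<^sub>R (x + y))" for x y
    by (simp add: \<phi>_def f.add f.scaleR power2_norm_eq_inner inner_simps inner_commute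
        algebra_simps)
  have dist: "(norm (X a - X b))\<^sup>2 \<le> 2 / real (Suc a) + 2 / real (Suc b)" for a b
    using par[of "X a" "X b"] X[of a] X[of b] m_le[of "(1/2) *\<^sub>R (X a + X b)"]
    by simp
  have "Cauchy X"
  proof (rule metric_CauchyI)
    fix e :: real assume e: "e > 0"
    obtain N where N: "real N > 4 / e\<^sup>2" using reals_Archimedean2 by blast
    have "dist (X a) (X b) < e" if "a \<ge> N" "b \<ge> N" for a b
    proof -
      have "2 / real (Suc a) + 2 / real (Suc b) \<le> 2 / real (Suc N) + 2 / real (Suc N)"
        using that by (intro add_mono divide_left_mono) auto
      also have "\<dots> = 4 / real (Suc N)" by simp
      also have "\<dots> < e\<^sup>2"
      proof -
        have "4 < e\<^sup>2 * real N" using N e by (simp add: field_simps)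
        also have "\<dots> \<le> e\<^sup>2 * real (Suc N)" by (intro mult_left_mono) auto
        finally show ?thesis by (simp add: field_simps)
      qed
      finally have "(norm (X a - X b))\<^sup>2 < e\<^sup>2" using dist[of a b] by linarith
      thus ?thesis using e by (simp add: dist_norm power_less_imp_less_base)
    qed
    thus "\<exists>M. \<forall>a\<ge>M. \<forall>b\<ge>M. dist (X a) (X b) < e" by blast
  qed
  then obtain z where z: "X \<longlonglongrightarrow> z" using Cauchy_convergent convergent_def by blast
  have "(\<lambda>n. \<phi> (X n)) \<longlonglongrightarrow> \<phi> z"
    unfolding \<phi>_def by (intro tendsto_intros f.tendsto z)
  moreover have "(\<lambda>n. m + 1 / real (Suc n)) \<longlonglongrightarrow> m + 0"
    by (intro tendsto_intros LIMSEQ_Suc[OF lim_1_over_n])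
  ultimately have "\<phi> z \<le> m + 0"
  proof (rule LIMSEQ_le)
    show "\<exists>N. \<forall>n\<ge>N. \<phi> (X n) \<le> m + 1 / real (Suc n)"
      using X less_imp_le by blast
  qed
  hence zmin: "\<phi> z \<le> \<phi> x" for x using m_le[of x] by simp
  have "f v = inner v z" for v
  proof -
    define d where "d = inner v z - f v"
    have q: "0 \<le> 2 * t * d + t\<^sup>2 * (norm v)\<^sup>2" for t
    proof -
      have "(norm (z + t *\<^sub>R v))\<^sup>2 = (norm z)\<^sup>2 + 2 * t * inner v z + t\<^sup>2 * (norm v)\<^sup>2"
        unfolding power2_norm_eq_inner by (simp add: inner_simps inner_commute power2_eq_square)
      thus ?thesis using zmin[of "z + t *\<^sub>R v"]
        by (simp add: \<phi>_def f.add f.scaleR d_def algebra_simps)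
    qed
    have "d = 0"
    proof (cases "v = 0")
      case False
      \<comment> \<open>This value of t minimises the quadratic polynomial in \<open>q\<close>; its
        minimum is negative unless d = 0.\<close>
      have "0 \<le> 2 * (- d / (norm v)\<^sup>2) * d + (- d / (norm v)\<^sup>2)\<^sup>2 * (norm v)\<^sup>2" by (rule q)
      also have "\<dots> = - (d\<^sup>2 / (norm v)\<^sup>2)"
        using False by (simp add: power2_eq_square field_simps)
      finally have "d\<^sup>2 / (norm v)\<^sup>2 \<le> 0" by simp
      thus ?thesis using False by (simp add: divide_le_0_iff)
    qed (simp add: d_def f.zero)
    thus ?thesis by (simp add: d_def)
  qed
  thus ?thesis by blast
qed

text \<open>Riesz represents the real part of the functional; complex linearity then gives the
  imaginary part, which is minus the real part at \<open>\<i> *\<^sub>C x\<close>.\<close>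

lemma adjoint_exists:
  fixes A :: "'h::complex_hilbert \<Rightarrow> 'h"
  assumes "bounded_clinear A"
  shows "\<exists>z. \<forall>x. cinner (A x) y = cinner x z"
proof -
  interpret A: bounded_linear A using assms by (simp add: bounded_clinear_def)
  have Ac: "A (c *\<^sub>C x) = c *\<^sub>C A x" for c x using assms by (simp add: bounded_clinear_def)
  obtain z where z: "\<And>x. inner (A x) y = inner x z"
    using Riesz_representation[OF bounded_linear_compose[OF bounded_linear_inner_left A.bounded_linear_axioms]]
    by blast
  have "cinner (A x) y = cinner x z" for x
  proof -
    have "Im (cinner (A x) y) = - inner (\<i> *\<^sub>C A x) y"
      by (simp add: Re_cinner[symmetric] cinner_simps)
    also have "\<dots> = - inner (\<i> *\<^sub>C x) z" by (simp add: z Ac[symmetric])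
    also have "\<dots> = Im (cinner x z)" by (simp add: Re_cinner[symmetric] cinner_simps)
    finally show ?thesis by (simp add: complex_eq_iff Re_cinner z)
  qed
  thus ?thesis by blast
qed

section \<open>The algebra of bounded operators\<close>

text \<open>A type, rather than a set of functions, gives access to ring normalisation and to the
  norm topology. The underlying \<open>blinfun\<close> is only real-linear, hence the extra
  condition.\<close>

typedef (overloaded) 'h bop =
  "{f :: ('h::complex_hilbert) \<Rightarrow>\<^sub>L 'h. \<forall>c x. blinfun_apply f (c *\<^sub>C x) = c *\<^sub>C blinfun_apply f x}"
  by (rule exI[of _ 0]) simp

setup_lifting type_definition_bop

lift_definition bapp :: "'h::complex_hilbert bop \<Rightarrow> 'h \<Rightarrow> 'h"  (infixr "\<rhd>" 76) is blinfun_apply .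

text \<open>On a one-point Hilbert space 1 = 0, whereas the classes of rings with unit demand that 0
  and 1 differ. For the same reason the norm of 1 is only bounded by 1 below.\<close>

instantiation bop :: (complex_hilbert) "{real_algebra, monoid_mult}"
begin

lift_definition zero_bop :: "'a bop" is 0 by simp
lift_definition one_bop :: "'a bop" is id_blinfun by simp
lift_definition plus_bop :: "'a bop \<Rightarrow> 'a bop \<Rightarrow> 'a bop" is "(+)"
  by (simp add: blinfun.add_left scaleC_add_right)
lift_definition minus_bop :: "'a bop \<Rightarrow> 'a bop \<Rightarrow> 'a bop" is "(-)"
  by (simp add: blinfun.diff_left scaleC_diff_right)
lift_definition uminus_bop :: "'a bop \<Rightarrow> 'a bop" is "uminus"
  by (simp add: blinfun.minus_left scaleC_minus_right)
lift_definition times_bop :: "'a bop \<Rightarrow> 'a bop \<Rightarrow> 'a bop" is "(o\<^sub>L)" by simp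
lift_definition scaleR_bop :: "real \<Rightarrow> 'a bop \<Rightarrow> 'a bop" is "(*\<^sub>R)"
  by (simp add: blinfun.scaleR_left scaleC_scaleR)
instance
proof
  fix a b c :: "'a bop" and r s :: real
  show "a - b = a + - b" by transfer simp
  show "- a + a = 0" by transfer simp
  show "0 + a = a" by transfer simp
  show "a + b = b + a" by transfer simp
  show "a + b + c = a + (b + c)" by transfer simp
  show "r *\<^sub>R (a + b) = r *\<^sub>R a + r *\<^sub>R b" by transfer (simp add: algebra_simps)
  show "(r + s) *\<^sub>R a = r *\<^sub>R a + s *\<^sub>R a" by transfer (simp add: algebra_simps)
  show "r *\<^sub>R s *\<^sub>R a = (r * s) *\<^sub>R a" by transfer simp
  show "1 *\<^sub>R a = a" by transfer simp
  show "a * b * c = a * (b * c)" by transfer (rule blinfun_eqI, simp)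
  show "(a + b) * c = a * c + b * c" by transfer (rule blinfun_eqI, simp add: blinfun.add_left)
  show "a * (b + c) = a * b + a * c"
    by transfer (rule blinfun_eqI, simp add: blinfun.add_left blinfun.add_right)
  show "r *\<^sub>R a * b = r *\<^sub>R (a * b)" by transfer (rule blinfun_eqI, simp add: blinfun.scaleR_left)
  show "a * r *\<^sub>R b = r *\<^sub>R (a * b)"
    by transfer (rule blinfun_eqI, simp add: blinfun.scaleR_left blinfun.scaleR_right)
  show "1 * a = a" by transfer (rule blinfun_eqI, simp)
  show "a * 1 = a" by transfer (rule blinfun_eqI, simp)
qed

end

instantiation bop :: (complex_hilbert) real_normed_algebra
begin

lift_definition norm_bop :: "'a bop \<Rightarrow> real" is norm .
definition "sgn_bop x = x /\<^sub>R norm x" for x :: "'a bop"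
definition "dist_bop x y = norm (x - y)" for x y :: "'a bop"
definition "uniformity_bop =
  (INF e\<in>{0 <..}. principal {(x::'a bop, y). dist x y < e})"
definition "open_bop U = (\<forall>x\<in>U. \<forall>\<^sub>F (x', y) in uniformity. x' = x \<longrightarrow> y \<in> U)" for U :: "'a bop set"

instance
proof
  fix a b :: "'a bop" and r :: real
  show "norm a = 0 \<longleftrightarrow> a = 0" by transfer simp
  show "norm (a + b) \<le> norm a + norm b" by transfer (rule norm_triangle_ineq)
  show "norm (r *\<^sub>R a) = \<bar>r\<bar> * norm a" by transfer simp
  show "norm (a * b) \<le> norm a * norm b" by transfer (rule norm_blinfun_compose)
qed (simp_all add: sgn_bop_def dist_bop_def uniformity_bop_def open_bop_def)

end

lemma bop_eqI: "(\<And>x. X \<rhd> x = Y \<rhd> x) \<Longrightarrow> X = Y"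
  by transfer (auto intro: blinfun_eqI)

lemma bapp_zero_left [simp]: "0 \<rhd> x = 0" by transfer simp
lemma bapp_one [simp]: "1 \<rhd> x = x" by transfer simp
lemma bapp_add_left: "(X + Y) \<rhd> x = X \<rhd> x + Y \<rhd> x" by transfer (simp add: blinfun.add_left)
lemma bapp_diff_left: "(X - Y) \<rhd> x = X \<rhd> x - Y \<rhd> x" by transfer (simp add: blinfun.diff_left)
lemma bapp_minus_left: "(- X) \<rhd> x = - (X \<rhd> x)" by transfer (simp add: blinfun.minus_left)
lemma bapp_mult: "(X * Y) \<rhd> x = X \<rhd> Y \<rhd> x" by transfer simp
lemma bapp_scaleR_left: "(r *\<^sub>R X) \<rhd> x = r *\<^sub>R (X \<rhd> x)" by transfer (simp add: blinfun.scaleR_left)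
lemma bapp_zero_right [simp]: "X \<rhd> 0 = 0" by transfer simp
lemma bapp_add_right: "X \<rhd> (x + y) = X \<rhd> x + X \<rhd> y" by transfer (simp add: blinfun.add_right)
lemma bapp_diff_right: "X \<rhd> (x - y) = X \<rhd> x - X \<rhd> y" by transfer (simp add: blinfun.diff_right)
lemma bapp_minus_right: "X \<rhd> (- y) = - (X \<rhd> y)" by transfer (simp add: blinfun.minus_right)
lemma bapp_scaleR_right: "X \<rhd> (r *\<^sub>R x) = r *\<^sub>R (X \<rhd> x)" by transfer (simp add: blinfun.scaleR_right)
lemma bapp_scaleC_right: "X \<rhd> (c *\<^sub>C x) = c *\<^sub>C (X \<rhd> x)" by transfer simp

lemmas bapp_simps = bapp_add_left bapp_diff_left bapp_minus_left bapp_mult bapp_scaleR_left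
  bapp_add_right bapp_diff_right bapp_minus_right bapp_scaleR_right bapp_scaleC_right

lemma norm_bapp: "norm (X \<rhd> x) \<le> norm X * norm x"
  by transfer (rule norm_blinfun)

lemma norm_bop_le: "0 \<le> c \<Longrightarrow> (\<And>x. norm (X \<rhd> x) \<le> c * norm x) \<Longrightarrow> norm X \<le> c"
  by transfer (rule norm_blinfun_bound)

lemma bounded_clinear_bapp: "bounded_clinear (bapp X)"
  unfolding bounded_clinear_def
  by (auto simp: bapp_simps intro!: bounded_linear_intro[where K = "norm X"])
     (metis norm_bapp mult.commute)

definition Bop :: "('h::complex_hilbert \<Rightarrow> 'h) \<Rightarrow> 'h bop" where
  "Bop f = Abs_bop (Blinfun f)"

lemma bapp_Bop: "bounded_clinear f \<Longrightarrow> bapp (Bop f) = f"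
  unfolding Bop_def bounded_clinear_def bapp_def
  by (simp add: Abs_bop_inverse bounded_linear_Blinfun_apply)

instance bop :: (complex_hilbert) banach
proof
  fix X :: "nat \<Rightarrow> 'a bop"
  assume "Cauchy X"
  hence "Cauchy (\<lambda>n. Rep_bop (X n))"
    unfolding Cauchy_def dist_norm by (simp add: norm_bop.rep_eq minus_bop.rep_eq)
  hence "convergent (\<lambda>n. Rep_bop (X n))" by (rule Cauchy_convergent)
  then obtain Y where Y: "(\<lambda>n. Rep_bop (X n)) \<longlonglongrightarrow> Y"
    unfolding convergent_def by blast
  have lim: "(\<lambda>n. blinfun_apply (Rep_bop (X n)) x) \<longlonglongrightarrow> blinfun_apply Y x" for x
    by (intro blinfun.tendsto Y tendsto_const)
  have "blinfun_apply Y (c *\<^sub>C x) = c *\<^sub>C blinfun_apply Y x" for c x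
  proof (rule LIMSEQ_unique[OF lim])
    show "(\<lambda>n. blinfun_apply (Rep_bop (X n)) (c *\<^sub>C x)) \<longlonglongrightarrow> c *\<^sub>C blinfun_apply Y x"
    proof -
      have "blinfun_apply (Rep_bop (X n)) (c *\<^sub>C x) = c *\<^sub>C blinfun_apply (Rep_bop (X n)) x" for n
        using Rep_bop[of "X n"] by simp
      thus ?thesis using tendsto_scaleC[OF lim[of x], of c] by simp
    qed
  qed
  hence R: "Rep_bop (Abs_bop Y) = Y" by (simp add: Abs_bop_inverse)
  have "X \<longlonglongrightarrow> Abs_bop Y"
    using Y unfolding tendsto_iff dist_norm by (simp add: norm_bop.rep_eq minus_bop.rep_eq R)
  thus "convergent X" by (auto simp: convergent_def)
qed

lemma bounded_bilinear_bapp: "bounded_bilinear bapp"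
  by (rule bounded_bilinear.intro)
     (auto simp: bapp_simps intro!: exI[of _ 1] norm_bapp)

lemmas tendsto_bapp = bounded_bilinear.tendsto[OF bounded_bilinear_bapp]

lemma norm_one_bop_le: "norm (1 :: 'h::complex_hilbert bop) \<le> 1"
  by (rule norm_bop_le) simp_all

lemma norm_power_bop_le: "norm ((X :: 'h::complex_hilbert bop) ^ n) \<le> norm X ^ n"
proof (induction n)
  case (Suc n)
  have "norm (X ^ Suc n) \<le> norm X * norm (X ^ n)" by (simp add: norm_mult_ineq)
  also have "\<dots> \<le> norm X * norm X ^ n" using Suc by (simp add: mult_left_mono)
  finally show ?case by simp
qed (simp add: norm_one_bop_le)

section \<open>Complex scalars and the adjoint on \<open>bop\<close>\<close>

definition cscale :: "complex \<Rightarrow> 'h::complex_hilbert bop \<Rightarrow> 'h bop" where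
  "cscale c X = Bop (\<lambda>x. c *\<^sub>C (X \<rhd> x))"

lemma bapp_cscale [simp]: "cscale c X \<rhd> x = c *\<^sub>C (X \<rhd> x)"
proof -
  have "bounded_clinear (\<lambda>x. c *\<^sub>C (X \<rhd> x))"
    unfolding bounded_clinear_def
    by (auto simp: bapp_simps scaleC_scaleC mult.commute
        intro!: bounded_linear_compose[OF bounded_linear_scaleC]
        bounded_clinear_bapp[unfolded bounded_clinear_def, THEN conjunct1])
  thus ?thesis by (simp add: cscale_def bapp_Bop)
qed

lemma cscale_mult_left: "cscale c X * Y = cscale c (X * Y)"
  by (rule bop_eqI) (simp add: bapp_simps)

lemma cscale_mult_right: "X * cscale c Y = cscale c (X * Y)"
  by (rule bop_eqI) (simp add: bapp_simps)

lemma cscale_cscale: "cscale c (cscale d X) = cscale (c * d) X"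
  by (rule bop_eqI) (simp add: scaleC_scaleC)

lemma cscale_of_real: "cscale (of_real r) X = r *\<^sub>R X"
  by (rule bop_eqI) (simp add: bapp_simps scaleC_of_real)

lemma norm_cscale: "norm (cscale c X) = cmod c * norm X"
proof (rule antisym)
  have le: "norm (cscale c X) \<le> cmod c * norm X" for c and X :: "'a bop"
    by (rule norm_bop_le) (auto simp: mult.assoc intro!: mult_left_mono norm_bapp)
  show "norm (cscale c X) \<le> cmod c * norm X" by (rule le)
  show "cmod c * norm X \<le> norm (cscale c X)"
  proof (cases "c = 0")
    case False
    have "X = cscale (1 / c) (cscale c X)"
      using False by (simp add: cscale_cscale) (rule bop_eqI, simp)
    hence "norm X \<le> cmod (1 / c) * norm (cscale c X)" by (metis le)
    thus ?thesis using False by (simp add: norm_divide field_simps)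
  qed simp
qed

lemma cscale_power: "cscale c X ^ n = cscale (c ^ n) (X ^ n)"
proof (induction n)
  case 0
  show ?case by (rule bop_eqI) simp
next
  case (Suc n)
  thus ?case by (simp add: cscale_mult_left cscale_mult_right cscale_cscale mult.commute)
qed

definition star :: "'h::complex_hilbert bop \<Rightarrow> 'h bop" where
  "star X = Bop (\<lambda>y. SOME z. \<forall>x. cinner (X \<rhd> x) y = cinner x z)"

lemma cinner_eqI_right: "(\<And>z. cinner z x = cinner z y) \<Longrightarrow> x = y"
  by (metis cinner_eqI cinner_commute)

lemma cinner_star: "cinner (X \<rhd> x) y = cinner x (star X \<rhd> y)"
proof -
  define f where "f y = (SOME z. \<forall>x. cinner (X \<rhd> x) y = cinner x z)" for y
  have f: "cinner (X \<rhd> x) y = cinner x (f y)" for x y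
    unfolding f_def using adjoint_exists[OF bounded_clinear_bapp, of X y] by (rule someI2_ex) auto
  have add: "f (y + z) = f y + f z" for y z
    by (rule cinner_eqI_right) (simp add: f[symmetric] cinner_simps)
  have scaleC: "f (c *\<^sub>C y) = c *\<^sub>C f y" for c y
    by (rule cinner_eqI_right) (simp add: f[symmetric] cinner_simps)
  have "norm (f y) \<le> norm y * norm X" for y
  proof -
    have "(norm (f y))\<^sup>2 = cmod (cinner (f y) (f y))" by (simp add: cinner_self norm_power)
    also have "\<dots> = cmod (cinner (X \<rhd> f y) y)" by (simp add: f)
    also have "\<dots> \<le> norm (X \<rhd> f y) * norm y" by (rule cinner_Cauchy_Schwarz)
    also have "\<dots> \<le> (norm X * norm (f y)) * norm y" by (intro mult_right_mono norm_bapp) simp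
    finally show ?thesis
      by (cases "norm (f y) = 0") (auto simp: power2_eq_square mult_ac)
  qed
  hence "bounded_clinear f"
    unfolding bounded_clinear_def
    by (auto intro!: bounded_linear_intro[where K = "norm X"] simp: add scaleC scaleR_eq_scaleC)
  moreover have "star X = Bop f" by (simp add: star_def f_def[abs_def])
  ultimately show ?thesis by (simp add: bapp_Bop f)
qed

lemma star_eqI: "(\<And>x y. cinner (X \<rhd> x) y = cinner x (Y \<rhd> y)) \<Longrightarrow> star X = Y"
  by (rule bop_eqI, rule cinner_eqI_right) (simp add: cinner_star[symmetric])

lemma cinner_star': "cinner x (X \<rhd> y) = cinner (star X \<rhd> x) y"
  by (metis cinner_commute cinner_star)

lemma star_star [simp]: "star (star X) = X"
  by (rule star_eqI) (simp add: cinner_star')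
lemma star_one [simp]: "star 1 = 1" by (rule star_eqI) simp
lemma star_zero [simp]: "star 0 = 0" by (rule star_eqI) simp
lemma star_mult: "star (X * Y) = star Y * star X"
  by (rule star_eqI) (simp add: bapp_simps cinner_star)
lemma star_add: "star (X + Y) = star X + star Y"
  by (rule star_eqI) (simp add: bapp_simps cinner_simps cinner_star)
lemma star_diff: "star (X - Y) = star X - star Y"
  by (rule star_eqI) (simp add: bapp_simps cinner_simps cinner_star)
lemma star_scaleR: "star (r *\<^sub>R X) = r *\<^sub>R star X"
  by (rule star_eqI) (simp add: bapp_simps cinner_simps cinner_star)
lemma star_cscale: "star (cscale c X) = cscale (cnj c) (star X)"
  by (rule star_eqI) (simp add: bapp_simps cinner_simps cinner_star)
lemma star_power: "star (X ^ n) = star X ^ n"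
  by (induction n) (simp_all add: star_mult power_commutes)

lemmas star_simps = star_mult star_add star_diff star_scaleR star_cscale star_power

lemma norm_star [simp]: "norm (star X) = norm X"
proof -
  have "norm (star X) \<le> norm X" for X :: "'a bop"
  proof (rule norm_bop_le)
    fix y
    have "(norm (star X \<rhd> y))\<^sup>2 = cmod (cinner (X \<rhd> star X \<rhd> y) y)"
      by (simp add: cinner_star cinner_self norm_power)
    also have "\<dots> \<le> norm (X \<rhd> star X \<rhd> y) * norm y" by (rule cinner_Cauchy_Schwarz)
    also have "\<dots> \<le> (norm X * norm (star X \<rhd> y)) * norm y" by (intro mult_right_mono norm_bapp) simp
    finally show "norm (star X \<rhd> y) \<le> norm X * norm y"
      by (cases "norm (star X \<rhd> y) = 0") (auto simp: power2_eq_square mult_ac)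
  qed simp
  from this[of X] this[of "star X"] show ?thesis by simp
qed

subsection \<open>Positive operators\<close>

definition pos :: "'h::complex_hilbert bop \<Rightarrow> bool" where
  "pos X \<longleftrightarrow> (\<forall>x. cinner (X \<rhd> x) x \<in> \<real>\<^sub>\<ge>\<^sub>0)"

lemma pos_positive_op: "pos X \<longleftrightarrow> positive_op (bapp X)"
  by (simp add: pos_def positive_op_def bounded_clinear_bapp)

lemma bop_polarization:
  "4 * cinner (X \<rhd> x) y = cinner (X \<rhd> (x + y)) (x + y) - cinner (X \<rhd> (x - y)) (x - y)
     + \<i> * cinner (X \<rhd> (x + \<i> *\<^sub>C y)) (x + \<i> *\<^sub>C y)
     - \<i> * cinner (X \<rhd> (x - \<i> *\<^sub>C y)) (x - \<i> *\<^sub>C y)"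
  by (simp add: cinner_simps bapp_simps algebra_simps)

lemma bop_quadratic_eqI:
  assumes "\<And>x. cinner (X \<rhd> x) x = cinner (Y \<rhd> x) x"
  shows "X = Y"
proof (rule bop_eqI, rule cinner_eqI)
  fix x z
  have "4 * cinner (X \<rhd> x) z = 4 * cinner (Y \<rhd> x) z" unfolding bop_polarization assms ..
  thus "cinner (X \<rhd> x) z = cinner (Y \<rhd> x) z" by simp
qed

lemma self_adjoint_iff: "star X = X \<longleftrightarrow> (\<forall>x. cinner (X \<rhd> x) x \<in> \<real>)"
proof
  assume s: "star X = X"
  show "\<forall>x. cinner (X \<rhd> x) x \<in> \<real>"
  proof
    fix x
    have "cnj (cinner (X \<rhd> x) x) = cinner (X \<rhd> x) x"
      by (metis s cinner_star cinner_commute)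
    thus "cinner (X \<rhd> x) x \<in> \<real>" by (simp add: Reals_cnj_iff)
  qed
next
  assume r: "\<forall>x. cinner (X \<rhd> x) x \<in> \<real>"
  show "star X = X"
    by (rule bop_quadratic_eqI) (metis r Reals_cnj_iff cinner_commute cinner_star)
qed

lemma nonneg_Reals_iff: "z \<in> \<real>\<^sub>\<ge>\<^sub>0 \<longleftrightarrow> z \<in> \<real> \<and> 0 \<le> Re z"
  by (auto simp: complex_nonneg_Reals_iff complex_is_Real_iff)

lemma pos_iff: "pos X \<longleftrightarrow> star X = X \<and> (\<forall>x. 0 \<le> Re (cinner (X \<rhd> x) x))"
  by (auto simp: pos_def self_adjoint_iff nonneg_Reals_iff)

lemma pos_star: "pos X \<Longrightarrow> star X = X" by (simp add: pos_iff)
lemma pos_Re: "pos X \<Longrightarrow> 0 \<le> Re (cinner (X \<rhd> x) x)" by (simp add: pos_iff)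
lemma pos_zero [simp]: "pos 0" by (simp add: pos_iff)
lemma pos_one [simp]: "pos 1" by (simp add: pos_iff cinner_self)
lemma pos_add: "pos X \<Longrightarrow> pos Y \<Longrightarrow> pos (X + Y)"
  by (simp add: pos_iff star_add bapp_simps cinner_simps)
lemma pos_scaleR: "pos X \<Longrightarrow> 0 \<le> r \<Longrightarrow> pos (r *\<^sub>R X)"
  by (simp add: pos_iff star_scaleR bapp_simps cinner_simps)
lemma pos_conj: "pos X \<Longrightarrow> pos (star g * X * g)"
  using cinner_star[of "star g"] by (simp add: pos_def bapp_simps)
lemma pos_star_mult: "pos (star g * g)"
  using pos_conj[of 1 g] by simp

text \<open>For self-adjoint \<open>X\<close> the real part of the polarization identity involves
  only x + y and x - y, so the parallelogram law turns a bound on the quadratic form into one on the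
  sesquilinear form. It is tested at the multiple of \<open>X \<rhd> x\<close> that has the length
  of \<open>x\<close>.\<close>

lemma self_adjoint_norm_le:
  assumes "star X = X" and "0 \<le> c" and "\<And>x. \<bar>Re (cinner (X \<rhd> x) x)\<bar> \<le> c * (norm x)\<^sup>2"
  shows "norm X \<le> c"
proof (rule norm_bop_le)
  fix x
  have bnd: "4 * Re (cinner (X \<rhd> x) y) \<le> 2 * c * ((norm x)\<^sup>2 + (norm y)\<^sup>2)" for x y
  proof -
    have "cinner (X \<rhd> y) x = cnj (cinner (X \<rhd> x) y)"
      by (metis assms(1) cinner_star cinner_commute)
    hence "4 * Re (cinner (X \<rhd> x) y) = Re (cinner (X \<rhd> (x + y)) (x + y)) - Re (cinner (X \<rhd> (x - y)) (x - y))"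
      by (simp add: cinner_simps bapp_simps)
    also have "\<dots> \<le> c * (norm (x + y))\<^sup>2 + c * (norm (x - y))\<^sup>2"
      using assms(3)[of "x + y"] assms(3)[of "x - y"] by linarith
    also have "\<dots> = 2 * c * ((norm x)\<^sup>2 + (norm y)\<^sup>2)"
      by (simp add: power2_norm_eq_inner inner_simps inner_commute algebra_simps)
    finally show ?thesis .
  qed
  show "norm (X \<rhd> x) \<le> c * norm x"
  proof (cases "X \<rhd> x = 0 \<or> x = 0")
    case True
    thus ?thesis using assms(2) by auto
  next
    case False
    define r where "r = norm x / norm (X \<rhd> x)"
    have "4 * Re (cinner (X \<rhd> x) (r *\<^sub>R (X \<rhd> x))) \<le> 2 * c * ((norm x)\<^sup>2 + (norm (r *\<^sub>R (X \<rhd> x)))\<^sup>2)"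
      by (rule bnd)
    also have "norm (r *\<^sub>R (X \<rhd> x)) = norm x" using False by (simp add: r_def)
    also have "Re (cinner (X \<rhd> x) (r *\<^sub>R (X \<rhd> x))) = norm x * norm (X \<rhd> x)"
      using False by (simp add: cinner_simps cinner_self r_def power2_eq_square)
    finally have "norm x * norm (X \<rhd> x) \<le> norm x * (c * norm x)"
      by (simp add: power2_eq_square algebra_simps)
    thus ?thesis using False by simp
  qed
qed (rule assms)

lemma Re_cinner_bapp_le: "\<bar>Re (cinner (X \<rhd> x) x)\<bar> \<le> norm X * (norm x)\<^sup>2"
proof -
  have "\<bar>Re (cinner (X \<rhd> x) x)\<bar> \<le> cmod (cinner (X \<rhd> x) x)" by (rule abs_Re_le_cmod)
  also have "\<dots> \<le> norm (X \<rhd> x) * norm x" by (rule cinner_Cauchy_Schwarz)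
  also have "\<dots> \<le> (norm X * norm x) * norm x" by (intro mult_right_mono norm_bapp) simp
  finally show ?thesis by (simp add: power2_eq_square)
qed

lemma pos_norm_diff:
  fixes X :: "'a::complex_hilbert bop"
  assumes "star X = X" "norm X \<le> c"
  shows "pos (c *\<^sub>R 1 - X)"
  unfolding pos_iff
proof (intro conjI allI)
  fix x :: 'a
  have "norm X * (norm x)\<^sup>2 \<le> c * (norm x)\<^sup>2" using assms by (simp add: mult_right_mono)
  thus "0 \<le> Re (cinner ((c *\<^sub>R 1 - X) \<rhd> x) x)"
    using Re_cinner_bapp_le[of X x] by (simp add: bapp_simps cinner_simps cinner_self)
qed (simp add: star_simps assms)

lemma pos_norm_le:
  assumes "pos X" "pos (c *\<^sub>R 1 - X)" "0 \<le> c"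
  shows "norm X \<le> c"
  using assms(3) pos_Re[OF assms(1)] pos_Re[OF assms(2)]
  by (intro self_adjoint_norm_le[OF pos_star[OF assms(1)]])
     (simp_all add: bapp_simps cinner_simps cinner_self)

section \<open>The logarithm of the determinant of a positive invertible element\<close>

definition binv :: "'h::complex_hilbert bop \<Rightarrow> 'h bop" where
  "binv X = (THE V. X * V = 1 \<and> V * X = 1)"

lemma binv_eqI: "X * V = 1 \<Longrightarrow> V * X = 1 \<Longrightarrow> binv X = V"
  unfolding binv_def by (rule the_equality) (auto, metis mult.assoc mult_1_left mult_1_right)

lemma Neumann_series:
  fixes Y :: "'h::complex_hilbert bop"
  assumes "norm Y < 1"
  shows "summable (\<lambda>n. Y ^ n)" "(1 - Y) * (\<Sum>n. Y ^ n) = 1" "(\<Sum>n. Y ^ n) * (1 - Y) = 1"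
proof -
  show s: "summable (\<lambda>n. Y ^ n)"
    by (rule summable_comparison_test'[of "\<lambda>n. norm Y ^ n" 0])
       (use assms in \<open>auto intro: summable_geometric norm_power_bop_le\<close>)
  have "(\<Sum>n. Y ^ n) = 1 + (\<Sum>n. Y ^ Suc n)"
    using suminf_split_head[OF s] by simp
  moreover have "(\<Sum>n. Y ^ Suc n) = Y * (\<Sum>n. Y ^ n)"
    using bounded_linear.suminf[OF bounded_linear_mult_right s, of Y] by simp
  moreover have "(\<Sum>n. Y ^ Suc n) = (\<Sum>n. Y ^ n) * Y"
    using bounded_linear.suminf[OF bounded_linear_mult_left s, of Y] by (simp only: power_Suc2)
  ultimately show "(1 - Y) * (\<Sum>n. Y ^ n) = 1" "(\<Sum>n. Y ^ n) * (1 - Y) = 1"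
    by (simp_all add: left_diff_distrib right_diff_distrib)
qed

lemma deriv_le_imp_diff_le:
  fixes f g :: "real \<Rightarrow> real"
  assumes "\<And>s. s \<in> {0..1} \<Longrightarrow> (f has_real_derivative f' s) (at s within {0..1})"
    and "\<And>s. s \<in> {0..1} \<Longrightarrow> (g has_real_derivative g' s) (at s within {0..1})"
    and "\<And>s. s \<in> {0..1} \<Longrightarrow> f' s \<le> g' s"
  shows "f 1 - f 0 \<le> g 1 - g 0"
proof -
  have "g 0 - f 0 \<le> g 1 - f 1"
  proof (rule DERIV_nonneg_imp_increasing_open[of 0 1 "\<lambda>s. g s - f s"])
    show "continuous_on {0..1} (\<lambda>s. g s - f s)"
      by (intro continuous_on_diff; rule DERIV_continuous_on; rule assms)
    fix s :: real assume s: "0 < s" "s < 1"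
    have "((\<lambda>s. g s - f s) has_real_derivative g' s - f' s) (at s within {0..1})"
      using s by (intro derivative_intros assms) auto
    hence "((\<lambda>s. g s - f s) has_real_derivative g' s - f' s) (at s)"
      using s by (simp add: at_within_Icc_at)
    thus "\<exists>y. ((\<lambda>s. g s - f s) has_real_derivative y) (at s) \<and> 0 \<le> y"
      using assms(3)[of s] s by force
  qed simp
  thus ?thesis by simp
qed

lemma deriv_eq_imp_diff_eq:
  fixes f g :: "real \<Rightarrow> real"
  assumes "\<And>s. s \<in> {0..1} \<Longrightarrow> (f has_real_derivative f' s) (at s within {0..1})"
    and "\<And>s. s \<in> {0..1} \<Longrightarrow> (g has_real_derivative f' s) (at s within {0..1})"
  shows "f 1 - f 0 = g 1 - g 0"
  using deriv_le_imp_diff_le[OF assms] deriv_le_imp_diff_le[OF assms(2,1)] by force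

lemma ln_one_minus_sums:
  fixes x :: real
  assumes "\<bar>x\<bar> < 1"
  shows "(\<lambda>n. x ^ Suc n / real (Suc n)) sums (- ln (1 - x))"
proof -
  have "(\<lambda>n. (-1) ^ n * (1 / real (n + 1)) * ((1 - x) - 1) ^ Suc n) = (\<lambda>n. - (x ^ Suc n / real (Suc n)))"
  proof
    fix n
    have "(-1) ^ n * ((1 - x) - 1) ^ Suc n = - (x ^ Suc n)" by (cases "even n") auto
    thus "(-1) ^ n * (1 / real (n + 1)) * ((1 - x) - 1) ^ Suc n = - (x ^ Suc n / real (Suc n))"
      by simp
  qed
  moreover have "summable (\<lambda>n. x ^ Suc n / real (Suc n))"
  proof (rule summable_comparison_test'[of "\<lambda>n. \<bar>x\<bar> ^ n" 0])
    show "summable (\<lambda>n. \<bar>x\<bar> ^ n)" using assms by (auto intro: summable_geometric)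
    fix n :: nat
    have "norm (x ^ Suc n / real (Suc n)) = \<bar>x\<bar> ^ n * (\<bar>x\<bar> / real (Suc n))"
      by (simp add: power_abs abs_mult)
    also have "\<dots> \<le> \<bar>x\<bar> ^ n * 1"
      by (rule mult_left_mono) (use assms in \<open>auto simp: divide_le_eq\<close>)
    finally show "norm (x ^ Suc n / real (Suc n)) \<le> \<bar>x\<bar> ^ n" by simp
  qed
  ultimately show ?thesis
    using ln_series[of "1 - x"] assms by (simp add: sums_iff suminf_minus abs_less_iff)
qed

text \<open>A norm-closed unital star-algebra with a tracial state is the setting of the logarithm
  calculus, whose limits are all norm limits. Strong limits and normality come in with the spectral
  measures.\<close>

locale tracial_algebra =
  fixes N :: "'h::complex_hilbert bop set" and tr :: "'h bop \<Rightarrow> complex"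
  assumes one_mem [simp, intro]: "1 \<in> N"
    and add_mem [simp, intro]: "X \<in> N \<Longrightarrow> Y \<in> N \<Longrightarrow> X + Y \<in> N"
    and mult_mem [simp, intro]: "X \<in> N \<Longrightarrow> Y \<in> N \<Longrightarrow> X * Y \<in> N"
    and cscale_mem [simp, intro]: "X \<in> N \<Longrightarrow> cscale c X \<in> N"
    and star_mem [simp, intro]: "X \<in> N \<Longrightarrow> star X \<in> N"
    and limit_mem: "(\<And>n. Z n \<in> N) \<Longrightarrow> Z \<longlonglongrightarrow> X \<Longrightarrow> X \<in> N"
    and tr_add: "X \<in> N \<Longrightarrow> Y \<in> N \<Longrightarrow> tr (X + Y) = tr X + tr Y"
    and tr_cscale: "X \<in> N \<Longrightarrow> tr (cscale c X) = c * tr X"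
    and tr_pos: "X \<in> N \<Longrightarrow> pos X \<Longrightarrow> tr X \<in> \<real>\<^sub>\<ge>\<^sub>0"
    and tr_one: "tr 1 = 1"
    and tr_comm: "X \<in> N \<Longrightarrow> Y \<in> N \<Longrightarrow> tr (X * Y) = tr (Y * X)"
begin

lemma scaleR_mem [simp, intro]: "X \<in> N \<Longrightarrow> r *\<^sub>R X \<in> N"
  using cscale_mem[of X "of_real r"] by (simp add: cscale_of_real)

lemma minus_mem [simp, intro]: "X \<in> N \<Longrightarrow> - X \<in> N"
  using scaleR_mem[of X "-1"] by simp

lemma diff_mem [simp, intro]: "X \<in> N \<Longrightarrow> Y \<in> N \<Longrightarrow> X - Y \<in> N"
  using add_mem[of X "- Y"] by simp

lemma zero_mem [simp, intro]: "0 \<in> N"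
  using diff_mem[of 1 1] by simp

lemma power_mem [simp, intro]: "X \<in> N \<Longrightarrow> X ^ n \<in> N"
  by (induction n) auto

lemma sum_mem: "(\<And>i. i \<in> I \<Longrightarrow> f i \<in> N) \<Longrightarrow> sum f I \<in> N"
  by (induction I rule: infinite_finite_induct) auto

definition rt :: "'h bop \<Rightarrow> real" where "rt X = Re (tr X)"

lemma tr_scaleR: "X \<in> N \<Longrightarrow> tr (r *\<^sub>R X) = of_real r * tr X"
  using tr_cscale[of X "of_real r"] by (simp add: cscale_of_real)

lemma rt_add: "X \<in> N \<Longrightarrow> Y \<in> N \<Longrightarrow> rt (X + Y) = rt X + rt Y"
  by (simp add: rt_def tr_add)

lemma rt_scaleR: "X \<in> N \<Longrightarrow> rt (r *\<^sub>R X) = r * rt X"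
  by (simp add: rt_def tr_scaleR)

lemma rt_minus: "X \<in> N \<Longrightarrow> rt (- X) = - rt X"
  using rt_scaleR[of X "-1"] by simp

lemma rt_diff: "X \<in> N \<Longrightarrow> Y \<in> N \<Longrightarrow> rt (X - Y) = rt X - rt Y"
  using rt_add[of X "- Y"] by (simp add: rt_minus)

lemma rt_zero [simp]: "rt 0 = 0"
  using rt_diff[of 1 1] by simp

lemma rt_one [simp]: "rt 1 = 1" by (simp add: rt_def tr_one)

lemma rt_comm: "X \<in> N \<Longrightarrow> Y \<in> N \<Longrightarrow> rt (X * Y) = rt (Y * X)"
  by (simp add: rt_def tr_comm)

lemma rt_pos: "X \<in> N \<Longrightarrow> pos X \<Longrightarrow> 0 \<le> rt X"
  using tr_pos by (auto simp: rt_def complex_nonneg_Reals_iff)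

text \<open>Both 1 and \<open>norm X *\<^sub>R 1 - X\<close> are positive, so their traces are
  real.\<close>

lemma tr_self_adjoint:
  assumes "X \<in> N" "star X = X"
  shows "tr X \<in> \<real>"
proof -
  have "pos (norm X *\<^sub>R 1 - X)" using assms by (intro pos_norm_diff) auto
  hence "tr (norm X *\<^sub>R 1 - X) \<in> \<real>" using tr_pos assms(1) by (auto simp: nonneg_Reals_iff)
  moreover have "tr (norm X *\<^sub>R 1 - X) = of_real (norm X) + (-1) * tr X"
    using tr_add[of "norm X *\<^sub>R 1" "(-1) *\<^sub>R X"] assms(1) by (simp only: tr_scaleR) (simp add: tr_scaleR tr_one tr_scaleR[of X "-1", simplified])
  ultimately have "of_real (norm X) - tr X \<in> \<real>" by simp
  thus ?thesis by (simp add: complex_is_Real_iff)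
qed

lemma tr_star:
  assumes "X \<in> N"
  shows "tr (star X) = cnj (tr X)"
proof -
  define H where "H = X + star X"
  define K where "K = cscale (- \<i>) (X + cscale (-1) (star X))"
  have sa: "star H = H" "star K = K"
    by (simp_all add: H_def K_def star_simps add.commute)
       (rule bop_eqI, simp add: bapp_simps scaleC_add_right scaleC_scaleC)
  have mem: "H \<in> N" "K \<in> N" using assms by (auto simp: H_def K_def)
  have H: "tr H = tr X + tr (star X)" and K: "tr K = - \<i> * (tr X - tr (star X))"
    using assms by (simp_all add: H_def K_def tr_add tr_cscale)
  have "tr H \<in> \<real>" "tr K \<in> \<real>" using tr_self_adjoint mem sa by blast+
  thus ?thesis unfolding H K by (simp add: complex_is_Real_iff complex_eq_iff)
qed

lemma rt_star: "X \<in> N \<Longrightarrow> rt (star X) = rt X"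
  by (simp add: rt_def tr_star)

text \<open>The self-adjoint part of \<open>X\<close> has the same \<open>rt\<close> and no larger
  norm, and a self-adjoint element lies below its norm.\<close>

lemma abs_rt_le:
  assumes "X \<in> N"
  shows "\<bar>rt X\<bar> \<le> norm X"
proof -
  have *: "rt X \<le> norm X" if "X \<in> N" for X
  proof -
    define H where "H = (1/2) *\<^sub>R (X + star X)"
    have H: "H \<in> N" "star H = H" using that by (auto simp: H_def star_simps add.commute)
    have "norm H \<le> norm X"
      using norm_triangle_ineq[of X "star X"] by (simp add: H_def)
    hence "pos (norm X *\<^sub>R 1 - H)" using H by (intro pos_norm_diff) auto
    hence "0 \<le> rt (norm X *\<^sub>R 1 - H)" using H by (intro rt_pos) auto
    also have "\<dots> = norm X - rt H" using H by (simp add: rt_diff rt_scaleR)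
    also have "rt H = rt X" using that by (simp add: H_def rt_scaleR rt_add rt_star)
    finally show ?thesis by simp
  qed
  show ?thesis using *[OF assms] *[of "- X"] assms by (simp add: rt_minus abs_le_iff)
qed

lemma cmod_tr_le:
  assumes "X \<in> N"
  shows "cmod (tr X) \<le> norm X"
proof (cases "tr X = 0")
  case False
  define c where "c = cnj (tr X) / of_real (cmod (tr X))"
  have "c * tr X = of_real (cmod (tr X))"
    using False by (simp add: c_def complex_norm_square[symmetric] power2_eq_square mult.commute)
  hence "cmod (tr X) = rt (cscale c X)" using assms by (simp add: rt_def tr_cscale)
  also have "\<dots> \<le> norm (cscale c X)" using abs_rt_le[of "cscale c X"] assms by auto
  also have "\<dots> = norm X" using False by (simp add: norm_cscale c_def norm_divide)
  finally show ?thesis .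
qed simp

lemma rt_tendsto:
  assumes "\<And>n. Z n \<in> N" "Z \<longlonglongrightarrow> X"
  shows "(\<lambda>n. rt (Z n)) \<longlonglongrightarrow> rt X"
proof -
  have X: "X \<in> N" using assms by (rule limit_mem)
  have "(\<lambda>n. norm (Z n - X)) \<longlonglongrightarrow> 0" using assms(2) by (simp add: LIM_zero tendsto_norm_zero)
  moreover have "norm (rt (Z n) - rt X) \<le> norm (Z n - X)" for n
    using abs_rt_le[of "Z n - X"] assms(1) X by (simp add: rt_diff)
  ultimately have "(\<lambda>n. rt (Z n) - rt X) \<longlonglongrightarrow> 0"
    by (intro Lim_null_comparison[of "\<lambda>n. rt (Z n) - rt X" "\<lambda>n. norm (Z n - X)"]
        always_eventually allI)
  thus ?thesis by (rule LIM_zero_cancel)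
qed

lemma rt_sum: "(\<And>i. i \<in> I \<Longrightarrow> f i \<in> N) \<Longrightarrow> rt (sum f I) = (\<Sum>i\<in>I. rt (f i))"
  by (induction I rule: infinite_finite_induct) (auto simp: rt_add sum_mem)

lemma rt_sums:
  assumes "\<And>n. Z n \<in> N" "Z sums X"
  shows "(\<lambda>n. rt (Z n)) sums rt X" "X \<in> N"
  using assms rt_tendsto[of "\<lambda>n. sum Z {..<n}" X] limit_mem[of "\<lambda>n. sum Z {..<n}" X]
  by (auto simp: sums_def rt_sum sum_mem)

text \<open>With \<open>0 \<le> q \<le> 1\<close> and \<open>q\<^sub>n\<^sub>+\<^sub>1 = q\<^sub>n - q\<^sub>n\<^sup>2\<close>, the operator \<open>q\<close> is the sum of the squares
  \<open>q\<^sub>n\<^sup>2\<close> in the trace norm; this replaces a square root of \<open>q\<close>.\<close>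

lemma rt_mult_pos:
  assumes p: "p \<in> N" "pos p" and q: "q \<in> N" "pos q"
  shows "0 \<le> rt (p * q)"
proof -
  have main: "0 \<le> rt (p * q)" if q: "q \<in> N" "pos q" "norm q \<le> 1" for q
  proof -
    define Q where "Q = rec_nat q (\<lambda>_ X. X - X * X)"
    have Q0: "Q 0 = q" and QS: "Q (Suc n) = Q n - Q n * Q n" for n by (simp_all add: Q_def)
    have Q: "Q n \<in> N \<and> pos (Q n) \<and> pos (1 - Q n)" for n
    proof (induction n)
      case 0
      show ?case using q pos_norm_diff[of q 1] by (simp add: Q0 pos_star)
    next
      case (Suc n)
      let ?X = "Q n"
      have s: "star ?X = ?X" "star (1 - ?X) = 1 - ?X" using Suc by (simp_all add: pos_star)
      \<comment> \<open>X - X^2 = (1 - X) X (1 - X) + X (1 - X) X is a sum of conjugates of positive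
        elements; this keeps the recursion inside [0, 1].\<close>
      have "pos (star (1 - ?X) * ?X * (1 - ?X) + star ?X * (1 - ?X) * ?X)"
        using Suc by (intro pos_add pos_conj) auto
      also have "star (1 - ?X) * ?X * (1 - ?X) + star ?X * (1 - ?X) * ?X = Q (Suc n)"
        unfolding s QS by (simp add: algebra_simps)
      finally have 1: "pos (Q (Suc n))" .
      have "pos ((1 - ?X) + star ?X * ?X)"
        using Suc by (intro pos_add pos_star_mult) auto
      hence "pos (1 - Q (Suc n))" unfolding s QS by (simp add: algebra_simps)
      thus ?case using 1 Suc by (auto simp: QS)
    qed
    have sq: "0 \<le> rt (X * X)" if "X \<in> N" "star X = X" for X
      using rt_pos[OF _ pos_star_mult[of X]] that by auto
    \<comment> \<open>The sums telescope and stay below \<open>rt q\<close>, so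
      \<open>rt (Q n * Q n)\<close> tends to 0: the remainder \<open>Q n\<close> is small in the
      trace's 2-norm.\<close>
    have tele: "(\<Sum>i<n. rt (Q i * Q i)) = rt q - rt (Q n)" for n
      by (induction n) (use Q in \<open>auto simp: Q0 QS rt_diff\<close>)
    have "summable (\<lambda>i. rt (Q i * Q i))"
    proof (rule bounded_imp_summable)
      show "0 \<le> rt (Q i * Q i)" for i using Q[of i] sq pos_star by blast
      show "(\<Sum>i\<le>n. rt (Q i * Q i)) \<le> rt q" for n
        unfolding lessThan_Suc_atMost[symmetric] tele using Q rt_pos by simp
    qed
    hence lim: "(\<lambda>i. rt (Q i * Q i)) \<longlonglongrightarrow> 0" by (rule summable_LIMSEQ_zero)
    \<comment> \<open>By the trace property the term removed at each stage is the trace of Q p Q,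
      which is nonnegative.\<close>
    have dec: "rt (p * Q n) \<le> rt (p * q)" for n
    proof (induction n)
      case (Suc n)
      have "rt (p * Q (Suc n)) = rt (p * Q n) - rt (p * (Q n * Q n))"
        using p Q[of n] by (simp add: QS right_diff_distrib rt_diff)
      moreover have "rt (p * (Q n * Q n)) = rt (star (Q n) * p * Q n)"
        using rt_comm[of "p * Q n" "Q n"] p Q[of n] by (simp add: mult.assoc pos_star)
      moreover have "0 \<le> rt (star (Q n) * p * Q n)"
        using p Q[of n] by (intro rt_pos pos_conj) auto
      ultimately show ?case using Suc by simp
    qed (simp add: Q0)
    \<comment> \<open>A Cauchy-Schwarz argument with parameter t: positivity of the square of t p +
      \<open>Q n\<close> bounds \<open>rt (p * Q n)\<close> from below; n tends to infinity before t
      tends to 0.\<close>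
    have "- t * rt (p * p) \<le> 2 * rt (p * q)" if t: "t > 0" for t
    proof -
      have "- t * rt (p * p) - rt (Q n * Q n) / t \<le> 2 * rt (p * q)" for n
      proof -
        let ?Z = "t *\<^sub>R p + Q n"
        have mem: "p * p \<in> N" "p * Q n \<in> N" "Q n * p \<in> N" "Q n * Q n \<in> N" using p Q by auto
        have "star ?Z = ?Z" using p Q[of n] by (simp add: star_simps pos_star)
        hence "0 \<le> rt (?Z * ?Z)" using p Q[of n] by (intro sq) auto
        also have "?Z * ?Z = t\<^sup>2 *\<^sub>R (p * p) + t *\<^sub>R (p * Q n) + t *\<^sub>R (Q n * p) + Q n * Q n"
          by (simp add: algebra_simps power2_eq_square)
        also have "rt \<dots> = t\<^sup>2 * rt (p * p) + 2 * t * rt (p * Q n) + rt (Q n * Q n)"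
          using mem rt_comm[of p "Q n"] p Q[of n] by (simp add: rt_add rt_scaleR)
        finally have "0 \<le> t * (t * rt (p * p) + 2 * rt (p * Q n) + rt (Q n * Q n) / t)"
          using t by (simp add: algebra_simps power2_eq_square)
        hence "0 \<le> t * rt (p * p) + 2 * rt (p * Q n) + rt (Q n * Q n) / t"
          using t by (simp add: zero_le_mult_iff)
        thus ?thesis using dec[of n] by linarith
      qed
      moreover have "(\<lambda>n. - t * rt (p * p) - rt (Q n * Q n) / t) \<longlonglongrightarrow> - t * rt (p * p) - 0 / t"
        by (intro tendsto_intros lim) (use t in auto)
      ultimately have "- t * rt (p * p) - 0 / t \<le> 2 * rt (p * q)"
        by (intro LIMSEQ_le_const2) auto
      thus ?thesis by simp
    qed
    moreover have "((\<lambda>t. - t * rt (p * p)) \<longlongrightarrow> - 0 * rt (p * p)) (at_right 0)"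
      by (intro tendsto_intros)
    ultimately have "- 0 * rt (p * p) \<le> 2 * rt (p * q)"
      by (intro tendsto_upperbound[where F = "at_right (0::real)"]) (auto simp: eventually_at_right_less intro: eventually_at_rightI[of 0 1])
    thus ?thesis by simp
  qed
  show ?thesis
  proof (cases "q = 0")
    case False
    have "0 \<le> rt (p * ((1 / norm q) *\<^sub>R q))"
      using q False by (intro main pos_scaleR) auto
    also have "\<dots> = (1 / norm q) * rt (p * q)" using p q by (simp add: rt_scaleR)
    finally show ?thesis using False by (simp add: zero_le_divide_iff)
  qed simp
qed

subsection \<open>Derivative of the trace of a logarithm\<close>

text \<open>\<open>rt\<close> is known to be linear and contractive only on \<open>N\<close>, so the
  difference quotients are compared by hand instead of composing with a bounded linear map.\<close>

lemma rt_has_real_derivative: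
  assumes "(Z has_vector_derivative Z') (at s within S)" "\<And>u. u \<in> S \<Longrightarrow> Z u \<in> N" "s \<in> S" "Z' \<in> N"
  shows "((\<lambda>u. rt (Z u)) has_real_derivative rt Z') (at s within S)"
proof -
  have "((\<lambda>u. norm (Z u - Z s - (u - s) *\<^sub>R Z') / norm (u - s)) \<longlongrightarrow> 0) (at s within S)"
    using assms(1) unfolding has_vector_derivative_def has_derivative_iff_norm by simp
  hence "((\<lambda>u. norm (rt (Z u) - rt (Z s) - (u - s) * rt Z') / norm (u - s)) \<longlongrightarrow> 0) (at s within S)"
  proof (rule Lim_null_comparison[rotated])
    show "\<forall>\<^sub>F u in at s within S. norm (norm (rt (Z u) - rt (Z s) - (u - s) * rt Z') / norm (u - s))
        \<le> norm (Z u - Z s - (u - s) *\<^sub>R Z') / norm (u - s)"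
    proof (rule eventually_at_topological[THEN iffD2, OF exI[of _ UNIV]], intro conjI ballI impI)
      fix u assume "u \<in> S"
      hence "rt (Z u) - rt (Z s) - (u - s) * rt Z' = rt (Z u - Z s - (u - s) *\<^sub>R Z')"
        using assms by (simp add: rt_diff rt_scaleR)
      thus "norm (norm (rt (Z u) - rt (Z s) - (u - s) * rt Z') / norm (u - s))
        \<le> norm (Z u - Z s - (u - s) *\<^sub>R Z') / norm (u - s)"
        using abs_rt_le[of "Z u - Z s - (u - s) *\<^sub>R Z'"] assms \<open>u \<in> S\<close>
        by (auto intro!: divide_right_mono)
    qed auto
  qed
  thus ?thesis
    unfolding has_field_derivative_def has_derivative_iff_norm
    by (simp add: bounded_linear_mult_right mult.commute)
qed

text \<open>The derivative of Y^(n+1) is a sum of n + 1 words with a single factor Y'; under a trace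
  they all agree, which cancels the denominator.\<close>

lemma rt_power_has_real_derivative:
  assumes Y: "(Y has_vector_derivative Y') (at s within S)" "\<And>u. u \<in> S \<Longrightarrow> Y u \<in> N"
    and s: "s \<in> S" and Y': "Y' \<in> N"
  shows "((\<lambda>u. rt (Y u ^ Suc n) / real (Suc n)) has_real_derivative rt (Y s ^ n * Y')) (at s within S)"
proof -
  define D where "D = rec_nat 0 (\<lambda>n X. Y s * X + Y' * Y s ^ n)"
  have D0: "D 0 = 0" and DS: "D (Suc n) = Y s * D n + Y' * Y s ^ n" for n by (simp_all add: D_def)
  have D: "((\<lambda>u. Y u ^ n) has_vector_derivative D n) (at s within S)" for n
  proof (induction n)
    case (Suc n)
    show ?case using has_vector_derivative_mult[OF Y(1) Suc] by (simp add: DS)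
  qed (simp add: D0)
  have mem: "D n \<in> N" for n by (induction n) (use Y(2)[OF s] Y' in \<open>auto simp: D0 DS\<close>)
  \<comment> \<open>The extra factor \<open>Y s ^ k\<close> on the left makes the induction go
    through; k = 0 is what is used.\<close>
  have rtD: "rt (Y s ^ k * D (Suc n)) = real (Suc n) * rt (Y s ^ (k + n) * Y')" for k n
  proof (induction n arbitrary: k)
    case 0
    show ?case by (simp add: DS D0)
  next
    case (Suc n)
    have "Y s ^ k * D (Suc (Suc n)) = Y s ^ (Suc k) * D (Suc n) + Y s ^ k * Y' * Y s ^ Suc n"
      by (simp only: DS[of "Suc n"] distrib_left power_Suc2 mult.assoc)
    hence "rt (Y s ^ k * D (Suc (Suc n))) = rt (Y s ^ (Suc k) * D (Suc n)) + rt (Y s ^ k * Y' * Y s ^ Suc n)"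
      using mem[of "Suc n"] Y(2)[OF s] Y' by (simp add: rt_add)
    also have "rt (Y s ^ k * Y' * Y s ^ Suc n) = rt (Y s ^ Suc n * (Y s ^ k * Y'))"
      using Y(2)[OF s] Y' by (intro rt_comm) auto
    also have "Y s ^ Suc n * (Y s ^ k * Y') = Y s ^ (k + Suc n) * Y'"
      by (simp only: mult.assoc[symmetric] power_add[symmetric] add.commute)
    also have "rt (Y s ^ (Suc k) * D (Suc n)) = real (Suc n) * rt (Y s ^ (k + Suc n) * Y')"
      by (simp only: Suc) simp
    finally show ?case by (simp only: of_nat_Suc distrib_right mult_1_left)
  qed
  have "((\<lambda>u. rt (Y u ^ Suc n)) has_real_derivative rt (D (Suc n))) (at s within S)"
    using Y(2) by (intro rt_has_real_derivative[OF D _ s mem]) auto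
  hence "((\<lambda>u. rt (Y u ^ Suc n) / real (Suc n)) has_real_derivative rt (D (Suc n)) / real (Suc n)) (at s within S)"
    by (rule DERIV_cdivide)
  also have "rt (D (Suc n)) / real (Suc n) = rt (Y s ^ n * Y')"
    using rtD[of 0 n] by simp
  finally show ?thesis .
qed

text \<open>The real part of the trace of -log(1 - Y).\<close>

definition lser :: "'h bop \<Rightarrow> real" where
  "lser Y = (\<Sum>n. rt (Y ^ Suc n) / real (Suc n))"

lemma lser_summable:
  assumes "Y \<in> N" "norm Y < 1"
  shows "summable (\<lambda>n. rt (Y ^ Suc n) / real (Suc n))"
proof (rule summable_comparison_test'[of "\<lambda>n. norm Y ^ n" 0])
  show "summable (\<lambda>n. norm Y ^ n)" using assms by (auto intro: summable_geometric)
  fix n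
  have "\<bar>rt (Y ^ Suc n)\<bar> \<le> norm (Y ^ Suc n)" using assms by (intro abs_rt_le) auto
  also have "\<dots> \<le> norm Y ^ Suc n" by (rule norm_power_bop_le)
  also have "\<dots> \<le> norm Y ^ n" using assms by (auto intro: mult_left_le_one_le)
  finally have "\<bar>rt (Y ^ Suc n)\<bar> \<le> norm Y ^ n" .
  moreover have "\<bar>rt (Y ^ Suc n)\<bar> / real (Suc n) \<le> \<bar>rt (Y ^ Suc n)\<bar> / 1"
    by (intro divide_left_mono) auto
  ultimately show "norm (rt (Y ^ Suc n) / real (Suc n)) \<le> norm Y ^ n"
    by (simp add: abs_divide)
qed

text \<open>Termwise differentiation produces the geometric series of (1 - Y)^{-1}. The uniform
  bounds \<open>q\<close> and \<open>B\<close> supply the summable majorant \<open>q ^ n * B\<close>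
  for it.\<close>

lemma lser_has_real_derivative:
  assumes Y: "\<And>s. s \<in> {0..1} \<Longrightarrow> (Y has_vector_derivative Y' s) (at s within {0..1})"
    and mem: "\<And>s. s \<in> {0..1} \<Longrightarrow> Y s \<in> N" "\<And>s. s \<in> {0..1} \<Longrightarrow> Y' s \<in> N"
    and q: "\<And>s. s \<in> {0..1} \<Longrightarrow> norm (Y s) \<le> q" "q < 1"
    and B: "\<And>s. s \<in> {0..1} \<Longrightarrow> norm (Y' s) \<le> B"
    and s: "s \<in> {0..1}"
  shows "((\<lambda>s. lser (Y s)) has_real_derivative rt (binv (1 - Y s) * Y' s)) (at s within {0..1})"
proof -
  have q0: "0 \<le> q" using q(1)[of 0] norm_ge_zero[of "Y 0"] by (simp, linarith)
  have nY: "norm (Y u) < 1" if "u \<in> {0..1}" for u using q(1)[OF that] q(2) by simp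
  have "uniform_limit {0..1} (\<lambda>n s. \<Sum>i<n. rt (Y s ^ i * Y' s)) (\<lambda>s. \<Sum>i. rt (Y s ^ i * Y' s)) sequentially"
  proof (rule Weierstrass_m_test)
    fix n u assume u: "u \<in> {0..1::real}"
    have "norm (rt (Y u ^ n * Y' u)) \<le> norm (Y u ^ n * Y' u)"
      using abs_rt_le mem u by simp
    also have "\<dots> \<le> norm (Y u ^ n) * norm (Y' u)" by (rule norm_mult_ineq)
    also have "\<dots> \<le> q ^ n * B"
      using q0 B[OF u] q(1)[OF u] order_trans[OF norm_power_bop_le power_mono[OF q(1)[OF u]]]
      by (intro mult_mono) auto
    finally show "norm (rt (Y u ^ n * Y' u)) \<le> q ^ n * B" .
  next
    show "summable (\<lambda>n. q ^ n * B)"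
      using q q0 by (intro summable_mult2 summable_geometric) auto
  qed
  note UL = this
  have D: "((\<lambda>u. rt (Y u ^ Suc n) / real (Suc n)) has_real_derivative rt (Y u ^ n * Y' u))
      (at u within {0..1})" if "u \<in> {0..1}" for n u
    by (rule rt_power_has_real_derivative[OF Y[OF that] mem(1) that mem(2)[OF that]])
  have S: "summable (\<lambda>n. rt (Y 0 ^ Suc n) / real (Suc n))"
    by (rule lser_summable) (auto intro: mem nY)
  have "\<exists>g. \<forall>u\<in>{0..1}. (\<lambda>n. rt (Y u ^ Suc n) / real (Suc n)) sums g u \<and>
      (g has_real_derivative (\<Sum>i. rt (Y u ^ i * Y' u))) (at u within {0..1})"
    using has_field_derivative_series[of "{0..1::real}" "\<lambda>n u. rt (Y u ^ Suc n) / real (Suc n)"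
        "\<lambda>n u. rt (Y u ^ n * Y' u)" "\<lambda>s. \<Sum>i. rt (Y s ^ i * Y' s)" 0, OF convex_real_interval(5) D UL _ S]
    by simp
  then obtain g where g: "\<And>u. u \<in> {0..1} \<Longrightarrow> (\<lambda>n. rt (Y u ^ Suc n) / real (Suc n)) sums g u"
      "\<And>u. u \<in> {0..1} \<Longrightarrow> (g has_real_derivative (\<Sum>i. rt (Y u ^ i * Y' u))) (at u within {0..1})"
    by blast
  have "(\<lambda>i. Y s ^ i * Y' s) sums ((\<Sum>i. Y s ^ i) * Y' s)"
    by (intro bounded_linear.sums[OF bounded_linear_mult_left] summable_sums Neumann_series nY s)
  moreover have "binv (1 - Y s) = (\<Sum>i. Y s ^ i)"
    using Neumann_series[OF nY[OF s]] by (intro binv_eqI)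
  ultimately have "(\<lambda>i. rt (Y s ^ i * Y' s)) sums rt (binv (1 - Y s) * Y' s)"
    using rt_sums(1)[of "\<lambda>i. Y s ^ i * Y' s"] mem[OF s] by simp
  hence gd: "(g has_real_derivative rt (binv (1 - Y s) * Y' s)) (at s within {0..1})"
    using g(2)[OF s] by (simp add: sums_iff)
  have eq: "g u = lser (Y u)" if "u \<in> {0..1}" for u
    using g(1)[OF that] by (simp add: lser_def sums_iff)
  show ?thesis
    by (rule has_field_derivative_transform_within[OF gd zero_less_one s]) (rule eq)
qed

end

lemma inverse_mult_cancel: "V * W = 1 \<Longrightarrow> V * (W * X) = (X :: 'h::complex_hilbert bop)"
  by (simp add: mult.assoc[symmetric])

text \<open>Moves inverses across an intertwining relation; one-sided inverses suffice.\<close>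

lemma inverse_push_through:
  fixes P Q :: "'h::complex_hilbert bop"
  assumes "p * P = 1" "Q * q = 1" "A * Q = P * C"
  shows "p * A = C * q"
proof -
  have "p * A = p * (A * Q) * q" using assms(2) by (simp add: mult.assoc)
  also have "\<dots> = C * q" unfolding assms(3) using assms(1) by (simp add: mult.assoc[symmetric])
  finally show ?thesis .
qed

section \<open>Logarithms expanded about a scalar\<close>

context tracial_algebra
begin

text \<open>The trace of log X, expanded about \<kappa> as log \<kappa> + log(1 - (1 - X/\<kappa>)).
  The series converges once 0 < \<delta> \<le> X \<le> \<kappa>.\<close>

definition ldk :: "real \<Rightarrow> 'h bop \<Rightarrow> real" where
  "ldk \<kappa> X = ln \<kappa> - lser (1 - (1 / \<kappa>) *\<^sub>R X)"

lemma binv_scaleR: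
  assumes "c \<noteq> 0" "X * V = 1" "V * X = 1"
  shows "binv (c *\<^sub>R X) = (1 / c) *\<^sub>R V"
  using assms by (intro binv_eqI) auto

lemma ldk_has_real_derivative:
  assumes X: "\<And>s. s \<in> {0..1} \<Longrightarrow> (X has_vector_derivative X' s) (at s within {0..1})"
    and mem: "\<And>s. s \<in> {0..1} \<Longrightarrow> X s \<in> N" "\<And>s. s \<in> {0..1} \<Longrightarrow> X' s \<in> N"
    and q: "\<And>s. s \<in> {0..1} \<Longrightarrow> norm (1 - (1 / \<kappa>) *\<^sub>R X s) \<le> q" "q < 1"
    and B: "\<And>s. s \<in> {0..1} \<Longrightarrow> norm (X' s) \<le> B"
    and s: "s \<in> {0..1}" and \<kappa>: "0 < \<kappa>"
    and V: "X s * V = 1" "V * X s = 1"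
  shows "((\<lambda>s. ldk \<kappa> (X s)) has_real_derivative rt (V * X' s)) (at s within {0..1})"
proof -
  have "((\<lambda>s. lser (1 - (1 / \<kappa>) *\<^sub>R X s)) has_real_derivative
      rt (binv (1 - (1 - (1 / \<kappa>) *\<^sub>R X s)) * ((- 1 / \<kappa>) *\<^sub>R X' s))) (at s within {0..1})"
  proof (rule lser_has_real_derivative[OF _ _ _ q(1) q(2) _ s])
    fix u :: real assume u: "u \<in> {0..1}"
    show "((\<lambda>s. 1 - (1 / \<kappa>) *\<^sub>R X s) has_vector_derivative (- 1 / \<kappa>) *\<^sub>R X' u) (at u within {0..1})"
      using X[OF u] by (auto intro!: derivative_eq_intros)
    show "norm ((- 1 / \<kappa>) *\<^sub>R X' u) \<le> B / \<kappa>"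
      using B[OF u] \<kappa> by (simp add: divide_right_mono)
  qed (use mem in auto)
  moreover have "binv (1 - (1 - (1 / \<kappa>) *\<^sub>R X s)) = \<kappa> *\<^sub>R V"
    using V \<kappa> by (simp add: binv_scaleR)
  moreover have "(\<kappa> *\<^sub>R V) * ((- 1 / \<kappa>) *\<^sub>R X' s) = - (V * X' s)" using \<kappa> by simp
  moreover have "V \<in> N"
  proof -
    define Y where "Y = 1 - (1 / \<kappa>) *\<^sub>R X s"
    have Y: "norm Y < 1" "Y \<in> N" using q(1)[OF s] q(2) mem s by (auto simp: Y_def)
    have "(\<Sum>n. Y ^ n) \<in> N"
      using rt_sums(2)[OF _ summable_sums[OF Neumann_series(1)[OF Y(1)]]] Y(2) by blast
    moreover have "binv (1 - Y) = (\<Sum>n. Y ^ n)"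
      using Neumann_series[OF Y(1)] by (intro binv_eqI)
    ultimately have "\<kappa> *\<^sub>R V \<in> N" using V \<kappa> by (simp add: Y_def binv_scaleR)
    hence "(1 / \<kappa>) *\<^sub>R \<kappa> *\<^sub>R V \<in> N" by blast
    thus ?thesis using \<kappa> by simp
  qed
  ultimately have "((\<lambda>s. lser (1 - (1 / \<kappa>) *\<^sub>R X s)) has_real_derivative - rt (V * X' s)) (at s within {0..1})"
    using mem s by (simp add: rt_minus)
  from DERIV_diff[OF DERIV_const this, of "ln \<kappa>"] show ?thesis by (simp add: ldk_def[abs_def])
qed

subsection \<open>Positive invertible elements\<close>

definition pd :: "'h bop \<Rightarrow> bool" where
  "pd X \<longleftrightarrow> X \<in> N \<and> (\<exists>\<delta>>0. pos (X - \<delta> *\<^sub>R 1))"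

text \<open>The trace of log X for positive invertible X. By \<open>ldk_independent\<close> every
  admissible centre gives the same value; adding 1 keeps the centre positive in all cases.\<close>

definition ld :: "'h bop \<Rightarrow> real" where
  "ld X = ldk (norm X + 1) X"

lemma pdI: "X \<in> N \<Longrightarrow> 0 < \<delta> \<Longrightarrow> pos (X - \<delta> *\<^sub>R 1) \<Longrightarrow> pd X"
  by (auto simp: pd_def)

lemma pd_mem [simp]: "pd X \<Longrightarrow> X \<in> N" by (simp add: pd_def)

lemma pos_lower_mono:
  assumes "pos (X - \<delta> *\<^sub>R 1)" "\<epsilon> \<le> \<delta>"
  shows "pos (X - \<epsilon> *\<^sub>R 1)"
proof -
  have "pos ((X - \<delta> *\<^sub>R 1) + (\<delta> - \<epsilon>) *\<^sub>R 1)" using assms by (intro pos_add pos_scaleR) auto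
  thus ?thesis by (simp add: algebra_simps)
qed

lemma pos_lower_pos: "pos (X - \<delta> *\<^sub>R 1) \<Longrightarrow> 0 \<le> \<delta> \<Longrightarrow> pos X"
  using pos_lower_mono[of X \<delta> 0] by simp

lemma pd_pos: "pd X \<Longrightarrow> pos X"
  unfolding pd_def using pos_lower_pos less_imp_le by blast

lemma lower_le_norm:
  assumes "X \<in> N" "pos (X - \<delta> *\<^sub>R 1)"
  shows "\<delta> \<le> norm X"
proof -
  have "0 \<le> rt (X - \<delta> *\<^sub>R 1)" using assms by (intro rt_pos) auto
  also have "\<dots> = rt X - \<delta>" using assms by (simp add: rt_diff rt_scaleR)
  finally show ?thesis using abs_rt_le[OF assms(1)] by linarith
qed

text \<open>\<delta> \<le> X \<le> \<kappa> gives 0 \<le> 1 - X/\<kappa> \<le> 1 -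
  \<delta>/\<kappa>, and for positive operators the order bounds the norm.\<close>

lemma pd_norm_bound:
  assumes "X \<in> N" "0 < \<delta>" "pos (X - \<delta> *\<^sub>R 1)" "norm X \<le> \<kappa>"
  shows "norm (1 - (1 / \<kappa>) *\<^sub>R X) \<le> 1 - \<delta> / \<kappa>"
proof (rule pos_norm_le)
  have \<kappa>: "\<delta> \<le> \<kappa>" "0 < \<kappa>" using lower_le_norm[OF assms(1,3)] assms by auto
  have sa: "star X = X" using pos_lower_pos[OF assms(3)] assms(2) by (simp add: pos_star)
  have "pos ((1 / \<kappa>) *\<^sub>R (\<kappa> *\<^sub>R 1 - X))"
    using pos_norm_diff[OF sa assms(4)] \<kappa> by (intro pos_scaleR) auto
  thus "pos (1 - (1 / \<kappa>) *\<^sub>R X)" using \<kappa> by (simp add: algebra_simps)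
  have "pos ((1 / \<kappa>) *\<^sub>R (X - \<delta> *\<^sub>R 1))" using assms \<kappa> by (intro pos_scaleR) auto
  thus "pos ((1 - \<delta> / \<kappa>) *\<^sub>R 1 - (1 - (1 / \<kappa>) *\<^sub>R X))" using \<kappa> by (simp add: algebra_simps)
  show "0 \<le> 1 - \<delta> / \<kappa>" using \<kappa> by simp
qed

text \<open>The Neumann series about \<open>norm X\<close> stays in the closed algebra
  \<open>N\<close>. With V the inverse, V = V* X V shows that it is positive.\<close>

lemma binv_pd:
  assumes "pd X"
  shows "X * binv X = 1" "binv X * X = 1" "binv X \<in> N" "pos (binv X)"
proof -
  obtain \<delta> where \<delta>: "0 < \<delta>" "pos (X - \<delta> *\<^sub>R 1)" and X: "X \<in> N" using assms by (auto simp: pd_def)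
  define \<kappa> where "\<kappa> = norm X"
  have \<kappa>: "0 < \<kappa>" using lower_le_norm[OF X \<delta>(2)] \<delta> unfolding \<kappa>_def by linarith
  define Y where "Y = 1 - (1 / \<kappa>) *\<^sub>R X"
  have "norm Y \<le> 1 - \<delta> / \<kappa>" unfolding Y_def \<kappa>_def by (rule pd_norm_bound[OF X \<delta>]) simp
  moreover have "0 < \<delta> / \<kappa>" using \<delta> \<kappa> by simp
  ultimately have Y: "norm Y < 1" by linarith
  define V where "V = (1 / \<kappa>) *\<^sub>R (\<Sum>n. Y ^ n)"
  have XY: "X = \<kappa> *\<^sub>R (1 - Y)" using \<kappa> by (simp add: Y_def)
  have V: "X * V = 1" "V * X = 1"
    using Neumann_series[OF Y] \<kappa> by (simp_all add: XY V_def)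
  have b: "binv X = V" by (rule binv_eqI[OF V])
  show "X * binv X = 1" "binv X * X = 1" using V by (simp_all add: b)
  have "Y \<in> N" using X by (auto simp: Y_def)
  hence "(\<Sum>n. Y ^ n) \<in> N"
    using rt_sums(2)[OF _ summable_sums[OF Neumann_series(1)[OF Y]]] by blast
  thus "binv X \<in> N" by (auto simp: b V_def)
  have "star X = X" using assms pd_pos pos_star by blast
  hence "star V * X = 1" using V by (metis star_mult star_one)
  hence "star V * 1 = 1 * V" by (rule inverse_push_through[where P = X and Q = X]) (use V in simp_all)
  hence "star V = V" by simp
  hence "V = star V * X * V" using V by (simp add: mult.assoc)
  thus "pos (binv X)" using pos_conj[OF pd_pos[OF assms], of V] by (simp add: b)
qed

lemma lser_scaleR_one: "\<bar>c\<bar> < 1 \<Longrightarrow> lser (c *\<^sub>R 1) = - ln (1 - c)"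
proof -
  assume c: "\<bar>c\<bar> < 1"
  have "(c *\<^sub>R (1 :: 'h bop)) ^ n = (c ^ n) *\<^sub>R 1" for n by (induction n) auto
  hence "rt ((c *\<^sub>R 1) ^ n) = c ^ n" for n by (simp add: rt_scaleR)
  thus ?thesis using ln_one_minus_sums[OF c] by (simp add: lser_def sums_iff del: power_Suc)
qed

lemma ldk_scaleR_one:
  assumes "0 < m" "m \<le> \<kappa>"
  shows "ldk \<kappa> (m *\<^sub>R 1) = ln m"
proof -
  have "1 - (1 / \<kappa>) *\<^sub>R (m *\<^sub>R (1 :: 'h bop)) = (1 - m / \<kappa>) *\<^sub>R 1" by (simp add: algebra_simps)
  moreover have "\<bar>1 - m / \<kappa>\<bar> < 1" using assms by (simp add: abs_if field_simps)
  ultimately show ?thesis using assms by (simp add: ldk_def lser_scaleR_one ln_div)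
qed

lemma linear_path_deriv: "((\<lambda>s::real. A + s *\<^sub>R C) has_vector_derivative C) (at s within S)" for A C :: "'h bop"
  by (auto intro!: derivative_eq_intros)

lemma pos_segment:
  assumes "pos (A - \<delta> *\<^sub>R 1)" "pos (A + C - \<delta> *\<^sub>R 1)" "s \<in> {0..1::real}"
  shows "pos (A + s *\<^sub>R C - \<delta> *\<^sub>R 1)"
proof -
  have "pos ((1 - s) *\<^sub>R (A - \<delta> *\<^sub>R 1) + s *\<^sub>R (A + C - \<delta> *\<^sub>R 1))"
    using assms by (intro pos_add pos_scaleR) auto
  thus ?thesis by (simp add: algebra_simps)
qed

lemma norm_segment:
  assumes "norm A \<le> \<kappa>" "norm (A + C) \<le> \<kappa>" "s \<in> {0..1::real}"
  shows "norm (A + s *\<^sub>R C :: 'h bop) \<le> \<kappa>"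
proof -
  have "A + s *\<^sub>R C = (1 - s) *\<^sub>R A + s *\<^sub>R (A + C)" by (simp add: algebra_simps)
  also have "norm \<dots> \<le> norm ((1 - s) *\<^sub>R A) + norm (s *\<^sub>R (A + C))" by (rule norm_triangle_ineq)
  also have "\<dots> \<le> (1 - s) * \<kappa> + s * \<kappa>" using assms by (auto intro!: add_mono mult_left_mono)
  finally show ?thesis by (simp add: algebra_simps)
qed

text \<open>On the segment from \<kappa>1 to X both expansions have the same derivative, the trace
  of the inverse times X - \<kappa>1, and at \<kappa>1 both equal log \<kappa>.\<close>

lemma ldk_independent:
  assumes X: "X \<in> N" "0 < \<delta>" "pos (X - \<delta> *\<^sub>R 1)" "norm X \<le> \<kappa>" and \<kappa>': "\<kappa> \<le> \<kappa>'"
  shows "ldk \<kappa>' X = ldk \<kappa> X"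
proof -
  have \<delta>\<kappa>: "\<delta> \<le> \<kappa>" using lower_le_norm X by fastforce
  define P where "P s = \<kappa> *\<^sub>R 1 + s *\<^sub>R (X - \<kappa> *\<^sub>R 1)" for s :: real
  have mem: "P s \<in> N" for s using X by (auto simp: P_def)
  have "pos (\<kappa> *\<^sub>R 1 - \<delta> *\<^sub>R 1 :: 'h bop)"
    using pos_scaleR[of 1 "\<kappa> - \<delta>"] \<delta>\<kappa> by (simp add: scaleR_left_diff_distrib)
  hence lower: "pos (P s - \<delta> *\<^sub>R 1)" if "s \<in> {0..1}" for s
    unfolding P_def using that X by (intro pos_segment) auto
  have upper: "norm (P s) \<le> \<kappa>" if "s \<in> {0..1}" for s
    unfolding P_def using that X \<delta>\<kappa> norm_one_bop_le
    by (intro norm_segment) (auto intro: mult_left_le)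
  have V: "P s * binv (P s) = 1" "binv (P s) * P s = 1" if "s \<in> {0..1}" for s
    using binv_pd[OF pdI[OF mem X(2) lower[OF that]]] by auto
  have D: "((\<lambda>s. ldk c (P s)) has_real_derivative rt (binv (P s) * (X - \<kappa> *\<^sub>R 1))) (at s within {0..1})"
    if c: "\<kappa> \<le> c" and s: "s \<in> {0..1}" for c s
  proof (rule ldk_has_real_derivative[where X = P and X' = "\<lambda>_. X - \<kappa> *\<^sub>R 1" and \<kappa> = c
        and V = "binv (P s)" and s = s, OF _ _ _ _ _ _ s _ V[OF s]])
    show "(P has_vector_derivative X - \<kappa> *\<^sub>R 1) (at u within {0..1})" for u
      unfolding P_def by (rule linear_path_deriv)
    show "norm (1 - (1 / c) *\<^sub>R P u) \<le> 1 - \<delta> / c" if "u \<in> {0..1}" for u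
      using pd_norm_bound[OF mem X(2) lower[OF that]] upper[OF that] c by simp
    show "1 - \<delta> / c < 1" "0 < c" using X(2) c \<delta>\<kappa> by auto
    show "norm (X - \<kappa> *\<^sub>R 1) \<le> norm (X - \<kappa> *\<^sub>R 1)" by simp
  qed (use mem X in auto)
  have "ldk \<kappa>' (P 1) - ldk \<kappa>' (P 0) = ldk \<kappa> (P 1) - ldk \<kappa> (P 0)"
    using deriv_eq_imp_diff_eq[OF D[OF \<kappa>'] D[OF order_refl]] .
  moreover have "ldk \<kappa>' (P 0) = ldk \<kappa> (P 0)"
    using ldk_scaleR_one \<delta>\<kappa> X(2) \<kappa>' by (simp add: P_def)
  ultimately show ?thesis by (simp add: P_def)
qed

lemma ld_eq_ldk: "pd X \<Longrightarrow> norm X \<le> \<kappa> \<Longrightarrow> ld X = ldk \<kappa> X"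
proof -
  assume X: "pd X" and \<kappa>: "norm X \<le> \<kappa>"
  obtain \<delta> where \<delta>: "0 < \<delta>" "pos (X - \<delta> *\<^sub>R 1)" and mem: "X \<in> N" using X by (auto simp: pd_def)
  show ?thesis
    using ldk_independent[OF mem \<delta> order_refl \<kappa>] ldk_independent[OF mem \<delta> order_refl, of "norm X + 1"]
    by (simp add: ld_def)
qed

lemma ld_path:
  assumes X: "\<And>s. s \<in> {0..1} \<Longrightarrow> (X has_vector_derivative X' s) (at s within {0..1})"
    and mem: "\<And>s. s \<in> {0..1} \<Longrightarrow> X s \<in> N" "\<And>s. s \<in> {0..1} \<Longrightarrow> X' s \<in> N"
    and \<delta>: "0 < \<delta>" "\<And>s. s \<in> {0..1} \<Longrightarrow> pos (X s - \<delta> *\<^sub>R 1)"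
    and \<kappa>: "\<And>s. s \<in> {0..1} \<Longrightarrow> norm (X s) \<le> \<kappa>"
    and B: "\<And>s. s \<in> {0..1} \<Longrightarrow> norm (X' s) \<le> B"
    and s: "s \<in> {0..1}"
  shows "((\<lambda>s. ld (X s)) has_real_derivative rt (binv (X s) * X' s)) (at s within {0..1})"
proof (rule has_field_derivative_transform_within[OF _ zero_less_one s])
  have pd: "pd (X u)" if "u \<in> {0..1}" for u using pdI[OF mem(1) \<delta>] that by blast
  show "ldk \<kappa> (X u) = ld (X u)" if "u \<in> {0..1}" for u
    using ld_eq_ldk[OF pd \<kappa>] that by simp
  have \<kappa>0: "0 < \<kappa>" using lower_le_norm[OF mem(1) \<delta>(2), of 0] \<kappa>[of 0] \<delta>(1) by simp
  show "((\<lambda>s. ldk \<kappa> (X s)) has_real_derivative rt (binv (X s) * X' s)) (at s within {0..1})"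
  proof (rule ldk_has_real_derivative[where X = X and X' = X' and \<kappa> = \<kappa> and V = "binv (X s)"
        and s = s, OF X mem _ _ B s \<kappa>0 binv_pd(1,2)[OF pd[OF s]]])
    show "norm (1 - (1 / \<kappa>) *\<^sub>R X u) \<le> 1 - \<delta> / \<kappa>" if "u \<in> {0..1}" for u
      using pd_norm_bound[OF mem(1) \<delta>(1,2) \<kappa>] that by simp
    show "1 - \<delta> / \<kappa> < 1" using \<delta> \<kappa>0 by simp
  qed
qed

lemma ld_line:
  assumes A: "pd A" "pd (A + C)" and s: "s \<in> {0..1::real}"
  shows "((\<lambda>s. ld (A + s *\<^sub>R C)) has_real_derivative rt (binv (A + s *\<^sub>R C) * C)) (at s within {0..1})"
    and "pd (A + s *\<^sub>R C)"
proof -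
  have "A + C - A \<in> N" using A by (intro diff_mem) auto
  hence C: "C \<in> N" by simp
  obtain a b where ab: "0 < a" "pos (A - a *\<^sub>R 1)" "0 < b" "pos (A + C - b *\<^sub>R 1)"
    using A by (auto simp: pd_def)
  define \<delta> where "\<delta> = min a b"
  have \<delta>: "0 < \<delta>" "pos (A - \<delta> *\<^sub>R 1)" "pos (A + C - \<delta> *\<^sub>R 1)"
    using ab pos_lower_mono[OF ab(2), of \<delta>] pos_lower_mono[OF ab(4), of \<delta>] by (simp_all add: \<delta>_def)
  have lower: "pos (A + u *\<^sub>R C - \<delta> *\<^sub>R 1)" if "u \<in> {0..1}" for u
    using pos_segment \<delta> that by blast
  show "pd (A + s *\<^sub>R C)" using pdI[OF _ \<delta>(1) lower[OF s]] A C by auto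
  show "((\<lambda>s. ld (A + s *\<^sub>R C)) has_real_derivative rt (binv (A + s *\<^sub>R C) * C)) (at s within {0..1})"
    by (rule ld_path[where X = "\<lambda>s. A + s *\<^sub>R C" and X' = "\<lambda>_. C" and s = s,
          OF linear_path_deriv _ _ \<delta>(1) lower
          norm_segment[of A "max (norm A) (norm (A + C))"] order_refl s])
       (use A C in auto)
qed

text \<open>The derivative along the segment from X to Y is the trace of a product of two positive
  elements, nonnegative by \<open>rt_mult_pos\<close>. Operator monotonicity of the logarithm is
  bypassed.\<close>

lemma ld_mono:
  assumes "pd X" "pd Y" "pos (Y - X)"
  shows "ld X \<le> ld Y"
proof -
  have Y: "pd (X + (Y - X))" using assms by simp
  have "0 - 0 \<le> ld (X + 1 *\<^sub>R (Y - X)) - ld (X + 0 *\<^sub>R (Y - X))"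
    by (rule deriv_le_imp_diff_le[where f = "\<lambda>_. 0" and g = "\<lambda>s. ld (X + s *\<^sub>R (Y - X))",
          OF DERIV_const ld_line(1)[OF assms(1) Y]])
       (use binv_pd[OF ld_line(2)[OF assms(1) Y]] assms in \<open>auto intro!: rt_mult_pos\<close>)
  thus ?thesis by simp
qed

lemma pd_scaleR: "pd X \<Longrightarrow> 0 < c \<Longrightarrow> pd (c *\<^sub>R X)"
proof -
  assume X: "pd X" and c: "0 < c"
  then obtain \<delta> where \<delta>: "0 < \<delta>" "pos (X - \<delta> *\<^sub>R 1)" by (auto simp: pd_def)
  have "pos (c *\<^sub>R (X - \<delta> *\<^sub>R 1))" using \<delta> c by (intro pos_scaleR) auto
  thus ?thesis using X c \<delta> by (intro pdI[of _ "c * \<delta>"]) (auto simp: algebra_simps)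
qed

text \<open>Expanding c X about c times \<open>norm X\<close> reproduces the series of X about
  \<open>norm X\<close>.\<close>

lemma ld_scaleR:
  assumes "pd X" "0 < c"
  shows "ld (c *\<^sub>R X) = ln c + ld X"
proof -
  obtain \<delta> where "0 < \<delta>" "pos (X - \<delta> *\<^sub>R 1)" using assms by (auto simp: pd_def)
  hence n: "0 < norm X" using lower_le_norm[OF pd_mem[OF assms(1)], of \<delta>] by linarith
  have "ld (c *\<^sub>R X) = ldk (c * norm X) (c *\<^sub>R X)"
    using assms by (intro ld_eq_ldk pd_scaleR) auto
  also have "\<dots> = ln c + ldk (norm X) X" using assms n by (simp add: ldk_def ln_mult)
  also have "ldk (norm X) X = ld X" using ld_eq_ldk[OF assms(1) order_refl] by simp
  finally show ?thesis .
qed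

lemma pd_one: "pd 1"
  by (rule pdI[of _ 1]) auto

lemma ld_one: "ld 1 = 0"
  using ld_eq_ldk[OF pd_one norm_one_bop_le] ldk_scaleR_one[of 1 1] by simp

lemma pd_scaleR_one: "0 < c \<Longrightarrow> pd (c *\<^sub>R 1)"
  by (rule pd_scaleR[OF pd_one])

lemma ld_scaleR_one: "0 < c \<Longrightarrow> ld (c *\<^sub>R 1) = ln c"
  by (simp add: ld_scaleR pd_one ld_one)

lemma pd_add_pos: "pd X \<Longrightarrow> Y \<in> N \<Longrightarrow> pos Y \<Longrightarrow> pd (X + Y)"
proof -
  assume X: "pd X" and Y: "Y \<in> N" "pos Y"
  then obtain \<delta> where \<delta>: "0 < \<delta>" "pos (X - \<delta> *\<^sub>R 1)" by (auto simp: pd_def)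
  have "pos ((X - \<delta> *\<^sub>R 1) + Y)" using \<delta> Y by (intro pos_add) auto
  thus ?thesis using X Y \<delta> by (intro pdI[of _ \<delta>]) (auto simp: algebra_simps)
qed

lemma pd_pos_add: "Y \<in> N \<Longrightarrow> pos Y \<Longrightarrow> pd X \<Longrightarrow> pd (Y + X)"
  using pd_add_pos[of X Y] by (simp add: add.commute)

text \<open>The determinant identity \<open>det (c\<^sup>* B\<^sup>-\<^sup>1 c + \<eta>) det B = det (c c\<^sup>* + \<eta> B)\<close>; both sides have the same
  logarithmic derivative along \<open>s \<mapsto> s c\<^sup>* B\<^sup>-\<^sup>1 c + \<eta>\<close> and \<open>s \<mapsto> s c c\<^sup>* + \<eta> B\<close>.\<close>

lemma ld_Sylvester:
  assumes B: "pd B" and c: "c \<in> N" and \<eta>: "0 < \<eta>"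
  shows "ld (star c * binv B * c + \<eta> *\<^sub>R 1) + ld B = ld (c * star c + \<eta> *\<^sub>R B)"
proof -
  note V = binv_pd[OF B]
  let ?P = "\<lambda>s. \<eta> *\<^sub>R 1 + s *\<^sub>R (star c * binv B * c)" and ?Q = "\<lambda>s. \<eta> *\<^sub>R B + s *\<^sub>R (c * star c)"
  have pdP: "pd (\<eta> *\<^sub>R 1)" "pd (\<eta> *\<^sub>R 1 + star c * binv B * c)"
    using c \<eta> V by (auto intro!: pd_add_pos pd_scaleR_one pos_conj)
  have pdQ: "pd (\<eta> *\<^sub>R B)" "pd (\<eta> *\<^sub>R B + c * star c)"
    using c \<eta> B pos_star_mult[of "star c"] by (auto intro!: pd_add_pos pd_scaleR)
  have eq: "rt (binv (?Q s) * (c * star c)) = rt (binv (?P s) * (star c * binv B * c))"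
    if s: "s \<in> {0..1}" for s
  proof -
    note P = binv_pd[OF ld_line(2)[OF pdP s]] and Q = binv_pd[OF ld_line(2)[OF pdQ s]]
    \<comment> \<open>This intertwining carries the inverse of Q past \<open>star c\<close>;
      cyclicity of the trace then equates the two derivatives.\<close>
    have "star c * binv B * ?Q s = ?P s * star c"
      using V by (simp add: algebra_simps)
    from inverse_push_through[OF P(2) Q(1) this]
    have "binv (?P s) * (star c * binv B * c) = star c * (binv (?Q s) * c)"
      by (simp add: mult.assoc[symmetric])
    hence "rt (binv (?P s) * (star c * binv B * c)) = rt (star c * (binv (?Q s) * c))" by simp
    also have "\<dots> = rt (binv (?Q s) * c * star c)" using c Q(3) by (intro rt_comm) auto
    finally show ?thesis by (simp add: mult.assoc)
  qed
  have "ld (?P 1) - ld (?P 0) = ld (?Q 1) - ld (?Q 0)"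
  proof (rule deriv_eq_imp_diff_eq[OF ld_line(1)[OF pdP]])
    fix s :: real assume s: "s \<in> {0..1}"
    show "((\<lambda>s. ld (?Q s)) has_real_derivative rt (binv (?P s) * (star c * binv B * c))) (at s within {0..1})"
      using ld_line(1)[OF pdQ s] unfolding eq[OF s] .
  qed
  moreover have "ld (?P 0) = ln \<eta>" "ld (?Q 0) = ln \<eta> + ld B"
    using \<eta> B by (simp_all add: ld_scaleR_one ld_scaleR)
  ultimately show ?thesis by (simp add: add.commute)
qed

lemma ld_star_commute:
  assumes c: "c \<in> N" and \<eta>: "0 < \<eta>"
  shows "ld (star c * c + \<eta> *\<^sub>R 1) = ld (c * star c + \<eta> *\<^sub>R 1)"
proof -
  have "binv (1 :: 'h bop) = 1" by (rule binv_eqI) auto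
  thus ?thesis using ld_Sylvester[OF pd_one c \<eta>] by (simp add: ld_one)
qed

lemma pos_one_minus:
  fixes S :: "'h bop"
  assumes "norm S < 1"
  shows "pos (star (1 - S) * (1 - S) - ((1 - norm S)\<^sup>2) *\<^sub>R 1)"
  unfolding pos_iff
proof (intro conjI allI)
  fix x :: 'h
  have "(1 - norm S) * norm x \<le> norm x - norm (S \<rhd> x)"
    using norm_bapp[of S x] by (simp add: algebra_simps)
  also have "\<dots> \<le> norm ((1 - S) \<rhd> x)" by (simp add: bapp_simps norm_triangle_ineq2)
  finally have "((1 - norm S) * norm x)\<^sup>2 \<le> (norm ((1 - S) \<rhd> x))\<^sup>2"
    using assms by (intro power_mono) auto
  also have "\<dots> = Re (cinner ((star (1 - S) * (1 - S)) \<rhd> x) x)"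
    using cinner_star[of "star (1 - S)"] by (simp add: bapp_mult cinner_self)
  finally show "0 \<le> Re (cinner ((star (1 - S) * (1 - S) - ((1 - norm S)\<^sup>2) *\<^sub>R 1) \<rhd> x) x)"
    by (simp add: bapp_diff_left bapp_scaleR_left cinner_simps cinner_self power_mult_distrib)
qed (simp add: star_simps)

lemma pd_one_minus: "S \<in> N \<Longrightarrow> norm S < 1 \<Longrightarrow> pd (star (1 - S) * (1 - S))"
  by (rule pdI[OF _ _ pos_one_minus]) auto

text \<open>Along s S, with W the inverse of F = 1 - s S, both halves of the logarithmic derivative
  of F*F have the real trace of -W S, by cyclicity and invariance of \<open>rt\<close> under
  \<open>star\<close>. Hence the logarithm is additive on this product although S need not be
  normal.\<close>

lemma ld_one_minus:
  assumes S: "S \<in> N" "norm S < 1"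
  shows "ld (star (1 - S) * (1 - S)) = - 2 * lser S"
proof -
  define F where "F s = 1 - s *\<^sub>R S" for s :: real
  define X where "X s = star (F s) * F s" for s
  define X' where "X' s = - (star S * F s + star (F s) * S)" for s
  have nS: "norm (s *\<^sub>R S) \<le> norm S" if "s \<in> {0..1}" for s :: real
    using that by (auto intro: mult_left_le_one_le)
  have Fmem: "F s \<in> N" for s using S by (auto simp: F_def)
  have Xeq: "X = (\<lambda>s. 1 - s *\<^sub>R (star S + S) + s\<^sup>2 *\<^sub>R (star S * S))"
    unfolding X_def F_def by (rule ext) (simp add: star_simps algebra_simps power2_eq_square)
  have X'eq: "X' s = - (star S + S) + (2 * s) *\<^sub>R (star S * S)" for s
  proof -
    have "(2 * s) *\<^sub>R (star S * S) = s *\<^sub>R (star S * S) + s *\<^sub>R (star S * S)"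
      by (simp only: scaleR_left_distrib[symmetric] mult_2)
    thus ?thesis by (simp add: X'_def F_def star_simps left_diff_distrib right_diff_distrib)
  qed
  have D: "(X has_vector_derivative X' s) (at s within T)" for s T
    unfolding Xeq X'eq by (auto intro!: derivative_eq_intros simp: algebra_simps)
  \<comment> \<open>A lower bound independent of s, as the path lemma demands:
    \<open>norm (s *\<^sub>R S)\<close> is largest at s = 1.\<close>
  have lower: "pos (X s - ((1 - norm S)\<^sup>2) *\<^sub>R 1)" if "s \<in> {0..1}" for s
  proof (rule pos_lower_mono)
    show "pos (X s - ((1 - norm (s *\<^sub>R S))\<^sup>2) *\<^sub>R 1)"
      unfolding X_def F_def using nS[OF that] S by (intro pos_one_minus) auto
    show "(1 - norm S)\<^sup>2 \<le> (1 - norm (s *\<^sub>R S))\<^sup>2"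
      using nS[OF that] S by (intro power_mono) auto
  qed
  have nF: "norm (F s) \<le> 2" if "s \<in> {0..1}" for s
  proof -
    have "norm (F s) \<le> norm (1 :: 'h bop) + norm (s *\<^sub>R S)" unfolding F_def by (rule norm_triangle_ineq4)
    thus ?thesis using norm_one_bop_le[where 'h='h] nS[OF that] S by simp
  qed
  have nX: "norm (X s) \<le> 2 * 2" if "s \<in> {0..1}" for s
    unfolding X_def by (rule order_trans[OF norm_mult_ineq mult_mono]) (use nF[OF that] in auto)
  have nX': "norm (X' s) \<le> 1 * 2 + 2 * 1" if "s \<in> {0..1}" for s
    unfolding X'_def norm_minus_cancel
    by (rule order_trans[OF norm_triangle_ineq add_mono])
       (rule order_trans[OF norm_mult_ineq mult_mono]; use nF[OF that] S in auto)+
  have pdX: "pd (X s)" if "s \<in> {0..1}" for s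
    using pdI[OF _ _ lower[OF that]] S Fmem by (auto simp: X_def)
  have "((\<lambda>s. ld (X s)) has_real_derivative rt (binv (X s) * X' s)) (at s within {0..1})"
    if "s \<in> {0..1}" for s
    by (rule ld_path[where X = X and X' = X' and s = s, OF D _ _ _ lower nX nX' that]) (use S Fmem in \<open>auto simp: X_def X'_def\<close>)
  moreover have "((\<lambda>s. - 2 * lser (s *\<^sub>R S)) has_real_derivative rt (binv (X s) * X' s)) (at s within {0..1})"
    if s: "s \<in> {0..1}" for s
  proof -
    have D2: "((\<lambda>s. s *\<^sub>R S) has_vector_derivative S) (at u within {0..1})" for u :: real
      by (auto intro!: derivative_eq_intros)
    have L: "((\<lambda>s. lser (s *\<^sub>R S)) has_real_derivative rt (binv (1 - s *\<^sub>R S) * S)) (at s within {0..1})"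
      by (rule lser_has_real_derivative[where Y = "\<lambda>s. s *\<^sub>R S" and Y' = "\<lambda>_. S" and s = s, OF D2 _ _ nS S(2) order_refl s]) (use S in auto)
    define W where "W = binv (F s)"
    have nsS: "norm (s *\<^sub>R S) < 1" using nS[OF s] S by simp
    have Weq: "W = (\<Sum>n. (s *\<^sub>R S) ^ n)"
      unfolding W_def F_def using Neumann_series[OF nsS] by (intro binv_eqI)
    have W: "F s * W = 1" "W * F s = 1"
      unfolding Weq F_def using Neumann_series[OF nsS] by auto
    have Wmem: "W \<in> N"
      unfolding Weq using rt_sums(2)[OF _ summable_sums[OF Neumann_series(1)[OF nsS]]] S by blast
    have W': "star W * star (F s) = 1" "star (F s) * star W = 1"
      using W by (metis star_mult star_one)+
    have bX: "binv (X s) = W * star W"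
      unfolding X_def using W W'
      by (intro binv_eqI) (simp_all add: mult.assoc inverse_mult_cancel)
    have "rt (binv (X s) * X' s) = - rt (W * star W * star S * F s) - rt (W * star W * star (F s) * S)"
      using S Wmem Fmem by (simp add: bX X'_def right_diff_distrib mult.assoc rt_diff rt_minus)
    also have "rt (W * star W * star S * F s) = rt (F s * (W * star W * star S))"
      using S Wmem Fmem by (intro rt_comm) auto
    also have "F s * (W * star W * star S) = star (S * W)"
      using W by (simp add: mult.assoc star_mult inverse_mult_cancel)
    also have "rt (star (S * W)) = rt (W * S)"
      using S Wmem rt_comm[of S W] by (subst rt_star) auto
    also have "W * star W * star (F s) * S = W * S"
      using W' by (simp add: mult.assoc inverse_mult_cancel)
    finally have "rt (binv (X s) * X' s) = - 2 * rt (W * S)" by simp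
    thus ?thesis using DERIV_cmult[OF L, of "-2"] by (simp add: W_def F_def)
  qed
  ultimately have "ld (X 1) - ld (X 0) = - 2 * lser (1 *\<^sub>R S) - - 2 * lser (0 *\<^sub>R S)"
    by (rule deriv_eq_imp_diff_eq)
  moreover have "lser 0 = 0" by (simp add: lser_def)
  ultimately show ?thesis by (simp add: X_def F_def ld_one)
qed

end

section \<open>Bounded Borel functional calculus\<close>

definition bounded_borel :: "(real \<Rightarrow> real) \<Rightarrow> bool" where
  "bounded_borel f \<longleftrightarrow> f \<in> borel_measurable borel \<and> (\<exists>c. \<forall>t. \<bar>f t\<bar> \<le> c)"

lemma bounded_borelI: "f \<in> borel_measurable borel \<Longrightarrow> (\<And>t. \<bar>f t\<bar> \<le> c) \<Longrightarrow> bounded_borel f"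
  by (auto simp: bounded_borel_def)

lemma bounded_borel_measurable [measurable_dest]: "bounded_borel f \<Longrightarrow> f \<in> borel_measurable borel"
  by (simp add: bounded_borel_def)

lemma bounded_borel_const: "bounded_borel (\<lambda>_. c)"
  by (rule bounded_borelI[of _ "\<bar>c\<bar>"]) auto

lemma bounded_borel_indicator: "B \<in> sets borel \<Longrightarrow> bounded_borel (indicator B)"
  by (rule bounded_borelI[of _ 1]) (auto simp: indicator_def)

lemma bounded_borel_add: "bounded_borel f \<Longrightarrow> bounded_borel g \<Longrightarrow> bounded_borel (\<lambda>t. f t + g t)"
proof -
  assume fg: "bounded_borel f" "bounded_borel g"
  then obtain a b where "\<And>t. \<bar>f t\<bar> \<le> a" "\<And>t. \<bar>g t\<bar> \<le> b" by (auto simp: bounded_borel_def)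
  hence "\<bar>f t + g t\<bar> \<le> a + b" for t by (meson abs_triangle_ineq add_mono order_trans)
  thus ?thesis using fg by (intro bounded_borelI[of _ "a + b"]) (auto simp: bounded_borel_def)
qed

lemma bounded_borel_mult: "bounded_borel f \<Longrightarrow> bounded_borel g \<Longrightarrow> bounded_borel (\<lambda>t. f t * g t)"
proof -
  assume fg: "bounded_borel f" "bounded_borel g"
  then obtain a b where ab: "\<And>t. \<bar>f t\<bar> \<le> a" "\<And>t. \<bar>g t\<bar> \<le> b" by (auto simp: bounded_borel_def)
  have "0 \<le> a" using ab(1)[of 0] by linarith
  hence "\<bar>f t * g t\<bar> \<le> a * b" for t unfolding abs_mult using ab by (intro mult_mono) auto
  thus ?thesis using fg by (intro bounded_borelI[of _ "a * b"]) (auto simp: bounded_borel_def)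
qed

lemma bounded_borel_scale: "bounded_borel f \<Longrightarrow> bounded_borel (\<lambda>t. r * f t)"
  using bounded_borel_mult[OF bounded_borel_const] by auto

lemma bounded_borel_diff: "bounded_borel f \<Longrightarrow> bounded_borel g \<Longrightarrow> bounded_borel (\<lambda>t. f t - g t)"
  using bounded_borel_add[of f "\<lambda>t. -1 * g t"] bounded_borel_scale[of g "-1"] by simp

lemma bounded_borel_power: "bounded_borel f \<Longrightarrow> bounded_borel (\<lambda>t. f t ^ n)"
  by (induction n) (auto intro: bounded_borel_const bounded_borel_mult)

text \<open>Rounding down to the grid of step 1/(n + 1): uniform approximation, with finite range
  when f is bounded.\<close>

definition simple_approx :: "(real \<Rightarrow> real) \<Rightarrow> nat \<Rightarrow> real \<Rightarrow> real" where
  "simple_approx f n t = of_int \<lfloor>real (Suc n) * f t\<rfloor> / real (Suc n)"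

lemma simple_approx_close: "\<bar>simple_approx f n t - f t\<bar> \<le> 1 / real (Suc n)"
proof -
  let ?m = "real (Suc n)"
  have "\<bar>of_int \<lfloor>?m * f t\<rfloor> - ?m * f t\<bar> \<le> 1" by linarith
  moreover have "simple_approx f n t - f t = (of_int \<lfloor>?m * f t\<rfloor> - ?m * f t) / ?m"
    by (simp add: simple_approx_def field_simps)
  ultimately show ?thesis by (simp add: abs_divide divide_right_mono)
qed

lemma finite_range_simple_approx:
  assumes "bounded_borel f"
  shows "finite (range (simple_approx f n))"
proof -
  obtain c where c: "\<And>t. \<bar>f t\<bar> \<le> c" using assms by (auto simp: bounded_borel_def)
  let ?m = "real (Suc n)"
  have "range (simple_approx f n) \<subseteq> (\<lambda>k. of_int k / ?m) ` {\<lfloor>?m * - c\<rfloor>..\<lfloor>?m * c\<rfloor>}"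
  proof
    fix y assume "y \<in> range (simple_approx f n)"
    then obtain t where y: "y = of_int \<lfloor>?m * f t\<rfloor> / ?m" by (auto simp: simple_approx_def)
    have "- c \<le> f t" "f t \<le> c" using c[of t] by auto
    hence "?m * - c \<le> ?m * f t" "?m * f t \<le> ?m * c" by (intro mult_left_mono; simp)+
    hence "\<lfloor>?m * f t\<rfloor> \<in> {\<lfloor>?m * - c\<rfloor>..\<lfloor>?m * c\<rfloor>}" by (auto intro!: floor_mono)
    thus "y \<in> (\<lambda>k. of_int k / ?m) ` {\<lfloor>?m * - c\<rfloor>..\<lfloor>?m * c\<rfloor>}" using y by blast
  qed
  thus ?thesis by (rule finite_subset) auto
qed

lemma bounded_borel_simple_approx: "bounded_borel f \<Longrightarrow> bounded_borel (simple_approx f n)"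
proof -
  assume f: "bounded_borel f"
  then obtain c where c: "\<And>t. \<bar>f t\<bar> \<le> c" by (auto simp: bounded_borel_def)
  have "\<bar>simple_approx f n t\<bar> \<le> c + 1 / real (Suc n)" for t
    using simple_approx_close[of f n t] c[of t] by linarith
  moreover have "simple_approx f n \<in> borel_measurable borel"
    unfolding simple_approx_def[abs_def] using bounded_borel_measurable[OF f] by measurable
  ultimately show ?thesis by (intro bounded_borelI)
qed

lemma finite_range_indicator_sum:
  fixes f :: "real \<Rightarrow> real"
  assumes "finite (range f)"
  shows "f t = (\<Sum>y\<in>range f. y * indicator (f -` {y}) t)"
proof -
  have "(\<Sum>y\<in>range f. y * indicator (f -` {y}) t) = (\<Sum>y\<in>range f. if y = f t then y else 0)"
    by (intro sum.cong) (auto simp: indicator_def)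
  also have "\<dots> = f t" using assms by (simp add: sum.delta)
  finally show ?thesis by simp
qed

locale spectral_pvm =
  fixes E :: "real set \<Rightarrow> 'h::complex_hilbert \<Rightarrow> 'h"
  assumes pvm: "projection_valued_measure E"
begin

definition EB :: "real set \<Rightarrow> 'h bop" where "EB B = Bop (E B)"

lemma bapp_EB: "B \<in> sets borel \<Longrightarrow> EB B \<rhd> x = E B x"
  using pvm by (simp add: EB_def bapp_Bop projection_valued_measure_def)

lemma star_EB: "B \<in> sets borel \<Longrightarrow> star (EB B) = EB B"
  using pvm by (intro star_eqI) (simp add: bapp_EB projection_valued_measure_def is_adjoint_def)

lemma EB_idem: "B \<in> sets borel \<Longrightarrow> EB B * EB B = EB B"
proof (rule bop_eqI)
  fix x assume B: "B \<in> sets borel"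
  hence "E B \<circ> E B = E B" using pvm by (simp add: projection_valued_measure_def)
  hence "E B (E B x) = E B x" by (metis comp_apply)
  thus "(EB B * EB B) \<rhd> x = EB B \<rhd> x" using B by (simp add: bapp_mult bapp_EB)
qed

lemma EB_UNIV: "EB UNIV = 1"
  by (rule bop_eqI) (use pvm in \<open>simp add: bapp_EB projection_valued_measure_def\<close>)

lemma EB_sums:
  "range F \<subseteq> sets borel \<Longrightarrow> disjoint_family F \<Longrightarrow> (\<lambda>n. EB (F n) \<rhd> x) sums (EB (\<Union>n. F n) \<rhd> x)"
proof -
  assume F: "range F \<subseteq> sets borel" "disjoint_family F"
  hence "(\<lambda>n. E (F n) x) sums E (\<Union>n. F n) x"
    using pvm unfolding projection_valued_measure_def by blast
  moreover have "F n \<in> sets borel" for n using F by auto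
  ultimately show ?thesis by (simp add: bapp_EB)
qed

lemma EB_empty: "EB {} = 0"
proof (rule bop_eqI)
  fix x
  have "(\<lambda>n::nat. EB {} \<rhd> x) sums (EB {} \<rhd> x)"
    using EB_sums[of "\<lambda>_. {}" x] by (simp add: disjoint_family_on_def)
  hence "(\<lambda>n::nat. EB {} \<rhd> x) \<longlonglongrightarrow> 0" by (intro summable_LIMSEQ_zero sums_summable)
  thus "EB {} \<rhd> x = 0 \<rhd> x" by (simp add: LIMSEQ_const_iff)
qed

lemma EB_Un:
  assumes "A \<in> sets borel" "B \<in> sets borel" "A \<inter> B = {}"
  shows "EB (A \<union> B) = EB A + EB B"
proof (rule bop_eqI)
  fix x
  have "(\<lambda>n. EB (binaryset A B n) \<rhd> x) sums (EB (\<Union>n. binaryset A B n) \<rhd> x)"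
    using assms by (intro EB_sums) (auto simp: range_binaryset_eq disjoint_family_on_def binaryset_def)
  moreover have "(\<lambda>n. EB (binaryset A B n) \<rhd> x) sums (\<Sum>n\<in>{0,1}. EB (binaryset A B n) \<rhd> x)"
    by (rule sums_finite) (auto simp: binaryset_def EB_empty)
  ultimately have "EB (\<Union>n. binaryset A B n) \<rhd> x = (\<Sum>n\<in>{0,1}. EB (binaryset A B n) \<rhd> x)"
    by (rule sums_unique2)
  thus "EB (A \<union> B) \<rhd> x = (EB A + EB B) \<rhd> x"
    by (simp add: UN_binaryset_eq bapp_add_left binaryset_def)
qed

text \<open>The sum of the projections a and b is again idempotent, whence ab = -ba. Multiplying by
  a on the left gives ab = -aba, while aba = -ba = ab; so ab vanishes.\<close>

lemma EB_disjoint_mult: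
  assumes "A \<in> sets borel" "B \<in> sets borel" "A \<inter> B = {}"
  shows "EB A * EB B = 0"
proof -
  let ?a = "EB A" and ?b = "EB B"
  have idem: "?a * ?a = ?a" "?b * ?b = ?b" using assms by (simp_all add: EB_idem)
  have "(?a + ?b) * (?a + ?b) = ?a + ?b" using EB_idem[of "A \<union> B"] assms by (simp add: EB_Un)
  hence anti: "?a * ?b = - (?b * ?a)"
    by (simp add: algebra_simps idem) (metis add.commute add_left_cancel add.assoc eq_neg_iff_add_eq_0 add_cancel_right_right)
  have "?a * ?b = ?a * (?a * ?b)" by (simp add: mult.assoc[symmetric] idem)
  also have "\<dots> = ?a * - (?b * ?a)" by (simp only: anti)
  also have "\<dots> = - (?a * ?b * ?a)" by (simp add: mult.assoc)
  also have "?a * ?b * ?a = - (?b * ?a) * ?a" by (simp only: anti)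
  also have "\<dots> = - (?b * (?a * ?a))" by (simp add: mult.assoc)
  also have "\<dots> = ?a * ?b" by (simp add: idem anti)
  finally have "?a * ?b = - (?a * ?b)" .
  hence "2 *\<^sub>R (?a * ?b) = 0" by (simp only: scaleR_2 eq_neg_iff_add_eq_0)
  thus ?thesis by simp
qed

lemma EB_Int:
  assumes "A \<in> sets borel" "B \<in> sets borel"
  shows "EB A * EB B = EB (A \<inter> B)"
proof -
  have split: "EB C = EB (C - D) + EB (C \<inter> D)" if "C \<in> sets borel" "D \<in> sets borel" for C D
    using EB_Un[of "C - D" "C \<inter> D"] that by (simp add: Un_Diff_Int Diff_Int_distrib2)
  have A: "EB A = EB (A - B) + EB (A \<inter> B)" and B: "EB B = EB (B - A) + EB (A \<inter> B)"
    using split[of A B] split[of B A] assms by (simp_all add: Int_commute)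
  have "EB (A - B) * EB (B - A) = 0" "EB (A - B) * EB (A \<inter> B) = 0" "EB (A \<inter> B) * EB (B - A) = 0"
    using assms by (auto intro!: EB_disjoint_mult)
  thus ?thesis unfolding A B using assms by (simp add: algebra_simps EB_idem)
qed

lemma EB_quadratic: "B \<in> sets borel \<Longrightarrow> cinner (EB B \<rhd> x) x = of_real ((norm (EB B \<rhd> x))\<^sup>2)"
proof -
  assume B: "B \<in> sets borel"
  have "cinner (EB B \<rhd> x) x = cinner (EB B \<rhd> EB B \<rhd> x) x" using EB_idem[OF B] by (metis bapp_mult)
  also have "\<dots> = cinner (EB B \<rhd> x) (EB B \<rhd> x)" by (simp add: cinner_star star_EB B)
  finally show ?thesis by (simp add: cinner_self)
qed

abbreviation "sm \<equiv> scalar_measure E"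

lemma sets_sm [simp, measurable_cong]: "sets (sm x) = sets borel"
  by (simp add: scalar_measure_def sets.sigma_sets_eq[of borel, simplified])

lemma space_sm [simp]: "space (sm x) = UNIV"
  by (simp add: scalar_measure_def)

lemma measurable_sm: "borel_measurable (sm x) = borel_measurable borel"
  by (rule measurable_cong_sets) auto

lemma emeasure_sm:
  assumes B: "B \<in> sets borel"
  shows "emeasure (sm x) B = ennreal (Re (cinner (EB B \<rhd> x) x))"
proof -
  have "emeasure (sm x) B = ennreal (Re (cinner (E B x) x))"
    unfolding scalar_measure_def
  proof (rule emeasure_measure_of_sigma)
    show "sigma_algebra UNIV (sets borel)" by (metis sets.sigma_algebra_axioms space_borel)
    show "positive (sets borel) (\<lambda>B. ennreal (Re (cinner (E B x) x)))"
      using EB_empty bapp_EB[of "{}" x] by (simp add: positive_def)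
    show "countably_additive (sets borel) (\<lambda>B. ennreal (Re (cinner (E B x) x)))"
    proof (rule countably_additiveI)
      fix F :: "nat \<Rightarrow> real set"
      assume F: "range F \<subseteq> sets borel" "disjoint_family F" "(\<Union>i. F i) \<in> sets borel"
      have "(\<lambda>n. Re (cinner (EB (F n) \<rhd> x) x)) sums Re (cinner (EB (\<Union>n. F n) \<rhd> x) x)"
        by (intro bounded_linear.sums[OF bounded_linear_Re]
            bounded_linear.sums[OF bounded_bilinear.bounded_linear_left[OF bounded_bilinear_cinner]]
            EB_sums F)
      moreover have "F n \<in> sets borel" for n using F by auto
      ultimately have "(\<Sum>n. ennreal (Re (cinner (EB (F n) \<rhd> x) x))) = ennreal (Re (cinner (EB (\<Union>n. F n) \<rhd> x) x))"
        by (intro suminf_ennreal_eq) (simp_all add: EB_quadratic)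
      thus "(\<Sum>n. ennreal (Re (cinner (E (F n) x) x))) = ennreal (Re (cinner (E (\<Union>n. F n) x) x))"
        using \<open>\<And>n. F n \<in> sets borel\<close> F(3) by (simp add: bapp_EB)
    qed
  qed (use B in auto)
  thus ?thesis using B by (simp add: bapp_EB)
qed

lemma finite_measure_sm: "finite_measure (sm x)"
  by (rule finite_measureI) (simp add: emeasure_sm)

lemma measure_sm: "B \<in> sets borel \<Longrightarrow> measure (sm x) B = Re (cinner (EB B \<rhd> x) x)"
  by (simp add: measure_def emeasure_sm EB_quadratic)

lemma measure_sm_UNIV: "measure (sm x) UNIV = (norm x)\<^sup>2"
  by (simp add: measure_sm EB_UNIV cinner_self)

lemma integrable_sm: "bounded_borel f \<Longrightarrow> integrable (sm x) f"
proof -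
  assume f: "bounded_borel f"
  then obtain c where "\<And>t. \<bar>f t\<bar> \<le> c" by (auto simp: bounded_borel_def)
  thus ?thesis using f
    by (intro finite_measure.integrable_const_bound[OF finite_measure_sm, where B = c])
       (auto simp: bounded_borel_def)
qed

lemma integral_sm_le:
  assumes "bounded_borel f" "\<And>t. \<bar>f t\<bar> \<le> c"
  shows "\<bar>\<integral>t. f t \<partial>sm x\<bar> \<le> c * (norm x)\<^sup>2"
proof -
  have "\<bar>\<integral>t. f t \<partial>sm x\<bar> \<le> (\<integral>t. \<bar>f t\<bar> \<partial>sm x)" by (rule integral_abs_bound)
  also have "\<dots> \<le> (\<integral>t. c \<partial>sm x)"
    using assms integrable_sm[OF assms(1)] integrable_sm[OF bounded_borel_const]
    by (intro integral_mono integrable_abs) auto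
  also have "\<dots> = c * (norm x)\<^sup>2" by (simp add: measure_sm_UNIV)
  finally show ?thesis .
qed

text \<open>The integral of f against E, characterised by its quadratic form. Being a relation, it
  can be checked on simple functions and passed to limits before existence is known.\<close>

definition has_fc :: "(real \<Rightarrow> real) \<Rightarrow> 'h bop \<Rightarrow> bool" where
  "has_fc f X \<longleftrightarrow> bounded_borel f \<and> star X = X \<and> (\<forall>x. Re (cinner (X \<rhd> x) x) = (\<integral>t. f t \<partial>sm x))"

lemma has_fc_unique: "has_fc f X \<Longrightarrow> has_fc f Y \<Longrightarrow> X = Y"
proof (rule bop_quadratic_eqI)
  fix x assume *: "has_fc f X" "has_fc f Y"
  hence "cinner (X \<rhd> x) x \<in> \<real>" "cinner (Y \<rhd> x) x \<in> \<real>" by (auto simp: has_fc_def self_adjoint_iff)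
  moreover have "Re (cinner (X \<rhd> x) x) = Re (cinner (Y \<rhd> x) x)" using * by (simp add: has_fc_def)
  ultimately show "cinner (X \<rhd> x) x = cinner (Y \<rhd> x) x" by (simp add: complex_eq_iff complex_is_Real_iff)
qed

lemma has_fc_norm: "has_fc f X \<Longrightarrow> (\<And>t. \<bar>f t\<bar> \<le> c) \<Longrightarrow> norm X \<le> c"
proof -
  assume *: "has_fc f X" "\<And>t. \<bar>f t\<bar> \<le> c"
  have "0 \<le> c" using *(2)[of 0] by linarith
  thus ?thesis using * integral_sm_le[of f c] by (intro self_adjoint_norm_le) (auto simp: has_fc_def)
qed

lemma has_fc_add: "has_fc f X \<Longrightarrow> has_fc g Y \<Longrightarrow> has_fc (\<lambda>t. f t + g t) (X + Y)"
  by (simp add: has_fc_def bounded_borel_add star_simps bapp_simps cinner_simps integrable_sm)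

lemma has_fc_scale: "has_fc f X \<Longrightarrow> has_fc (\<lambda>t. r * f t) (r *\<^sub>R X)"
  by (simp add: has_fc_def bounded_borel_scale star_simps bapp_simps cinner_simps)

lemma has_fc_diff: "has_fc f X \<Longrightarrow> has_fc g Y \<Longrightarrow> has_fc (\<lambda>t. f t - g t) (X - Y)"
  using has_fc_add[of f X "\<lambda>t. -1 * g t" "(-1) *\<^sub>R Y"] has_fc_scale[of g Y "-1"] by simp

lemma has_fc_const: "has_fc (\<lambda>_. c) (c *\<^sub>R 1)"
  by (simp add: has_fc_def bounded_borel_const star_simps bapp_simps cinner_simps cinner_self measure_sm_UNIV)

lemma has_fc_indicator: "B \<in> sets borel \<Longrightarrow> has_fc (indicator B) (EB B)"
  by (simp add: has_fc_def bounded_borel_indicator star_EB measure_sm)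

lemma has_fc_sum:
  "(\<And>i. i \<in> I \<Longrightarrow> has_fc (f i) (X i)) \<Longrightarrow> has_fc (\<lambda>t. \<Sum>i\<in>I. f i t) (\<Sum>i\<in>I. X i)"
proof (induction I rule: infinite_finite_induct)
  case (insert i I)
  thus ?case using has_fc_add[of "f i" "X i"] by simp
qed (use has_fc_const[of 0] in auto)

lemma has_fc_simple:
  assumes "f \<in> borel_measurable borel" "finite (range f)"
  shows "has_fc f (\<Sum>y\<in>range f. y *\<^sub>R EB (f -` {y}))"
proof -
  have "has_fc (\<lambda>t. \<Sum>y\<in>range f. y * indicator (f -` {y}) t) (\<Sum>y\<in>range f. y *\<^sub>R EB (f -` {y}))"
    using measurable_sets_borel[OF assms(1), of "{_}"]
    by (intro has_fc_sum has_fc_scale has_fc_indicator) simp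
  thus ?thesis using finite_range_indicator_sum[OF assms(2)] by (metis (no_types, lifting) ext)
qed

lemma has_fc_limit:
  assumes "\<And>n. has_fc (f n) (X n)" "X \<longlonglongrightarrow> Y" "bounded_borel g"
    and "\<And>n t. \<bar>f n t - g t\<bar> \<le> e n" "e \<longlonglongrightarrow> 0"
  shows "has_fc g Y"
  unfolding has_fc_def
proof (intro conjI allI assms)
  have lim: "(\<lambda>n. Re (cinner (X n \<rhd> x) x)) \<longlonglongrightarrow> Re (cinner (Y \<rhd> x) x)" for x
    by (intro tendsto_intros tendsto_cinner tendsto_bapp assms)
  have Im: "(\<lambda>n. Im (cinner (X n \<rhd> x) x)) \<longlonglongrightarrow> Im (cinner (Y \<rhd> x) x)" for x
    by (intro tendsto_intros tendsto_cinner tendsto_bapp assms)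
  have "Im (cinner (X n \<rhd> x) x) = 0" for n x
    using assms(1)[of n] self_adjoint_iff[of "X n"] by (auto simp: has_fc_def complex_is_Real_iff)
  hence "Im (cinner (Y \<rhd> x) x) = 0" for x using Im[of x] by (simp add: LIMSEQ_const_iff)
  thus "star Y = Y" by (simp add: self_adjoint_iff complex_is_Real_iff)
  fix x
  have bb: "bounded_borel (f n)" for n using assms(1) by (simp add: has_fc_def)
  have "norm ((\<integral>t. f n t \<partial>sm x) - (\<integral>t. g t \<partial>sm x)) \<le> e n * (norm x)\<^sup>2" for n
    using integral_sm_le[OF bounded_borel_diff[OF bb assms(3)] assms(4)] integrable_sm[OF bb] integrable_sm[OF assms(3)]
    by simp
  moreover have "(\<lambda>n. e n * (norm x)\<^sup>2) \<longlonglongrightarrow> 0" using tendsto_mult_right[OF assms(5)] by fastforce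
  ultimately have "(\<lambda>n. (\<integral>t. f n t \<partial>sm x) - (\<integral>t. g t \<partial>sm x)) \<longlonglongrightarrow> 0"
    by (rule Lim_null_comparison[OF always_eventually, OF allI])
  hence "(\<lambda>n. \<integral>t. f n t \<partial>sm x) \<longlonglongrightarrow> (\<integral>t. g t \<partial>sm x)" by (rule LIM_zero_cancel)
  moreover have "(\<lambda>n. \<integral>t. f n t \<partial>sm x) = (\<lambda>n. Re (cinner (X n \<rhd> x) x))"
    using assms(1) by (simp add: has_fc_def)
  ultimately show "Re (cinner (Y \<rhd> x) x) = (\<integral>t. g t \<partial>sm x)" using lim[of x] by (simp add: LIMSEQ_unique)
qed

definition simple_fc :: "(real \<Rightarrow> real) \<Rightarrow> nat \<Rightarrow> 'h bop" where
  "simple_fc f n = (\<Sum>y\<in>range (simple_approx f n). y *\<^sub>R EB (simple_approx f n -` {y}))"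

lemma has_fc_simple_approx: "bounded_borel f \<Longrightarrow> has_fc (simple_approx f n) (simple_fc f n)"
  unfolding simple_fc_def
  by (intro has_fc_simple finite_range_simple_approx bounded_borel_measurable bounded_borel_simple_approx)

lemma LIMSEQ_inverse_Suc: "(\<lambda>n. 1 / real (Suc n)) \<longlonglongrightarrow> 0"
  by (rule LIMSEQ_Suc[OF lim_1_over_n])

text \<open>The calculus is contractive for the sup norm (\<open>has_fc_norm\<close>), so uniform
  approximation of f by simple functions yields a Cauchy sequence of operators.\<close>

lemma simple_fc_convergent:
  assumes f: "bounded_borel f"
  shows "\<exists>X. simple_fc f \<longlonglongrightarrow> X \<and> has_fc f X"
proof -
  have le: "norm (simple_fc f m - simple_fc f n) \<le> 1 / real (Suc m) + 1 / real (Suc n)" for m n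
  proof (rule has_fc_norm[OF has_fc_diff[OF has_fc_simple_approx[OF f] has_fc_simple_approx[OF f]]])
    show "\<bar>simple_approx f m t - simple_approx f n t\<bar> \<le> 1 / real (Suc m) + 1 / real (Suc n)" for t
      using simple_approx_close[of f m t] simple_approx_close[of f n t] by linarith
  qed
  have "Cauchy (simple_fc f)"
  proof (rule metric_CauchyI)
    fix e :: real assume e: "0 < e"
    hence "eventually (\<lambda>n. 1 / real (Suc n) < e / 2) sequentially"
      using LIMSEQ_inverse_Suc by (intro order_tendstoD(2)) auto
    then obtain K where K: "\<And>n. n \<ge> K \<Longrightarrow> 1 / real (Suc n) < e / 2"
      by (auto simp: eventually_sequentially)
    have "dist (simple_fc f m) (simple_fc f n) < e" if "m \<ge> K" "n \<ge> K" for m n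
      using le[of m n] K[OF that(1)] K[OF that(2)] by (simp add: dist_norm)
    thus "\<exists>M. \<forall>m\<ge>M. \<forall>n\<ge>M. dist (simple_fc f m) (simple_fc f n) < e" by blast
  qed
  hence "convergent (simple_fc f)" by (rule Cauchy_convergent)
  then obtain X where X: "simple_fc f \<longlonglongrightarrow> X" unfolding convergent_def by blast
  have "has_fc f X"
    by (rule has_fc_limit[OF has_fc_simple_approx[OF f] X f simple_approx_close LIMSEQ_inverse_Suc])
  thus ?thesis using X by blast
qed

section \<open>Algebraic and continuity properties of the functional calculus\<close>

definition FC :: "(real \<Rightarrow> real) \<Rightarrow> 'h bop" where "FC f = (THE X. has_fc f X)"

lemma FC_eqI: "has_fc f X \<Longrightarrow> FC f = X"
  unfolding FC_def by (rule the_equality) (auto intro: has_fc_unique)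

lemma has_fc_FC: "bounded_borel f \<Longrightarrow> has_fc f (FC f)"
  using simple_fc_convergent[of f] FC_eqI[of f] by auto

lemma simple_fc_tendsto: "bounded_borel f \<Longrightarrow> simple_fc f \<longlonglongrightarrow> FC f"
  using simple_fc_convergent[of f] FC_eqI[of f] by auto

lemma star_FC: "bounded_borel f \<Longrightarrow> star (FC f) = FC f"
  using has_fc_FC by (simp add: has_fc_def)

lemma FC_quadratic: "bounded_borel f \<Longrightarrow> cinner (FC f \<rhd> x) x = of_real (\<integral>t. f t \<partial>sm x)"
  using has_fc_FC[of f] self_adjoint_iff[of "FC f"] star_FC[of f]
  by (auto simp: has_fc_def complex_eq_iff complex_is_Real_iff)

lemma FC_norm: "bounded_borel f \<Longrightarrow> (\<And>t. \<bar>f t\<bar> \<le> c) \<Longrightarrow> norm (FC f) \<le> c"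
  using has_fc_norm[OF has_fc_FC] by blast

lemma FC_add: "bounded_borel f \<Longrightarrow> bounded_borel g \<Longrightarrow> FC (\<lambda>t. f t + g t) = FC f + FC g"
  by (intro FC_eqI has_fc_add has_fc_FC)
lemma FC_diff: "bounded_borel f \<Longrightarrow> bounded_borel g \<Longrightarrow> FC (\<lambda>t. f t - g t) = FC f - FC g"
  by (intro FC_eqI has_fc_diff has_fc_FC)
lemma FC_scale: "bounded_borel f \<Longrightarrow> FC (\<lambda>t. r * f t) = r *\<^sub>R FC f"
  by (intro FC_eqI has_fc_scale has_fc_FC)
lemma FC_const: "FC (\<lambda>_. c) = c *\<^sub>R 1"
  by (intro FC_eqI has_fc_const)
lemma FC_indicator: "B \<in> sets borel \<Longrightarrow> FC (indicator B) = EB B"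
  by (intro FC_eqI has_fc_indicator)

lemma FC_pos: "bounded_borel f \<Longrightarrow> (\<And>t. 0 \<le> f t) \<Longrightarrow> pos (FC f)"
  unfolding pos_def by (simp add: FC_quadratic nonneg_Reals_iff)

text \<open>Multiplicativity reduces to \<open>EB_Int\<close>: both factors are finite combinations
  of projections of level sets.\<close>

lemma has_fc_mult_simple:
  assumes f: "bounded_borel f" "finite (range f)" and g: "bounded_borel g" "finite (range g)"
  shows "has_fc (\<lambda>t. f t * g t) (FC f * FC g)"
proof -
  have Bf: "f -` {y} \<in> sets borel" for y using measurable_sets_borel[OF bounded_borel_measurable[OF f(1)], of "{y}"] by simp
  have Bg: "g -` {y} \<in> sets borel" for y using measurable_sets_borel[OF bounded_borel_measurable[OF g(1)], of "{y}"] by simp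
  have F: "FC f = (\<Sum>y\<in>range f. y *\<^sub>R EB (f -` {y}))"
    using f by (intro FC_eqI has_fc_simple) (auto simp: bounded_borel_def)
  have G: "FC g = (\<Sum>z\<in>range g. z *\<^sub>R EB (g -` {z}))"
    using g by (intro FC_eqI has_fc_simple) (auto simp: bounded_borel_def)
  have "has_fc (\<lambda>t. \<Sum>y\<in>range f. \<Sum>z\<in>range g. (y * z) * indicator (f -` {y} \<inter> g -` {z}) t)
      (\<Sum>y\<in>range f. \<Sum>z\<in>range g. (y * z) *\<^sub>R EB (f -` {y} \<inter> g -` {z}))"
    using Bf Bg by (intro has_fc_sum has_fc_scale has_fc_indicator) auto
  moreover have "(\<Sum>y\<in>range f. \<Sum>z\<in>range g. (y * z) * indicator (f -` {y} \<inter> g -` {z}) t) = f t * g t" for t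
    unfolding finite_range_indicator_sum[OF f(2), of t] finite_range_indicator_sum[OF g(2), of t] sum_product
    by (intro sum.cong refl) (simp add: indicator_inter_arith)
  moreover have "(\<Sum>y\<in>range f. \<Sum>z\<in>range g. (y * z) *\<^sub>R EB (f -` {y} \<inter> g -` {z})) = FC f * FC g"
    unfolding F G sum_product using Bf Bg by (intro sum.cong refl) (simp add: EB_Int[symmetric])
  ultimately show ?thesis by simp
qed

lemma has_fc_mult:
  assumes f: "bounded_borel f" and g: "bounded_borel g"
  shows "has_fc (\<lambda>t. f t * g t) (FC f * FC g)"
proof -
  obtain a b where ab: "\<And>t. \<bar>f t\<bar> \<le> a" "\<And>t. \<bar>g t\<bar> \<le> b" using f g by (auto simp: bounded_borel_def)
  have a0: "0 \<le> a" using ab(1)[of 0] by linarith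
  let ?e = "\<lambda>n. 1 / real (Suc n) :: real"
  have eq: "FC (simple_approx h n) = simple_fc h n" if "bounded_borel h" for h n
    by (rule FC_eqI[OF has_fc_simple_approx[OF that]])
  have fc: "has_fc (\<lambda>t. simple_approx f n t * simple_approx g n t) (simple_fc f n * simple_fc g n)" for n
    using has_fc_mult_simple[OF bounded_borel_simple_approx[OF f] finite_range_simple_approx[OF f]
      bounded_borel_simple_approx[OF g] finite_range_simple_approx[OF g], of n n] by (simp add: eq f g)
  have lim: "(\<lambda>n. simple_fc f n * simple_fc g n) \<longlonglongrightarrow> FC f * FC g"
    by (intro tendsto_mult simple_fc_tendsto f g)
  have close: "\<bar>simple_approx f n t * simple_approx g n t - f t * g t\<bar> \<le> ?e n * (b + 1) + a * ?e n" for n t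
  proof -
    have 1: "\<bar>simple_approx f n t - f t\<bar> \<le> ?e n" "\<bar>simple_approx g n t - g t\<bar> \<le> ?e n"
      by (rule simple_approx_close)+
    have "?e n \<le> 1" by simp
    hence 2: "\<bar>simple_approx g n t\<bar> \<le> b + 1" using 1(2) ab(2)[of t] by linarith
    have "simple_approx f n t * simple_approx g n t - f t * g t =
        (simple_approx f n t - f t) * simple_approx g n t + f t * (simple_approx g n t - g t)"
      by (simp add: algebra_simps)
    also have "\<bar>\<dots>\<bar> \<le> \<bar>(simple_approx f n t - f t) * simple_approx g n t\<bar> + \<bar>f t * (simple_approx g n t - g t)\<bar>"
      by (rule abs_triangle_ineq)
    also have "\<dots> \<le> ?e n * (b + 1) + a * ?e n"
      unfolding abs_mult using 1 2 ab(1)[of t] a0 by (intro add_mono mult_mono) auto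
    finally show ?thesis .
  qed
  have "(\<lambda>n. ?e n * (b + 1) + a * ?e n) \<longlonglongrightarrow> 0 * (b + 1) + a * 0"
    by (intro tendsto_intros LIMSEQ_inverse_Suc)
  thus ?thesis
    using has_fc_limit[OF fc lim bounded_borel_mult[OF f g] close] by simp
qed

lemma FC_mult: "bounded_borel f \<Longrightarrow> bounded_borel g \<Longrightarrow> FC (\<lambda>t. f t * g t) = FC f * FC g"
  by (intro FC_eqI has_fc_mult)

lemma FC_one: "FC (\<lambda>_. 1) = 1" using FC_const[of 1] by simp

lemma FC_power: "bounded_borel f \<Longrightarrow> FC (\<lambda>t. f t ^ n) = FC f ^ n"
  by (induction n) (simp_all add: FC_one FC_mult bounded_borel_power)

lemma norm_FC_bapp: "bounded_borel f \<Longrightarrow> (norm (FC f \<rhd> x))\<^sup>2 = (\<integral>t. (f t)\<^sup>2 \<partial>sm x)"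
proof -
  assume f: "bounded_borel f"
  have "of_real ((norm (FC f \<rhd> x))\<^sup>2) = cinner (FC f \<rhd> FC f \<rhd> x) x"
    using f by (simp add: cinner_star star_FC cinner_self)
  also have "\<dots> = cinner (FC (\<lambda>t. f t * f t) \<rhd> x) x" using f by (simp add: FC_mult bapp_mult)
  also have "\<dots> = of_real (\<integral>t. (f t)\<^sup>2 \<partial>sm x)"
    using f by (simp add: FC_quadratic bounded_borel_mult power2_eq_square)
  finally show ?thesis using of_real_eq_iff by blast
qed

text \<open>By \<open>norm_FC_bapp\<close> the squared distance at x is the integral of (f_n - g)^2
  against the finite measure \<open>sm x\<close>, to which dominated convergence applies.\<close>

lemma FC_strong_limit:
  assumes f: "\<And>n. bounded_borel (f n)" "\<And>n t. \<bar>f n t\<bar> \<le> c" and g: "bounded_borel g"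
    and lim: "\<And>t. (\<lambda>n. f n t) \<longlonglongrightarrow> g t"
  shows "(\<lambda>n. FC (f n) \<rhd> x) \<longlonglongrightarrow> FC g \<rhd> x"
proof -
  obtain b where b: "\<And>t. \<bar>g t\<bar> \<le> b" using g by (auto simp: bounded_borel_def)
  have "(\<lambda>n. \<integral>t. (f n t - g t)\<^sup>2 \<partial>sm x) \<longlonglongrightarrow> (\<integral>t. 0 \<partial>sm x)"
  proof (rule integral_dominated_convergence[where w = "\<lambda>_. (c + b)\<^sup>2"])
    show "integrable (sm x) (\<lambda>_. (c + b)\<^sup>2)" by (rule integrable_sm[OF bounded_borel_const])
    show "(\<lambda>t. (f n t - g t)\<^sup>2) \<in> borel_measurable (sm x)" for n
      using bounded_borel_measurable[OF bounded_borel_power[OF bounded_borel_diff[OF f(1)[of n] g]]]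
      by (simp add: measurable_sm)
    show "AE t in sm x. (\<lambda>n. (f n t - g t)\<^sup>2) \<longlonglongrightarrow> 0"
      using tendsto_power[OF LIM_zero[OF lim], where n = 2] by simp
    have "\<bar>f n t - g t\<bar> \<le> c + b" for n t using f(2)[of n t] b[of t] by linarith
    hence "\<bar>f n t - g t\<bar>\<^sup>2 \<le> (c + b)\<^sup>2" for n t by (intro power_mono) auto
    thus "AE t in sm x. norm ((f n t - g t)\<^sup>2) \<le> (c + b)\<^sup>2" for n by simp
  qed auto
  hence "(\<lambda>n. (norm ((FC (f n) - FC g) \<rhd> x))\<^sup>2) \<longlonglongrightarrow> 0"
    using f g by (simp add: FC_diff[symmetric] norm_FC_bapp bounded_borel_diff)
  hence "(\<lambda>n. sqrt ((norm (FC (f n) \<rhd> x - FC g \<rhd> x))\<^sup>2)) \<longlonglongrightarrow> sqrt 0"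
    by (intro tendsto_intros) (simp add: bapp_diff_left)
  hence "(\<lambda>n. norm (FC (f n) \<rhd> x - FC g \<rhd> x)) \<longlonglongrightarrow> 0" by simp
  thus ?thesis by (rule LIM_zero_cancel[OF tendsto_norm_zero_cancel])
qed

text \<open>\<open>EB B\<close> after \<open>FC f\<close> is the calculus at the product of the
  indicator and f, and its squared norm at x is an integral against \<open>sm x\<close>.\<close>

lemma sm_FC:
  assumes f: "bounded_borel f"
  shows "sm (FC f \<rhd> x) = density (sm x) (\<lambda>t. ennreal ((f t)\<^sup>2))"
proof (rule measure_eqI)
  fix B assume "B \<in> sets (sm (FC f \<rhd> x))"
  hence B: "B \<in> sets borel" by simp
  have bB: "bounded_borel (\<lambda>t. indicator B t * f t)" by (intro bounded_borel_mult bounded_borel_indicator B f)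
  have int: "integrable (sm x) (\<lambda>t. (indicator B t * f t)\<^sup>2)"
    using bB by (intro integrable_sm bounded_borel_power)
  have "emeasure (sm (FC f \<rhd> x)) B = ennreal ((norm (EB B \<rhd> FC f \<rhd> x))\<^sup>2)"
    using B by (simp add: emeasure_sm EB_quadratic)
  also have "EB B \<rhd> FC f \<rhd> x = FC (\<lambda>t. indicator B t * f t) \<rhd> x"
    using B f by (simp add: FC_mult bounded_borel_indicator FC_indicator bapp_mult)
  also have "(norm \<dots>)\<^sup>2 = (\<integral>t. (indicator B t * f t)\<^sup>2 \<partial>sm x)" by (rule norm_FC_bapp[OF bB])
  also have "ennreal \<dots> = (\<integral>\<^sup>+t. ennreal ((indicator B t * f t)\<^sup>2) \<partial>sm x)"
    by (rule nn_integral_eq_integral[symmetric, OF int]) auto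
  also have "\<dots> = (\<integral>\<^sup>+t. ennreal ((f t)\<^sup>2) * indicator B t \<partial>sm x)"
    by (intro nn_integral_cong) (auto simp: indicator_def)
  also have "\<dots> = emeasure (density (sm x) (\<lambda>t. ennreal ((f t)\<^sup>2))) B"
    using B f by (subst emeasure_density) (auto simp: bounded_borel_def)
  finally show "emeasure (sm (FC f \<rhd> x)) B = emeasure (density (sm x) (\<lambda>t. ennreal ((f t)\<^sup>2))) B" .
qed simp

end

section \<open>Unbounded operators and their spectral measures\<close>

lemma linear_operator_add:
  "linear_operator T \<Longrightarrow> (x, y) \<in> T \<Longrightarrow> (x', y') \<in> T \<Longrightarrow> (x + x', y + y') \<in> T"
  by (simp add: linear_operator_def)

lemma linear_operator_scaleC: "linear_operator T \<Longrightarrow> (x, y) \<in> T \<Longrightarrow> (c *\<^sub>C x, c *\<^sub>C y) \<in> T"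
  by (simp add: linear_operator_def)

lemma linear_operator_diff:
  "linear_operator T \<Longrightarrow> (x, y) \<in> T \<Longrightarrow> (x', y') \<in> T \<Longrightarrow> (x - x', y - y') \<in> T"
  using linear_operator_add[of T x y "(-1) *\<^sub>C x'" "(-1) *\<^sub>C y'"] linear_operator_scaleC[of T x' y' "-1"]
    scaleC_of_real[of "-1" x'] scaleC_of_real[of "-1" y'] by simp

lemma linear_operator_unique: "linear_operator T \<Longrightarrow> (x, y) \<in> T \<Longrightarrow> (x, y') \<in> T \<Longrightarrow> y = y'"
  by (auto simp: linear_operator_def single_valued_def)

lemma adjD: "(w, z) \<in> adj T \<Longrightarrow> (x, y) \<in> T \<Longrightarrow> cinner y w = cinner x z"
  by (auto simp: adj_def)

lemma adj_diff: "(x, y) \<in> adj T \<Longrightarrow> (x', y') \<in> adj T \<Longrightarrow> (x - x', y - y') \<in> adj T"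
  by (fastforce simp: adj_def cinner_simps)

lemma abs_le_one_plus_square: "\<bar>t::real\<bar> \<le> 1 + t\<^sup>2"
proof -
  have "0 \<le> (\<bar>t\<bar> - 1)\<^sup>2" by simp
  also have "\<dots> = t\<^sup>2 + 1 - 2 * \<bar>t\<bar>" by (simp add: power2_diff)
  finally show ?thesis using abs_ge_zero[of t] by linarith
qed

definition trunc :: "nat \<Rightarrow> real \<Rightarrow> real" where
  "trunc m t = (if \<bar>t\<bar> \<le> real m then 1 else 0)"

lemma trunc_measurable [measurable]: "trunc m \<in> borel_measurable borel"
  unfolding trunc_def[abs_def] by measurable

lemma trunc_bounds: "0 \<le> trunc m t" "trunc m t \<le> 1" "\<bar>trunc m t\<bar> \<le> 1"
  by (auto simp: trunc_def)

lemma bounded_borel_trunc: "bounded_borel (trunc m)"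
  by (rule bounded_borelI[OF trunc_measurable trunc_bounds(3)])

lemma abs_mult_trunc_le: "\<bar>f t * trunc m t\<bar> \<le> \<bar>f t\<bar>"
  by (auto simp: trunc_def)

lemma trunc_tendsto: "(\<lambda>m. f t * trunc m t) \<longlonglongrightarrow> f t"
proof (rule tendsto_eventually)
  show "\<forall>\<^sub>F m in sequentially. f t * trunc m t = f t"
    using eventually_ge_at_top[of "nat \<lceil>\<bar>t\<bar>\<rceil>"] by eventually_elim (auto simp: trunc_def)
qed

lemma bounded_borel_id_power_trunc: "bounded_borel (\<lambda>t. t ^ k * trunc m t)"
proof (rule bounded_borelI)
  show "\<bar>t ^ k * trunc m t\<bar> \<le> real m ^ k" for t
    by (auto simp: trunc_def power_abs intro: power_mono)
qed measurable

lemma bounded_borel_id_trunc: "bounded_borel (\<lambda>t. t * trunc m t)"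
  using bounded_borel_id_power_trunc[of 1 m] by simp

text \<open>At t = |T| this becomes the resolvent (T*T + \<epsilon>)^{-1}.\<close>

definition res :: "real \<Rightarrow> real \<Rightarrow> real" where "res \<epsilon> t = 1 / (t\<^sup>2 + \<epsilon>)"

lemma res_bounds: "0 < \<epsilon> \<Longrightarrow> 0 < res \<epsilon> t" "0 < \<epsilon> \<Longrightarrow> res \<epsilon> t \<le> 1 / \<epsilon>"
  by (auto simp: res_def add_nonneg_pos intro!: divide_left_mono mult_pos_pos)

lemma bounded_borel_res: "0 < \<epsilon> \<Longrightarrow> bounded_borel (res \<epsilon>)"
  by (rule bounded_borelI[of _ "1 / \<epsilon>"])
     (use res_bounds in \<open>auto simp: abs_of_pos res_def[abs_def]\<close>)

lemma (in spectral_pvm) FC_trunc_limit: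
  assumes g: "bounded_borel g"
  shows "(\<lambda>m. FC (\<lambda>t. g t * trunc m t) \<rhd> x) \<longlonglongrightarrow> FC g \<rhd> x"
proof -
  obtain c where c: "\<And>t. \<bar>g t\<bar> \<le> c" using g by (auto simp: bounded_borel_def)
  show ?thesis
  proof (rule FC_strong_limit[where f = "\<lambda>m t. g t * trunc m t" and c = c])
    show "\<bar>g t * trunc m t\<bar> \<le> c" for m t
      using abs_mult_trunc_le[of g t m] c[of t] by linarith
  qed (intro bounded_borel_mult g bounded_borel_trunc trunc_tendsto)+
qed

locale spectral_op = spectral_pvm E for E :: "real set \<Rightarrow> 'h::complex_hilbert \<Rightarrow> 'h" +
  fixes A :: "'h operator"
  assumes psa: "positive_self_adjoint A" and spectral: "is_spectral_measure A E"
begin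

lemma linA: "linear_operator A" and closedA: "closed A" and denseA: "closure (Domain A) = UNIV"
  using psa by (simp_all add: positive_self_adjoint_def closed_densely_defined_def)

lemma Domain_A: "x \<in> Domain A \<longleftrightarrow> (\<integral>\<^sup>+t. ennreal (t\<^sup>2) \<partial>sm x) < \<infinity>"
  using spectral by (auto simp: is_spectral_measure_def)

lemma cinner_A: "(x, y) \<in> A \<Longrightarrow> cinner y x = of_real (\<integral>t. t \<partial>sm x)"
  using spectral by (auto simp: is_spectral_measure_def)

lemma A_quadratic_limit:
  assumes "(x, y) \<in> A"
  shows "(\<lambda>m. cinner (FC (\<lambda>t. t * trunc m t) \<rhd> x) x) \<longlonglongrightarrow> cinner y x"
proof -
  have fin: "(\<integral>\<^sup>+t. ennreal (t\<^sup>2) \<partial>sm x) < \<infinity>" using assms Domain_A by blast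
  have int: "integrable (sm x) (\<lambda>t. t\<^sup>2)"
    using fin by (intro integrableI_nonneg) (auto simp: measurable_sm)
  have "(\<lambda>m. \<integral>t. t * trunc m t \<partial>sm x) \<longlonglongrightarrow> (\<integral>t. t \<partial>sm x)"
  proof (rule integral_dominated_convergence[where w = "\<lambda>t. 1 + t\<^sup>2"])
    show "integrable (sm x) (\<lambda>t. 1 + t\<^sup>2)"
      using int integrable_sm[OF bounded_borel_const] by auto
    show "AE t in sm x. (\<lambda>m. t * trunc m t) \<longlonglongrightarrow> t" by (simp add: trunc_tendsto[of "\<lambda>t. t"])
    show "AE t in sm x. norm (t * trunc m t) \<le> 1 + t\<^sup>2" for m
    proof (rule AE_I2)
      fix t :: real
      show "norm (t * trunc m t) \<le> 1 + t\<^sup>2"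
        using abs_le_one_plus_square[of t] abs_mult_trunc_le[of "\<lambda>t. t" t m] by simp
    qed
  qed (auto simp: measurable_sm)
  hence "(\<lambda>m. complex_of_real (\<integral>t. t * trunc m t \<partial>sm x)) \<longlonglongrightarrow> of_real (\<integral>t. t \<partial>sm x)"
    by (rule tendsto_of_real)
  thus ?thesis by (simp add: FC_quadratic bounded_borel_id_trunc cinner_A[OF assms])
qed

text \<open>\<open>is_spectral_measure\<close> specifies only the quadratic form of
  \<open>A\<close>; polarization within the domain extends the limit to pairs of vectors.\<close>

lemma A_weak_limit:
  assumes "(x, y) \<in> A" "(u, v) \<in> A"
  shows "(\<lambda>m. cinner (FC (\<lambda>t. t * trunc m t) \<rhd> x) u) \<longlonglongrightarrow> cinner y u"
proof -
  let ?Z = "\<lambda>m. FC (\<lambda>t. t * trunc m t)"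
  have iv: "(\<i> *\<^sub>C u, \<i> *\<^sub>C v) \<in> A" by (rule linear_operator_scaleC[OF linA assms(2)])
  have "(\<lambda>m. cinner (?Z m \<rhd> (x + u)) (x + u) - cinner (?Z m \<rhd> (x - u)) (x - u)
     + \<i> * cinner (?Z m \<rhd> (x + \<i> *\<^sub>C u)) (x + \<i> *\<^sub>C u) - \<i> * cinner (?Z m \<rhd> (x - \<i> *\<^sub>C u)) (x - \<i> *\<^sub>C u))
     \<longlonglongrightarrow> cinner (y + v) (x + u) - cinner (y - v) (x - u)
     + \<i> * cinner (y + \<i> *\<^sub>C v) (x + \<i> *\<^sub>C u) - \<i> * cinner (y - \<i> *\<^sub>C v) (x - \<i> *\<^sub>C u)"
    by (intro tendsto_intros A_quadratic_limit linear_operator_add[OF linA] linear_operator_diff[OF linA] assms iv)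
  hence "(\<lambda>m. 4 * cinner (?Z m \<rhd> x) u) \<longlonglongrightarrow> 4 * cinner y u"
    unfolding bop_polarization by (simp add: cinner_simps algebra_simps)
  from tendsto_mult_left[OF this, of "1/4"] show ?thesis by simp
qed

text \<open>\<open>sm_FC\<close> puts \<open>FC f \<rhd> x\<close> into the domain. Its image under
  \<open>A\<close> and the expected vector are weak limits of the same truncations against vectors
  of the domain, which is dense.\<close>

lemma A_FC:
  assumes f: "bounded_borel f" and tf: "bounded_borel (\<lambda>t. t * f t)"
  shows "(FC f \<rhd> x, FC (\<lambda>t. t * f t) \<rhd> x) \<in> A"
proof -
  let ?g = "\<lambda>t. t * f t"
  have "(\<integral>\<^sup>+t. ennreal (t\<^sup>2) \<partial>sm (FC f \<rhd> x)) = (\<integral>\<^sup>+t. ennreal ((f t)\<^sup>2) * ennreal (t\<^sup>2) \<partial>sm x)"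
    unfolding sm_FC[OF f] using bounded_borel_measurable[OF f]
    by (intro nn_integral_density) (auto simp: measurable_sm)
  also have "\<dots> = (\<integral>\<^sup>+t. ennreal ((?g t)\<^sup>2) \<partial>sm x)"
    by (intro nn_integral_cong) (simp add: ennreal_mult[symmetric] power_mult_distrib mult.commute)
  also have "\<dots> < \<infinity>"
    using nn_integral_eq_integral[OF integrable_sm[OF bounded_borel_power[OF tf, of 2]]] by simp
  finally obtain w where w: "(FC f \<rhd> x, w) \<in> A" using Domain_A by blast
  have orth: "cinner (w - FC ?g \<rhd> x) u = 0" if u: "u \<in> Domain A" for u
  proof -
    obtain v where v: "(u, v) \<in> A" using u by blast
    have "(\<lambda>m. FC (\<lambda>t. ?g t * trunc m t) \<rhd> x) \<longlonglongrightarrow> FC ?g \<rhd> x" by (rule FC_trunc_limit[OF tf])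
    moreover have "FC (\<lambda>t. ?g t * trunc m t) \<rhd> x = FC (\<lambda>t. t * trunc m t) \<rhd> FC f \<rhd> x" for m
      using FC_mult[OF bounded_borel_id_trunc f, of m] by (simp add: bapp_mult[symmetric] mult_ac)
    ultimately have "(\<lambda>m. cinner (FC (\<lambda>t. t * trunc m t) \<rhd> FC f \<rhd> x) u) \<longlonglongrightarrow> cinner (FC ?g \<rhd> x) u"
      by (intro tendsto_cinner) auto
    moreover have "(\<lambda>m. cinner (FC (\<lambda>t. t * trunc m t) \<rhd> FC f \<rhd> x) u) \<longlonglongrightarrow> cinner w u"
      by (rule A_weak_limit[OF w v])
    ultimately show ?thesis by (simp add: cinner_simps LIMSEQ_unique)
  qed
  have "closed {u. cinner (w - FC ?g \<rhd> x) u = 0}"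
    by (intro closed_Collect_eq continuous_intros
        bounded_linear.continuous_on[OF bounded_bilinear.bounded_linear_right[OF bounded_bilinear_cinner]])
  hence "closure (Domain A) \<subseteq> {u. cinner (w - FC ?g \<rhd> x) u = 0}"
    using orth by (intro closure_minimal) auto
  hence "cinner (w - FC ?g \<rhd> x) (w - FC ?g \<rhd> x) = 0" using denseA by auto
  hence "w = FC ?g \<rhd> x" by (simp add: cinner_self)
  thus ?thesis using w by simp
qed

text \<open>On the piece \<open>B n\<close> of the negative axis t is at most -1/(n + 1), so
  positivity of \<open>A\<close> at the spectral projection of x forces the mass of
  \<open>B n\<close> to be at most 0.\<close>

lemma sm_negative: "emeasure (sm x) {..<0} = 0"
proof -
  define B where "B n = {- real n .. - 1 / real (Suc n)}" for n
  have B: "B n \<in> sets borel" for n by (simp add: B_def)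
  have "emeasure (sm x) (B n) = 0" for n
  proof -
    have tB: "bounded_borel (\<lambda>t. t * indicator (B n) t)"
    proof (rule bounded_borelI)
      show "\<bar>t * indicator (B n) t\<bar> \<le> real n" for t
        by (auto simp: B_def indicator_def)
           (smt (verit) divide_nonneg_nonneg of_nat_0_le_iff)
    qed (use B in measurable)
    let ?I = "indicator (B n) :: real \<Rightarrow> real" and ?g = "\<lambda>t. t * indicator (B n) t :: real"
    have bI: "bounded_borel ?I" by (rule bounded_borel_indicator[OF B])
    have "(FC ?I \<rhd> x, FC ?g \<rhd> x) \<in> A" by (rule A_FC[OF bI tB])
    hence "cinner (FC ?g \<rhd> x) (FC ?I \<rhd> x) \<in> \<real>\<^sub>\<ge>\<^sub>0"
      using psa by (auto simp: positive_self_adjoint_def)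
    also have "cinner (FC ?g \<rhd> x) (FC ?I \<rhd> x) = cinner (FC ?I \<rhd> FC ?g \<rhd> x) x"
      by (simp add: cinner_star star_FC bI)
    also have "FC ?I \<rhd> FC ?g \<rhd> x = FC (\<lambda>t. ?I t * ?g t) \<rhd> x"
      by (simp add: FC_mult[OF bI tB] bapp_mult)
    also have "(\<lambda>t. ?I t * ?g t) = ?g" by (auto simp: indicator_def)
    also have "cinner (FC ?g \<rhd> x) x = of_real (\<integral>t. ?g t \<partial>sm x)" by (rule FC_quadratic[OF tB])
    finally have "0 \<le> (\<integral>t. ?g t \<partial>sm x)" by (simp add: nonneg_Reals_iff)
    also have "\<dots> \<le> (\<integral>t. (- 1 / real (Suc n)) * ?I t \<partial>sm x)"
      by (rule integral_mono[OF integrable_sm[OF tB] integrable_sm[OF bounded_borel_scale[OF bI]]])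
         (auto simp: B_def indicator_def)
    also have "\<dots> = (- 1 / real (Suc n)) * measure (sm x) (B n)"
      using B by simp
    finally have "measure (sm x) (B n) \<le> 0" by (simp add: divide_le_0_iff mult_le_0_iff)
    hence "measure (sm x) (B n) = 0" using measure_nonneg[of "sm x" "B n"] by linarith
    thus ?thesis
      by (simp add: finite_measure.emeasure_eq_measure[OF finite_measure_sm])
  qed
  hence "emeasure (sm x) (\<Union>n. B n) = 0"
    by (intro emeasure_UN_eq_0) (auto simp: B)
  moreover have "(\<Union>n. B n) = {..<0}"
  proof (intro equalityI subsetI)
    fix t :: real assume "t \<in> {..<0}"
    hence t: "t < 0" by simp
    obtain n1 where n1: "1 / real (Suc n1) < - t" using nat_approx_posE[of "- t"] t by auto
    obtain n2 where n2: "real n2 > - t" using reals_Archimedean2 by blast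
    have "t \<in> B (max n1 n2)"
    proof -
      have "1 / real (Suc (max n1 n2)) \<le> 1 / real (Suc n1)" by (intro divide_left_mono) auto
      moreover have "real n2 \<le> real (max n1 n2)" by simp
      ultimately show ?thesis using n1 n2 by (simp add: B_def)
    qed
    thus "t \<in> (\<Union>n. B n)" by blast
  next
    fix t assume "t \<in> (\<Union>n. B n)"
    then obtain n where "t \<le> - 1 / real (Suc n)" by (auto simp: B_def)
    moreover have "- 1 / real (Suc n) < 0" by simp
    ultimately show "t \<in> {..<0}" by (simp only: lessThan_iff)
  qed
  ultimately show ?thesis by simp
qed

lemma EB_negative: "EB {..<0} = 0"
proof (rule bop_eqI)
  fix x
  have "ennreal ((norm (EB {..<0} \<rhd> x))\<^sup>2) = 0"
    using sm_negative[of x] by (simp add: emeasure_sm EB_quadratic)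
  thus "EB {..<0} \<rhd> x = 0 \<rhd> x" by simp
qed

lemma EB_nonneg_part:
  assumes "B \<in> sets borel"
  shows "EB B = EB (B \<inter> {0..})"
proof -
  have "EB ((B \<inter> {0..}) \<union> (B \<inter> {..<0})) = EB (B \<inter> {0..}) + EB (B \<inter> {..<0})"
    using assms by (intro EB_Un) auto
  moreover have "(B \<inter> {0..}) \<union> (B \<inter> {..<0}) = B" by auto
  ultimately have "EB B = EB (B \<inter> {0..}) + EB (B \<inter> {..<0})" by simp
  also have "EB (B \<inter> {..<0}) = 0"
    using EB_Int[OF assms, of "{..<0}"] by (simp add: EB_negative)
  finally show ?thesis by simp
qed

lemma EB_cong_nonneg:
  assumes "B \<in> sets borel" "C \<in> sets borel" "\<And>t. 0 \<le> t \<Longrightarrow> t \<in> B \<longleftrightarrow> t \<in> C"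
  shows "EB B = EB C"
proof -
  have "B \<inter> {0..} = C \<inter> {0..}" using assms(3) by auto
  thus ?thesis using EB_nonneg_part[OF assms(1)] EB_nonneg_part[OF assms(2)] by simp
qed

text \<open>The pointwise identity t^2 res = 1 - \<epsilon> res, read as a resolvent equation for
  A^2. It determines \<open>FC (res \<epsilon>)\<close> through A^2 = T*T alone.\<close>

lemma A_res:
  assumes \<epsilon>: "0 < \<epsilon>"
  shows "(FC (res \<epsilon>) \<rhd> x, x - \<epsilon> *\<^sub>R (FC (res \<epsilon>) \<rhd> x)) \<in> A O A"
proof -
  have eq: "t * (t * res \<epsilon> t) = 1 - \<epsilon> * res \<epsilon> t" for t
  proof -
    have "t\<^sup>2 + \<epsilon> \<noteq> 0" using \<epsilon> zero_le_power2[of t] by linarith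
    thus ?thesis by (simp add: res_def divide_simps) (simp add: power2_eq_square)
  qed
  have b0: "bounded_borel (res \<epsilon>)" by (rule bounded_borel_res[OF \<epsilon>])
  have b2: "bounded_borel (\<lambda>t. t * (t * res \<epsilon> t))"
    unfolding eq by (intro bounded_borel_diff bounded_borel_const bounded_borel_scale b0)
  have b1: "bounded_borel (\<lambda>t. t * res \<epsilon> t)"
  proof (rule bounded_borelI)
    fix t
    have r: "0 \<le> res \<epsilon> t" using res_bounds(1)[OF \<epsilon>, of t] by simp
    have "\<bar>t * res \<epsilon> t\<bar> = \<bar>t\<bar> * res \<epsilon> t" using r by (simp add: abs_mult)
    also have "\<dots> \<le> (1 + t\<^sup>2) * res \<epsilon> t" by (rule mult_right_mono[OF abs_le_one_plus_square r])
    also have "\<dots> = res \<epsilon> t + (1 - \<epsilon> * res \<epsilon> t)" using eq[of t] by (simp add: power2_eq_square algebra_simps)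
    also have "\<dots> \<le> 1 / \<epsilon> + 1" using res_bounds[OF \<epsilon>, of t] \<epsilon> by (simp add: add_mono)
    finally show "\<bar>t * res \<epsilon> t\<bar> \<le> 1 / \<epsilon> + 1" .
  qed (use bounded_borel_measurable[OF b0] in auto)
  have "(FC (res \<epsilon>) \<rhd> x, FC (\<lambda>t. t * res \<epsilon> t) \<rhd> x) \<in> A" by (rule A_FC[OF b0 b1])
  moreover have "(FC (\<lambda>t. t * res \<epsilon> t) \<rhd> x, FC (\<lambda>t. t * (t * res \<epsilon> t)) \<rhd> x) \<in> A" by (rule A_FC[OF b1 b2])
  moreover have "FC (\<lambda>t. t * (t * res \<epsilon> t)) = 1 - \<epsilon> *\<^sub>R FC (res \<epsilon>)"
    unfolding eq using b0 by (simp add: FC_diff FC_scale FC_one bounded_borel_const bounded_borel_scale)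
  ultimately show ?thesis by (auto simp: bapp_simps intro: relcompI)
qed

end

text \<open>T*T + \<epsilon> is injective: the difference of two solutions satisfies |w - w'|^2 =
  -\<epsilon> |x - x'|^2. This pins down the resolvent in terms of T, whichever modulus and spectral
  measure it came from.\<close>

lemma modulus_square_unique:
  assumes T: "linear_operator T" and \<epsilon>: "0 < \<epsilon>"
    and x: "(x, y - \<epsilon> *\<^sub>R x) \<in> T O adj T" and x': "(x', y - \<epsilon> *\<^sub>R x') \<in> T O adj T"
  shows "x = x'"
proof -
  obtain w w' where w: "(x, w) \<in> T" "(w, y - \<epsilon> *\<^sub>R x) \<in> adj T" "(x', w') \<in> T" "(w', y - \<epsilon> *\<^sub>R x') \<in> adj T"
    using x x' by blast
  have "(w - w', (y - \<epsilon> *\<^sub>R x) - (y - \<epsilon> *\<^sub>R x')) \<in> adj T" by (rule adj_diff[OF w(2,4)])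
  moreover have "(x - x', w - w') \<in> T" by (rule linear_operator_diff[OF T w(1,3)])
  ultimately have "cinner (w - w') (w - w') = cinner (x - x') ((y - \<epsilon> *\<^sub>R x) - (y - \<epsilon> *\<^sub>R x'))"
    by (rule adjD)
  also have "(y - \<epsilon> *\<^sub>R x) - (y - \<epsilon> *\<^sub>R x') = - (\<epsilon> *\<^sub>R (x - x'))" by (simp add: algebra_simps)
  also have "cinner (x - x') \<dots> = of_real (- \<epsilon> * (norm (x - x'))\<^sup>2)"
    by (simp only: cinner_minus_right cinner_scaleR_right cinner_self) simp
  finally have "(norm (w - w'))\<^sup>2 = - \<epsilon> * (norm (x - x'))\<^sup>2"
    by (simp only: cinner_self of_real_eq_iff)
  hence "\<epsilon> * (norm (x - x'))\<^sup>2 \<le> 0" using zero_le_power2[of "norm (w - w')"] by linarith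
  thus ?thesis using \<epsilon> by (simp add: mult_le_0_iff)
qed

text \<open>A property of bounded Borel functions that holds for \<open>\<phi>\<close> and passes to algebraic combinations
  and bounded pointwise limits holds for all indicators of sets in \<open>\<sigma>(\<phi>)\<close>, since
  polynomials in \<open>\<phi>\<close> approximate continuous functions of \<open>\<phi>\<close>.\<close>

lemma bounded_borel_class_induct:
  fixes \<phi> :: "real \<Rightarrow> real"
  assumes \<phi>: "\<phi> \<in> borel_measurable borel" "\<And>t. \<phi> t \<in> {0..1}"
    and const: "\<And>c. Q (\<lambda>_. c)" and base: "Q \<phi>"
    and add: "\<And>f g. bounded_borel f \<Longrightarrow> bounded_borel g \<Longrightarrow> Q f \<Longrightarrow> Q g \<Longrightarrow> Q (\<lambda>t. f t + g t)"
    and mult: "\<And>f g. bounded_borel f \<Longrightarrow> bounded_borel g \<Longrightarrow> Q f \<Longrightarrow> Q g \<Longrightarrow> Q (\<lambda>t. f t * g t)"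
    and limit: "\<And>f g c. (\<And>n. bounded_borel (f n)) \<Longrightarrow> (\<And>n. Q (f n)) \<Longrightarrow> (\<And>n t. \<bar>f n t\<bar> \<le> c) \<Longrightarrow>
      bounded_borel g \<Longrightarrow> (\<And>t. (\<lambda>n. f n t) \<longlonglongrightarrow> g t) \<Longrightarrow> Q g"
    and B: "B \<in> sets borel"
  shows "Q (\<lambda>t. indicator B (\<phi> t))"
proof -
  have b\<phi>: "bounded_borel \<phi>" using \<phi> by (intro bounded_borelI[of _ 1]) auto
  define K where "K f \<longleftrightarrow> bounded_borel f \<and> Q f" for f
  have Kconst: "K (\<lambda>_. c)" for c by (simp add: K_def bounded_borel_const const)
  have Kadd: "K (\<lambda>t. f t + g t)" if "K f" "K g" for f g
    using that add bounded_borel_add by (simp add: K_def)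
  have Kmult: "K (\<lambda>t. f t * g t)" if "K f" "K g" for f g
    using that mult bounded_borel_mult by (simp add: K_def)
  have Klim: "K g" if "\<And>n. K (f n)" "\<And>n t. \<bar>f n t\<bar> \<le> c" "\<And>t. (\<lambda>n. f n t) \<longlonglongrightarrow> g t" for f g and c :: real
  proof -
    have "f n \<in> borel_measurable borel" for n using that(1)[of n] by (simp add: K_def bounded_borel_def)
    hence "g \<in> borel_measurable borel"
      by (rule borel_measurable_LIMSEQ_real[where u = f, OF that(3)])
    moreover have "\<bar>g t\<bar> \<le> c" for t
      by (rule LIMSEQ_le_const2[OF tendsto_rabs[OF that(3)[of t]]]) (use that(2) in blast)
    ultimately have "bounded_borel g" by (rule bounded_borelI)
    thus ?thesis using limit[of f c g] that by (simp add: K_def)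
  qed
  have Kpoly: "K (\<lambda>t. p (\<phi> t))" if "real_polynomial_function p" for p
    using that
  proof (induction p rule: real_polynomial_function.induct)
    case (linear p)
    obtain a where "\<And>s. p s = a * s"
      using linear_scale[OF bounded_linear.linear[OF linear], of _ 1] by (metis mult.commute mult.right_neutral real_scaleR_def)
    moreover have "K \<phi>" using b\<phi> base by (simp add: K_def)
    ultimately show ?case using Kmult[OF Kconst[of a], of \<phi>] by simp
  qed (auto intro: Kconst Kadd Kmult)
  have Kcont: "K (\<lambda>t. f (\<phi> t))" if f: "continuous_on {0..1} f" for f :: "real \<Rightarrow> real"
  proof -
    have "\<exists>p. real_polynomial_function p \<and> (\<forall>s\<in>{0..1}. \<bar>f s - p s\<bar> < 1 / real (Suc n))" for n
      by (rule Stone_Weierstrass_real_polynomial_function[OF compact_Icc f, of "1 / real (Suc n)"]) auto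
    then obtain p where p: "\<And>n. real_polynomial_function (p n)" "\<And>n s. s \<in> {0..1} \<Longrightarrow> \<bar>f s - p n s\<bar> < 1 / real (Suc n)"
      by metis
    have "bounded (f ` {0..1})" by (intro compact_imp_bounded compact_continuous_image f) simp
    then obtain c where c: "\<And>s. s \<in> {0..1} \<Longrightarrow> \<bar>f s\<bar> \<le> c"
      unfolding bounded_iff real_norm_def by blast
    show ?thesis
    proof (rule Klim[OF Kpoly[OF p(1)]])
      fix n t
      have "1 / real (Suc n) \<le> 1" by simp
      thus "\<bar>p n (\<phi> t)\<bar> \<le> c + 1" using p(2)[OF \<phi>(2)[of t], of n] c[OF \<phi>(2)[of t]] by linarith
    next
      fix t
      have "(\<lambda>n. p n (\<phi> t) - f (\<phi> t)) \<longlonglongrightarrow> 0"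
      proof (rule Lim_null_comparison[OF always_eventually[OF allI] LIMSEQ_Suc[OF lim_1_over_n]])
        show "norm (p n (\<phi> t) - f (\<phi> t)) \<le> 1 / real (Suc n)" for n
          using p(2)[OF \<phi>(2)[of t], of n] by simp
      qed
      thus "(\<lambda>n. p n (\<phi> t)) \<longlonglongrightarrow> f (\<phi> t)" by (rule LIM_zero_cancel)
    qed
  qed
  have Kle: "K (\<lambda>t. indicator {..a} (\<phi> t))" for a
  proof (rule Klim[where c = 1])
    \<comment> \<open>Continuous ramps, equal to 1 up to a and falling to 0 within distance 1/n,
      converge pointwise to the indicator.\<close>
    fix n show "K (\<lambda>t. max 0 (min 1 (1 - real n * (\<phi> t - a))))"
      by (rule Kcont) (intro continuous_intros)
  next
    fix t
    show "(\<lambda>n. max 0 (min 1 (1 - real n * (\<phi> t - a)))) \<longlonglongrightarrow> indicator {..a} (\<phi> t)"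
    proof (cases "\<phi> t \<le> a")
      case True
      hence "max 0 (min 1 (1 - real n * (\<phi> t - a))) = 1" for n
        using mult_nonneg_nonpos[of "real n" "\<phi> t - a"] by simp
      thus ?thesis using True by simp
    next
      case False
      obtain k where k: "real k > 1 / (\<phi> t - a)" using reals_Archimedean2 by blast
      have "max 0 (min 1 (1 - real n * (\<phi> t - a))) = 0" if "n \<ge> k" for n
      proof -
        have "1 / (\<phi> t - a) < real n" using k that by linarith
        hence "1 < real n * (\<phi> t - a)" using False by (simp add: divide_less_eq)
        thus ?thesis by simp
      qed
      hence "\<forall>\<^sub>F n in sequentially. max 0 (min 1 (1 - real n * (\<phi> t - a))) = 0"
        by (auto simp: eventually_sequentially)
      thus ?thesis using False by (simp add: tendsto_eventually)
    qed
  qed auto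
  have gen: "sets borel = sigma_sets UNIV (range (\<lambda>a::real. {..a}))"
    by (subst borel_eq_atMost) simp
  have "Int_stable (range (\<lambda>a::real. {..a}))" "range (\<lambda>a::real. {..a}) \<subseteq> Pow UNIV"
    by (auto simp: Int_stable_def)
  hence "K (\<lambda>t. indicator B (\<phi> t))"
    using B unfolding gen
  proof (induction rule: sigma_sets_induct_disjoint)
    case (basic A)
    thus ?case using Kle by auto
  next
    case empty
    show ?case using Kconst[of 0] by simp
  next
    case (compl A)
    have "K (\<lambda>t. 1 + (-1) * indicator A (\<phi> t))" by (intro Kadd Kmult Kconst compl)
    moreover have "1 + (-1) * indicator A (\<phi> t) = (indicator (UNIV - A) (\<phi> t) :: real)" for t
      by (simp add: indicator_def)
    ultimately show ?case by simp
  next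
    case (union F)
    show ?case
    proof (rule Klim[where c = 1])
      show "K (\<lambda>t. \<Sum>i<n. indicator (F i) (\<phi> t))" for n
        by (induction n) (auto intro: Kconst[of 0] Kadd union)
      \<comment> \<open>Disjointness makes the partial sums indicators themselves, so 1 bounds them
        uniformly, as the closure under limits requires.\<close>
      have eq: "(\<Sum>i<n. indicator (F i) s) = (indicator (\<Union>i<n. F i) s :: real)" for n s
        using union(1) by (intro indicator_UN_disjoint[symmetric]) (auto simp: disjoint_family_on_def)
      show "\<bar>\<Sum>i<n. indicator (F i) (\<phi> t)\<bar> \<le> (1::real)" for n t
        unfolding eq by simp
      show "(\<lambda>n. \<Sum>i<n. indicator (F i) (\<phi> t)) \<longlonglongrightarrow> (indicator (\<Union>i. F i) (\<phi> t) :: real)" for t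
        unfolding eq by (rule LIMSEQ_indicator_UN)
    qed
  qed
  thus ?thesis by (simp add: K_def)
qed

section \<open>Affiliated operators\<close>

context tracial_von_neumann_algebra
begin

definition alg :: "'h bop set" where "alg = {X. bapp X \<in> M}"

definition tr :: "'h bop \<Rightarrow> complex" where "tr X = \<tau> (bapp X)"

lemma M_clinear: "B \<in> M \<Longrightarrow> bounded_clinear B"
  using von_neumann by (simp add: von_neumann_algebra_def)

lemma alg_star: "X \<in> alg \<Longrightarrow> star X \<in> alg"
proof -
  assume "X \<in> alg"
  then obtain B where B: "B \<in> M" "is_adjoint (bapp X) B"
    using von_neumann by (auto simp: alg_def von_neumann_algebra_def)
  have "star X = Bop B"
    using B by (intro star_eqI) (simp add: bapp_Bop M_clinear is_adjoint_def)
  thus ?thesis using B by (simp add: alg_def bapp_Bop M_clinear)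
qed

definition comm :: "'h bop set" where "comm = {C. \<forall>X\<in>alg. C * X = X * C}"

lemma bapp_commute_iff: "bapp C \<circ> bapp X = bapp X \<circ> bapp C \<longleftrightarrow> C * X = X * C"
proof
  assume "bapp C \<circ> bapp X = bapp X \<circ> bapp C"
  thus "C * X = X * C" by (intro bop_eqI) (simp add: bapp_mult fun_eq_iff)
next
  assume *: "C * X = X * C"
  have "(C * X) \<rhd> x = (X * C) \<rhd> x" for x using * by simp
  thus "bapp C \<circ> bapp X = bapp X \<circ> bapp C" by (simp add: bapp_mult fun_eq_iff)
qed

lemma bapp_comm_iff: "bapp C \<in> commutant M \<longleftrightarrow> C \<in> comm"
proof
  assume C: "bapp C \<in> commutant M"
  show "C \<in> comm"
    using C by (auto simp: comm_def alg_def commutant_def bapp_commute_iff)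
next
  assume C: "C \<in> comm"
  show "bapp C \<in> commutant M"
    unfolding commutant_def
  proof (intro CollectI conjI ballI bounded_clinear_bapp)
    fix B assume B: "B \<in> M"
    hence "Bop B \<in> alg" by (simp add: alg_def bapp_Bop M_clinear)
    hence "bapp C \<circ> bapp (Bop B) = bapp (Bop B) \<circ> bapp C"
      using C by (simp add: comm_def bapp_commute_iff)
    thus "bapp C \<circ> B = B \<circ> bapp C" using B by (simp add: bapp_Bop M_clinear)
  qed
qed

text \<open>The bicommutant property, transferred to \<open>bop\<close>. Membership in the algebra
  is established below by commutation with \<open>comm\<close>.\<close>

lemma alg_iff: "X \<in> alg \<longleftrightarrow> (\<forall>C\<in>comm. X * C = C * X)"
proof -
  have "bapp X \<in> M \<longleftrightarrow> bapp X \<in> commutant (commutant M)"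
    using von_neumann by (simp add: von_neumann_algebra_def)
  also have "\<dots> \<longleftrightarrow> (\<forall>C\<in>comm. X * C = C * X)"
  proof
    assume "bapp X \<in> commutant (commutant M)"
    thus "\<forall>C\<in>comm. X * C = C * X"
      using bapp_comm_iff by (auto simp: commutant_def[of "commutant M"] bapp_commute_iff[symmetric])
  next
    assume *: "\<forall>C\<in>comm. X * C = C * X"
    show "bapp X \<in> commutant (commutant M)"
      unfolding commutant_def[of "commutant M"]
    proof (intro CollectI conjI ballI bounded_clinear_bapp)
      fix D assume D: "D \<in> commutant M"
      hence cl: "bounded_clinear D" by (simp add: commutant_def)
      hence "Bop D \<in> comm" using D bapp_comm_iff[of "Bop D"] by (simp add: bapp_Bop)
      hence "bapp X \<circ> bapp (Bop D) = bapp (Bop D) \<circ> bapp X" using * by (simp add: bapp_commute_iff)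
      thus "bapp X \<circ> D = D \<circ> bapp X" using cl by (simp add: bapp_Bop)
    qed
  qed
  finally show ?thesis by (simp add: alg_def)
qed

lemma comm_star: "C \<in> comm \<Longrightarrow> star C \<in> comm"
  unfolding comm_def
proof (intro CollectI ballI)
  fix X assume C: "C \<in> {C. \<forall>X\<in>alg. C * X = X * C}" and X: "X \<in> alg"
  have "C * star X = star X * C" using C alg_star[OF X] by blast
  hence "star (C * star X) = star (star X * C)" by simp
  thus "star C * X = X * star C" by (simp add: star_mult)
qed

lemma alg_strong_limit:
  assumes "\<And>n. Z n \<in> alg" "\<And>x. (\<lambda>n. Z n \<rhd> x) \<longlonglongrightarrow> X \<rhd> x"
  shows "X \<in> alg"
  unfolding alg_iff
proof
  fix C assume C: "C \<in> comm"
  show "X * C = C * X"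
  proof (rule bop_eqI)
    fix x
    have "(\<lambda>n. C \<rhd> Z n \<rhd> x) \<longlonglongrightarrow> C \<rhd> X \<rhd> x" by (intro tendsto_bapp tendsto_const assms)
    moreover have "C \<rhd> Z n \<rhd> x = Z n \<rhd> C \<rhd> x" for n
      using assms(1)[of n] C by (simp add: bapp_mult[symmetric] alg_iff)
    ultimately have "(\<lambda>n. Z n \<rhd> C \<rhd> x) \<longlonglongrightarrow> C \<rhd> X \<rhd> x" by simp
    hence "X \<rhd> C \<rhd> x = C \<rhd> X \<rhd> x" using assms(2)[of "C \<rhd> x"] LIMSEQ_unique by blast
    thus "(X * C) \<rhd> x = (C * X) \<rhd> x" by (simp add: bapp_mult)
  qed
qed

lemma bapp_ops:
  "bapp (X + Y) = (\<lambda>x. X \<rhd> x + Y \<rhd> x)" "bapp (cscale c X) = (\<lambda>x. c *\<^sub>C (X \<rhd> x))"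
  "bapp (X * Y) = bapp X \<circ> bapp Y" "bapp 1 = id" "bapp 0 = (\<lambda>x. 0)" "bapp (X - Y) = (\<lambda>x. X \<rhd> x - Y \<rhd> x)"
  by (auto simp: bapp_simps)

sublocale tracial_algebra alg tr
proof
  show "1 \<in> alg" by (simp add: alg_iff)
  show "X + Y \<in> alg" if "X \<in> alg" "Y \<in> alg" for X Y
    using that by (simp add: alg_iff distrib_left distrib_right)
  show "X * Y \<in> alg" if "X \<in> alg" "Y \<in> alg" for X Y
    using that unfolding alg_iff by (metis mult.assoc)
  show "cscale c X \<in> alg" if "X \<in> alg" for X c
    using that by (simp add: alg_iff cscale_mult_left cscale_mult_right)
  show "star X \<in> alg" if "X \<in> alg" for X using that by (rule alg_star)
  show "X \<in> alg" if "\<And>n. Z n \<in> alg" "Z \<longlonglongrightarrow> X" for Z X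
    by (rule alg_strong_limit[OF that(1) tendsto_bapp[OF that(2) tendsto_const]])
  show "tr (X + Y) = tr X + tr Y" if "X \<in> alg" "Y \<in> alg" for X Y
    using trace_add[of "bapp X" "bapp Y"] that by (simp add: tr_def alg_def bapp_ops)
  show "tr (cscale c X) = c * tr X" if "X \<in> alg" for X c
    using trace_scale[of "bapp X" c] that by (simp add: tr_def alg_def bapp_ops)
  show "tr X \<in> \<real>\<^sub>\<ge>\<^sub>0" if "X \<in> alg" "pos X" for X
    using trace_positive[of "bapp X"] that by (simp add: tr_def alg_def pos_positive_op)
  show "tr 1 = 1" using trace_unit by (simp add: tr_def bapp_ops)
  show "tr (X * Y) = tr (Y * X)" if "X \<in> alg" "Y \<in> alg" for X Y
    using trace_commute[of "bapp X" "bapp Y"] that by (simp add: tr_def alg_def bapp_ops)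
qed

text \<open>An increasing sequence is a directed set, and its strong limit is its supremum, since an
  upper bound of all quadratic forms bounds the limit form. Normality then applies.\<close>

lemma rt_normal:
  fixes P :: "nat \<Rightarrow> 'h bop"
  assumes P: "\<And>n. P n \<in> alg" "\<And>n. pos (P n)" "\<And>m n. m \<le> n \<Longrightarrow> pos (P n - P m)" "\<And>n. pos (S - P n)"
    and lim: "\<And>x. (\<lambda>n. P n \<rhd> x) \<longlonglongrightarrow> S \<rhd> x"
  shows "(\<lambda>n. rt (P n)) \<longlonglongrightarrow> rt S"
proof -
  have S: "S \<in> alg" using alg_strong_limit[OF P(1) lim] .
  have le: "op_le (bapp X) (bapp Y) \<longleftrightarrow> pos (Y - X)" for X Y :: "'h bop"
    by (simp add: pos_positive_op bapp_ops)
  have "Re (\<tau> (bapp S)) = (SUP A\<in>range (\<lambda>n. bapp (P n)). Re (\<tau> A))"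
  proof (rule trace_normal)
    show "range (\<lambda>n. bapp (P n)) \<subseteq> M" using P by (auto simp: alg_def)
    show "\<forall>A\<in>range (\<lambda>n. bapp (P n)). positive_op A" using P by (auto simp: pos_positive_op)
    show "\<forall>A\<in>range (\<lambda>n. bapp (P n)). \<forall>B\<in>range (\<lambda>n. bapp (P n)).
        \<exists>C\<in>range (\<lambda>n. bapp (P n)). op_le A C \<and> op_le B C"
    proof (intro ballI)
      fix A B assume "A \<in> range (\<lambda>n. bapp (P n))" "B \<in> range (\<lambda>n. bapp (P n))"
      then obtain m n where "A = bapp (P m)" "B = bapp (P n)" by blast
      hence "op_le A (bapp (P (max m n))) \<and> op_le B (bapp (P (max m n)))" by (simp add: le P)
      thus "\<exists>C\<in>range (\<lambda>n. bapp (P n)). op_le A C \<and> op_le B C" by blast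
    qed
    show "bapp S \<in> M" using S by (simp add: alg_def)
    show "\<forall>A\<in>range (\<lambda>n. bapp (P n)). op_le A (bapp S)" using P by (auto simp: le)
    show "\<forall>R\<in>M. (\<forall>A\<in>range (\<lambda>n. bapp (P n)). op_le A R) \<longrightarrow> op_le (bapp S) R"
    proof (intro ballI impI)
      fix R assume R: "R \<in> M" "\<forall>A\<in>range (\<lambda>n. bapp (P n)). op_le A R"
      have Req: "R = bapp (Bop R)" using R by (simp add: bapp_Bop M_clinear)
      have p: "pos (Bop R - P n)" for n using R(2) by (subst (asm) Req) (auto simp: le)
      have "cinner ((Bop R - S) \<rhd> x) x \<in> \<real>\<^sub>\<ge>\<^sub>0" for x
      proof (rule closed_sequentially[OF closed_nonneg_Reals_complex, of "\<lambda>n. cinner ((Bop R - P n) \<rhd> x) x"])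
        show "cinner ((Bop R - P n) \<rhd> x) x \<in> \<real>\<^sub>\<ge>\<^sub>0" for n using p[of n] by (simp add: pos_def)
        show "(\<lambda>n. cinner ((Bop R - P n) \<rhd> x) x) \<longlonglongrightarrow> cinner ((Bop R - S) \<rhd> x) x"
          unfolding bapp_diff_left by (intro tendsto_cinner tendsto_intros lim)
      qed
      hence "pos (Bop R - S)" by (simp add: pos_def)
      thus "op_le (bapp S) R" by (subst Req) (simp add: le)
    qed
  qed auto
  hence "rt S = (SUP n. rt (P n))" by (simp add: rt_def tr_def image_image)
  moreover have "incseq (\<lambda>n. rt (P n))"
  proof (rule incseq_SucI)
    fix n
    have "0 \<le> rt (P (Suc n) - P n)" using P by (intro rt_pos) auto
    thus "rt (P n) \<le> rt (P (Suc n))" using P by (simp add: rt_diff)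
  qed
  moreover have "rt (P n) \<le> rt S" for n
    using rt_pos[OF _ P(4), of n] S P(1)[of n] by (simp add: rt_diff)
  hence "bdd_above (range (\<lambda>n. rt (P n)))" by (rule bdd_aboveI2)
  ultimately show ?thesis
    using LIMSEQ_incseq_SUP[of "\<lambda>n. rt (P n)"] by simp
qed

end

text \<open>The modulus and its spectral measure are parameters because the definitions provide them
  only through existential witnesses. The same locale is used for T and for its shifts.\<close>

locale affiliated_modulus = tracial_von_neumann_algebra M \<tau>
  for M :: "('h::complex_hilbert \<Rightarrow> 'h) set" and \<tau> +
  fixes T A :: "'h operator" and E
  assumes aff: "T \<in> affiliated M" and modulus: "is_modulus T A" and spec: "is_spectral_measure A E"
begin

sublocale spectral_op E A
  using modulus spec by unfold_locales (auto simp: is_modulus_def is_spectral_measure_def)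

lemma linT: "linear_operator T" and closedT: "closed T" and denseT: "closure (Domain T) = UNIV"
  using aff by (auto simp: affiliated_def closed_densely_defined_def)

lemma square_eq: "A O A = T O adj T" using modulus by (simp add: is_modulus_def)

lemma T_comm: "C \<in> comm \<Longrightarrow> (x, y) \<in> T \<Longrightarrow> (C \<rhd> x, C \<rhd> y) \<in> T"
  using aff bapp_comm_iff by (fastforce simp: affiliated_def)

lemma adj_T_comm: "C \<in> comm \<Longrightarrow> (w, z) \<in> adj T \<Longrightarrow> (C \<rhd> w, C \<rhd> z) \<in> adj T"
proof -
  assume C: "C \<in> comm" and wz: "(w, z) \<in> adj T"
  have "cinner y (C \<rhd> w) = cinner x (C \<rhd> z)" if "(x, y) \<in> T" for x y
    using adjD[OF wz T_comm[OF comm_star[OF C] that]] by (simp add: cinner_star)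
  thus ?thesis by (auto simp: adj_def)
qed

text \<open>For C in the commutant, C b x and b C x solve the same resolvent equation, because C
  preserves the graphs of T and of its adjoint; the solution is unique.\<close>

lemma FC_res_alg:
  assumes \<epsilon>: "0 < \<epsilon>"
  shows "FC (res \<epsilon>) \<in> alg"
  unfolding alg_iff
proof
  fix C assume C: "C \<in> comm"
  show "FC (res \<epsilon>) * C = C * FC (res \<epsilon>)"
  proof (rule bop_eqI)
    fix x
    let ?b = "FC (res \<epsilon>)"
    have "(?b \<rhd> x, x - \<epsilon> *\<^sub>R (?b \<rhd> x)) \<in> T O adj T" using A_res[OF \<epsilon>, of x] by (simp add: square_eq)
    hence "(C \<rhd> ?b \<rhd> x, C \<rhd> (x - \<epsilon> *\<^sub>R (?b \<rhd> x))) \<in> T O adj T"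
      using T_comm[OF C] adj_T_comm[OF C] by blast
    hence "(C \<rhd> ?b \<rhd> x, C \<rhd> x - \<epsilon> *\<^sub>R (C \<rhd> ?b \<rhd> x)) \<in> T O adj T" by (simp add: bapp_simps)
    moreover have "(?b \<rhd> C \<rhd> x, C \<rhd> x - \<epsilon> *\<^sub>R (?b \<rhd> C \<rhd> x)) \<in> T O adj T"
      using A_res[OF \<epsilon>] by (simp add: square_eq)
    ultimately have "?b \<rhd> C \<rhd> x = C \<rhd> ?b \<rhd> x"
      by (intro modulus_square_unique[OF linT \<epsilon>])
    thus "(?b * C) \<rhd> x = (C * ?b) \<rhd> x" by (simp add: bapp_mult)
  qed
qed

lemma res_one_range: "res 1 t \<in> {0..1}"
  using res_bounds[of 1 t] by auto

text \<open>The function \<open>res 1\<close> is injective on \<open>[0,\<infinity>)\<close>, with inverse \<open>y \<mapsto> sqrt (1 / y - 1)\<close>.\<close>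

lemma EB_res:
  assumes "B \<in> sets borel"
  defines "B' \<equiv> {y. 0 < y \<and> sqrt (1 / y - 1) \<in> B}"
  shows "B' \<in> sets borel" "(\<lambda>t. indicator B' (res 1 t) :: real) = indicator (res 1 -` B')"
    "res 1 -` B' \<in> sets borel" "EB B = EB (res 1 -` B')"
proof -
  have "(\<lambda>y::real. sqrt (1 / y - 1)) -` B \<inter> space borel \<in> sets borel"
    using assms(1) by (intro measurable_sets[of _ borel borel]) auto
  moreover have "B' = (\<lambda>y. sqrt (1 / y - 1)) -` B \<inter> {0<..}" by (auto simp: B'_def)
  ultimately show B': "B' \<in> sets borel" by simp
  show "(\<lambda>t. indicator B' (res 1 t) :: real) = indicator (res 1 -` B')" by (auto simp: indicator_def)
  show m: "res 1 -` B' \<in> sets borel"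
    using measurable_sets_borel[OF bounded_borel_measurable[OF bounded_borel_res] B'] by simp
  show "EB B = EB (res 1 -` B')"
  proof (rule EB_cong_nonneg[OF assms(1) m])
    fix t :: real assume t: "0 \<le> t"
    have "1 / res 1 t - 1 = t\<^sup>2" by (simp add: res_def)
    hence "sqrt (1 / res 1 t - 1) = t" using t by simp
    thus "t \<in> B \<longleftrightarrow> t \<in> res 1 -` B'" using res_bounds(1)[of 1 t] by (simp add: B'_def)
  qed
qed

text \<open>The property of lying in the algebra passes from \<open>res 1\<close> to the indicators
  of its preimages. These give all spectral projections, since E vanishes on the negative
  axis.\<close>

lemma EB_alg:
  assumes B: "B \<in> sets borel"
  shows "EB B \<in> alg"
proof -
  let ?B = "{y. 0 < y \<and> sqrt (1 / y - 1) \<in> B}"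
  have "FC (\<lambda>t. indicator ?B (res 1 t)) \<in> alg"
  proof (rule bounded_borel_class_induct[where Q = "\<lambda>f. FC f \<in> alg", OF bounded_borel_measurable[OF bounded_borel_res] res_one_range])
    show "FC (\<lambda>_. c) \<in> alg" for c by (simp add: FC_const scaleR_mem)
    show "FC (res 1) \<in> alg" by (rule FC_res_alg) simp
    show "FC g \<in> alg" if "\<And>n. bounded_borel (f n)" "\<And>n. FC (f n) \<in> alg" "\<And>n t. \<bar>f n t\<bar> \<le> c"
      "bounded_borel g" "\<And>t. (\<lambda>n. f n t) \<longlonglongrightarrow> g t" for f g c
      by (rule alg_strong_limit[OF that(2) FC_strong_limit[OF that(1,3,4,5)]])
  qed (use EB_res(1)[OF B] in \<open>auto simp: FC_add FC_mult\<close>)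
  thus ?thesis using EB_res[OF B] by (simp add: FC_indicator)
qed

lemma FC_alg: "bounded_borel f \<Longrightarrow> FC f \<in> alg"
proof -
  assume f: "bounded_borel f"
  have "simple_approx f n -` {y} \<in> sets borel" for n y
    using measurable_sets_borel[OF bounded_borel_measurable[OF bounded_borel_simple_approx[OF f]], of "{y}"] by simp
  hence "simple_fc f n \<in> alg" for n
    unfolding simple_fc_def by (intro sum_mem scaleR_mem EB_alg)
  thus ?thesis using limit_mem simple_fc_tendsto[OF f] by blast
qed

definition \<nu> :: "real measure" where
  "\<nu> = measure_of UNIV (sets borel) (\<lambda>B. ennreal (Re (\<tau> (E B))))"

lemma sets_\<nu> [simp, measurable_cong]: "sets \<nu> = sets borel"
  by (simp add: \<nu>_def sets.sigma_sets_eq[of borel, simplified])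

lemma space_\<nu> [simp]: "space \<nu> = UNIV"
  by (simp add: \<nu>_def)

lemma pos_EB: "B \<in> sets borel \<Longrightarrow> pos (EB B)"
  by (simp add: pos_def EB_quadratic)

text \<open>Countable additivity of the distribution is where normality of the trace enters: the
  projections of the partial unions increase strongly to that of the union.\<close>

lemma rt_EB_sums:
  assumes F: "range F \<subseteq> sets borel" "disjoint_family F"
  shows "(\<lambda>n. rt (EB (F n))) sums rt (EB (\<Union>n. F n))"
proof -
  have Fn: "F n \<in> sets borel" for n using F by auto
  define P where "P n = (\<Sum>i<n. EB (F i))" for n
  have P: "P n = EB (\<Union>i<n. F i)" for n
  proof (induction n)
    case (Suc n)
    have "F i \<inter> F n = {}" if "i < n" for i
      using F(2) that by (intro disjoint_family_onD[of F UNIV]) auto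
    hence "(\<Union>i<n. F i) \<inter> F n = {}" by blast
    hence "EB (\<Union>i<Suc n. F i) = EB (\<Union>i<n. F i) + EB (F n)"
      using EB_Un[of "\<Union>i<n. F i" "F n"] Fn by (simp add: lessThan_Suc Un_commute)
    thus ?case using Suc by (simp add: P_def)
  qed (simp add: P_def EB_empty)
  have diff: "pos (EB C - EB D)" if "C \<in> sets borel" "D \<in> sets borel" "D \<subseteq> C" for C D
  proof -
    have "EB C = EB D + EB (C - D)" using EB_Un[of D "C - D"] that by (simp add: Un_absorb1)
    thus ?thesis using pos_EB[of "C - D"] that by simp
  qed
  have "(\<lambda>n. rt (P n)) \<longlonglongrightarrow> rt (EB (\<Union>n. F n))"
  proof (rule rt_normal)
    show "P n \<in> alg" "pos (P n)" for n using Fn by (auto simp: P intro!: EB_alg pos_EB)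
    show "pos (P n - P m)" if "m \<le> n" for m n
      unfolding P using Fn that by (intro diff UN_mono) auto
    show "pos (EB (\<Union>n. F n) - P n)" for n
      unfolding P using Fn by (intro diff) auto
    show "(\<lambda>n. P n \<rhd> x) \<longlonglongrightarrow> EB (\<Union>n. F n) \<rhd> x" for x
    proof -
      have "P n \<rhd> x = (\<Sum>i<n. EB (F i) \<rhd> x)" for n
        by (induction n) (simp_all add: P_def bapp_simps)
      thus ?thesis using EB_sums[OF F, of x] by (simp add: sums_def)
    qed
  qed
  thus ?thesis using Fn by (simp add: sums_def P_def rt_sum EB_alg)
qed

lemma emeasure_\<nu>:
  assumes B: "B \<in> sets borel"
  shows "emeasure \<nu> B = ennreal (rt (EB B))"
proof -
  have eq: "Re (\<tau> (E C)) = rt (EB C)" if "C \<in> sets borel" for C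
  proof -
    have "bapp (EB C) = E C" by (rule ext) (simp add: bapp_EB that)
    thus ?thesis by (simp add: rt_def tr_def)
  qed
  have "emeasure \<nu> B = ennreal (Re (\<tau> (E B)))"
    unfolding \<nu>_def
  proof (rule emeasure_measure_of_sigma)
    show "sigma_algebra UNIV (sets borel)" by (metis sets.sigma_algebra_axioms space_borel)
    show "positive (sets borel) (\<lambda>B. ennreal (Re (\<tau> (E B))))"
      by (simp add: positive_def eq EB_empty)
    show "countably_additive (sets borel) (\<lambda>B. ennreal (Re (\<tau> (E B))))"
    proof (rule countably_additiveI)
      fix F :: "nat \<Rightarrow> real set"
      assume F: "range F \<subseteq> sets borel" "disjoint_family F" "(\<Union>i. F i) \<in> sets borel"
      have Fn: "F n \<in> sets borel" for n using F by auto
      have "(\<Sum>n. ennreal (rt (EB (F n)))) = ennreal (rt (EB (\<Union>n. F n)))"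
        using rt_EB_sums[OF F(1,2)] Fn by (intro suminf_ennreal_eq rt_pos EB_alg pos_EB)
      thus "(\<Sum>n. ennreal (Re (\<tau> (E (F n))))) = ennreal (Re (\<tau> (E (\<Union>n. F n))))"
        using F(3) by (simp add: eq Fn)
    qed
  qed (use B in auto)
  thus ?thesis using B by (simp add: eq)
qed

lemma prob_space_\<nu>: "prob_space \<nu>"
  by (rule prob_spaceI) (simp add: emeasure_\<nu> EB_UNIV)

lemma measure_\<nu>: "B \<in> sets borel \<Longrightarrow> measure \<nu> B = rt (EB B)"
  by (simp add: measure_def emeasure_\<nu> rt_pos EB_alg pos_EB)

lemma \<nu>_negative: "emeasure \<nu> {..<0} = 0"
  by (simp add: emeasure_\<nu> EB_negative)

lemma measurable_\<nu>: "borel_measurable \<nu> = borel_measurable borel"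
  by (rule measurable_cong_sets) auto

lemma integrable_\<nu>: "bounded_borel f \<Longrightarrow> integrable \<nu> f"
proof -
  assume f: "bounded_borel f"
  then obtain c where "\<And>t. \<bar>f t\<bar> \<le> c" by (auto simp: bounded_borel_def)
  interpret prob_space \<nu> by (rule prob_space_\<nu>)
  show ?thesis
    using f \<open>\<And>t. \<bar>f t\<bar> \<le> c\<close> by (intro integrable_const_bound[where B = c]) (auto simp: bounded_borel_def measurable_\<nu>)
qed

lemma rt_FC:
  assumes f: "bounded_borel f"
  shows "rt (FC f) = (\<integral>t. f t \<partial>\<nu>)"
proof (rule LIMSEQ_unique)
  interpret prob_space \<nu> by (rule prob_space_\<nu>)
  have bb: "bounded_borel (simple_approx f n)" for n by (rule bounded_borel_simple_approx[OF f])
  have sets: "simple_approx f n -` {y} \<in> sets borel" for n y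
    using measurable_sets_borel[OF bounded_borel_measurable[OF bb], of "{y}"] by simp
  have "simple_fc f n \<in> alg" for n
    unfolding simple_fc_def using sets by (intro sum_mem scaleR_mem EB_alg)
  thus "(\<lambda>n. rt (simple_fc f n)) \<longlonglongrightarrow> rt (FC f)"
    by (rule rt_tendsto[OF _ simple_fc_tendsto[OF f]])
  have "rt (simple_fc f n) = (\<integral>t. simple_approx f n t \<partial>\<nu>)" for n
  proof -
    have "(\<integral>t. simple_approx f n t \<partial>\<nu>) =
        (\<integral>t. (\<Sum>y\<in>range (simple_approx f n). y * indicator (simple_approx f n -` {y}) t) \<partial>\<nu>)"
      by (rule Bochner_Integration.integral_cong[OF refl]) (rule finite_range_indicator_sum[OF finite_range_simple_approx[OF f]])
    also have "\<dots> = (\<Sum>y\<in>range (simple_approx f n). y * rt (EB (simple_approx f n -` {y})))"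
      using sets by (subst Bochner_Integration.integral_sum)
        (auto simp: measure_\<nu> intro!: integrable_\<nu> bounded_borel_scale bounded_borel_indicator)
    also have "\<dots> = rt (simple_fc f n)"
      unfolding simple_fc_def using sets by (simp add: rt_sum rt_scaleR EB_alg scaleR_mem)
    finally show ?thesis by simp
  qed
  moreover have "(\<lambda>n. \<integral>t. simple_approx f n t \<partial>\<nu>) \<longlonglongrightarrow> (\<integral>t. f t \<partial>\<nu>)"
  proof -
    have "norm ((\<integral>t. simple_approx f n t \<partial>\<nu>) - (\<integral>t. f t \<partial>\<nu>)) \<le> 1 / real (Suc n)" for n
    proof -
      have "(\<integral>t. simple_approx f n t \<partial>\<nu>) - (\<integral>t. f t \<partial>\<nu>) = (\<integral>t. simple_approx f n t - f t \<partial>\<nu>)"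
        using integrable_\<nu> bb f by simp
      also have "norm \<dots> \<le> (\<integral>t. norm (simple_approx f n t - f t) \<partial>\<nu>)" by (rule integral_norm_bound)
      also have "\<dots> \<le> (\<integral>t. 1 / real (Suc n) \<partial>\<nu>)"
        using integrable_\<nu>[OF bounded_borel_diff[OF bb f]] simple_approx_close[of f n]
        by (intro integral_mono integrable_norm) auto
      finally show ?thesis using prob_space by simp
    qed
    hence "(\<lambda>n. (\<integral>t. simple_approx f n t \<partial>\<nu>) - (\<integral>t. f t \<partial>\<nu>)) \<longlonglongrightarrow> 0"
      by (intro Lim_null_comparison[OF always_eventually[OF allI] LIMSEQ_inverse_Suc])
    thus ?thesis by (rule LIM_zero_cancel)
  qed
  ultimately show "(\<lambda>n. rt (simple_fc f n)) \<longlonglongrightarrow> (\<integral>t. f t \<partial>\<nu>)" by simp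
qed

end

section \<open>Uniqueness of the spectral data and the operators T g(|T|)\<close>

context affiliated_modulus
begin

text \<open>Both calculi give the same resolvent at \<open>res 1\<close>, as it depends on T only,
  and agreement spreads from there to all spectral projections.\<close>

lemma spectral_unique:
  assumes O: "affiliated_modulus M \<tau> T A' E'"
    and B: "B \<in> sets borel"
  shows "spectral_pvm.EB E' B = EB B"
proof -
  interpret O: affiliated_modulus M \<tau> T A' E' by fact
  let ?B = "{y. 0 < y \<and> sqrt (1 / y - 1) \<in> B}"
  have "FC (\<lambda>t. indicator ?B (res 1 t)) = O.FC (\<lambda>t. indicator ?B (res 1 t))"
  proof (rule bounded_borel_class_induct[where Q = "\<lambda>f. FC f = O.FC f", OF bounded_borel_measurable[OF bounded_borel_res] res_one_range])
    show "FC (\<lambda>_. c) = O.FC (\<lambda>_. c)" for c by (simp add: FC_const O.FC_const)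
    show "FC (res 1) = O.FC (res 1)"
    proof (rule bop_eqI)
      fix x
      show "FC (res 1) \<rhd> x = O.FC (res 1) \<rhd> x"
        using A_res[of 1 x] O.A_res[of 1 x]
        by (intro modulus_square_unique[OF linT, of 1 _ x]) (simp_all add: square_eq O.square_eq)
    qed
    show "FC g = O.FC g" if "\<And>n. bounded_borel (f n)" "\<And>n. FC (f n) = O.FC (f n)" "\<And>n t. \<bar>f n t\<bar> \<le> c"
      "bounded_borel g" "\<And>t. (\<lambda>n. f n t) \<longlonglongrightarrow> g t" for f g c
    proof (rule bop_eqI)
      fix x
      show "FC g \<rhd> x = O.FC g \<rhd> x"
        using FC_strong_limit[OF that(1,3,4,5), of x] O.FC_strong_limit[OF that(1,3,4,5), of x] that(2)
        by (simp add: LIMSEQ_unique)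
    qed
  qed (use EB_res(1)[OF B] in \<open>auto simp: FC_add FC_mult O.FC_add O.FC_mult\<close>)
  thus ?thesis using EB_res[OF B] O.EB_res[OF B] by (simp add: FC_indicator O.FC_indicator)
qed

text \<open>This makes the definite description in \<open>modulus_distribution\<close> meaningful:
  any two choices of modulus and spectral measure yield the same measure.\<close>

lemma modulus_distribution_eq: "modulus_distribution \<tau> T = \<nu>"
  unfolding modulus_distribution_def
proof (rule the_equality)
  show "is_modulus_distribution \<tau> T \<nu>"
    unfolding is_modulus_distribution_def \<nu>_def using modulus spec by blast
  fix \<nu>' assume "is_modulus_distribution \<tau> T \<nu>'"
  then obtain A' E' where *: "is_modulus T A'" "is_spectral_measure A' E'"
    "\<nu>' = measure_of UNIV (sets borel) (\<lambda>B. ennreal (Re (\<tau> (E' B))))"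
    by (auto simp: is_modulus_distribution_def)
  interpret O: affiliated_modulus M \<tau> T A' E' by unfold_locales (use aff * in auto)
  show "\<nu>' = \<nu>"
  proof (rule measure_eqI)
    have eq: "\<nu>' = O.\<nu>" by (simp add: * O.\<nu>_def)
    show "sets \<nu>' = sets \<nu>" by (simp add: eq)
    show "emeasure \<nu>' B = emeasure \<nu> B" if "B \<in> sets \<nu>'" for B
      using that spectral_unique[OF O.affiliated_modulus_axioms, of B]
      by (simp add: eq O.emeasure_\<nu> emeasure_\<nu>)
  qed
qed

text \<open>With t^2 h bounded the vector lies in the domain of A^2 = T*T, hence of T, and |T h(A)
  x|^2 is the inner product of h(A) x with A^2 h(A) x.\<close>

lemma T_FC_square:
  assumes "bounded_borel h" "bounded_borel (\<lambda>t. t * h t)" "bounded_borel (\<lambda>t. t * (t * h t))"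
  shows "\<exists>w. (FC h \<rhd> x, w) \<in> T \<and> norm w = norm (FC (\<lambda>t. t * h t) \<rhd> x)"
proof -
  let ?h1 = "\<lambda>t. t * h t" and ?h2 = "\<lambda>t. t * (t * h t)"
  have "(FC h \<rhd> x, FC ?h2 \<rhd> x) \<in> A O A"
    using A_FC[OF assms(1,2), of x] A_FC[OF assms(2,3), of x] by blast
  then obtain w where w: "(FC h \<rhd> x, w) \<in> T" "(w, FC ?h2 \<rhd> x) \<in> adj T"
    by (auto simp: square_eq)
  have "cinner w w = cinner (FC h \<rhd> x) (FC ?h2 \<rhd> x)" by (rule adjD[OF w(2,1)])
  also have "\<dots> = cinner ((FC ?h2 * FC h) \<rhd> x) x"
    using cinner_star[of "FC ?h2" "FC h \<rhd> x" x] assms by (simp add: star_FC bapp_mult)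
  also have "FC ?h2 * FC h = FC ?h1 * FC ?h1"
    using FC_mult[OF assms(3,1)] FC_mult[OF assms(2,2)] by (simp add: mult_ac)
  also have "cinner (\<dots> \<rhd> x) x = cinner (FC ?h1 \<rhd> x) (FC ?h1 \<rhd> x)"
    using assms by (simp add: bapp_mult cinner_star star_FC)
  finally have "(norm w)\<^sup>2 = (norm (FC ?h1 \<rhd> x))\<^sup>2"
    unfolding cinner_self of_real_eq_iff .
  thus ?thesis using w(1) by (auto simp: power2_eq_iff_nonneg)
qed

text \<open>Only t g is bounded here, so T*T is out of reach at first. Truncations of g are
  admissible for \<open>T_FC_square\<close>, and closedness of T passes to the limit.\<close>

lemma T_FC:
  assumes g: "bounded_borel g" and tg: "bounded_borel (\<lambda>t. t * g t)"
  shows "\<exists>w. (FC g \<rhd> x, w) \<in> T \<and> norm w = norm (FC (\<lambda>t. t * g t) \<rhd> x)"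
proof -
  let ?g = "\<lambda>n t. g t * trunc n t"
  have b0: "bounded_borel (?g n)" for n by (intro bounded_borel_mult g bounded_borel_trunc)
  have b1: "bounded_borel (\<lambda>t. t * ?g n t)" for n
    using bounded_borel_mult[OF tg bounded_borel_trunc[of n]] by (simp add: mult.assoc)
  have b2: "bounded_borel (\<lambda>t. t * (t * ?g n t))" for n
    using bounded_borel_mult[OF tg bounded_borel_id_trunc[of n]] by (simp add: mult_ac)
  have "\<exists>w. \<forall>n. (FC (?g n) \<rhd> x, w n) \<in> T \<and> norm (w n) = norm (FC (\<lambda>t. t * ?g n t) \<rhd> x)"
    using T_FC_square[OF b0 b1 b2] by (intro choice) blast
  then obtain w where w: "\<And>n. (FC (?g n) \<rhd> x, w n) \<in> T" "\<And>n. norm (w n) = norm (FC (\<lambda>t. t * ?g n t) \<rhd> x)"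
    by blast
  \<comment> \<open>The norm identity for the difference of two truncations transfers the Cauchy
    property from the |T| side to the images under T.\<close>
  have wdiff: "norm (w m - w n) = norm (FC (\<lambda>t. t * ?g m t) \<rhd> x - FC (\<lambda>t. t * ?g n t) \<rhd> x)" for m n
  proof -
    let ?h = "\<lambda>t. ?g m t - ?g n t"
    have h: "bounded_borel ?h" "bounded_borel (\<lambda>t. t * ?h t)" "bounded_borel (\<lambda>t. t * (t * ?h t))"
      using bounded_borel_diff[OF b0[of m] b0[of n]] bounded_borel_diff[OF b1[of m] b1[of n]]
        bounded_borel_diff[OF b2[of m] b2[of n]] by (simp_all add: right_diff_distrib)
    obtain v where v: "(FC ?h \<rhd> x, v) \<in> T" "norm v = norm (FC (\<lambda>t. t * ?h t) \<rhd> x)"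
      using T_FC_square[OF h] by blast
    have "(FC ?h \<rhd> x, w m - w n) \<in> T"
      using linear_operator_diff[OF linT w(1)[of m] w(1)[of n]] b0 by (simp add: FC_diff bapp_diff_left)
    hence "w m - w n = v" using linear_operator_unique[OF linT _ v(1)] by blast
    thus ?thesis using v(2) FC_diff[OF b1[of m] b1[of n]] by (simp add: right_diff_distrib bapp_diff_left)
  qed
  have lim1: "(\<lambda>n. FC (\<lambda>t. t * ?g n t) \<rhd> x) \<longlonglongrightarrow> FC (\<lambda>t. t * g t) \<rhd> x"
    using FC_trunc_limit[OF tg, of x] by (simp add: mult.assoc)
  hence "Cauchy (\<lambda>n. FC (\<lambda>t. t * ?g n t) \<rhd> x)" by (rule LIMSEQ_imp_Cauchy)
  hence "Cauchy w" unfolding Cauchy_def dist_norm wdiff .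
  hence "convergent w" by (rule Cauchy_convergent)
  then obtain v where v: "w \<longlonglongrightarrow> v" unfolding convergent_def by blast
  have "(\<lambda>n. (FC (?g n) \<rhd> x, w n)) \<longlonglongrightarrow> (FC g \<rhd> x, v)"
    by (rule tendsto_Pair[OF FC_trunc_limit[OF g] v])
  hence "(FC g \<rhd> x, v) \<in> T" using closed_sequentially[OF closedT, of "\<lambda>n. (FC (?g n) \<rhd> x, w n)"] w(1) by blast
  moreover have "norm v = norm (FC (\<lambda>t. t * g t) \<rhd> x)"
    using LIMSEQ_unique[OF tendsto_norm[OF v]] tendsto_norm[OF lim1] w(2) by simp
  ultimately show ?thesis by blast
qed

text \<open>T is single-valued, so the images chosen for each x are forced; linearity and
  commutation with the commutant are therefore inherited from the graph.\<close>

lemma T_FC_bounded: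
  assumes g: "bounded_borel g" and tg: "bounded_borel (\<lambda>t. t * g t)" "\<And>t. \<bar>t * g t\<bar> \<le> c"
  shows "\<exists>u\<in>alg. norm u \<le> c \<and> (\<forall>x. (FC g \<rhd> x, u \<rhd> x) \<in> T)"
proof -
  have c0: "0 \<le> c" using tg(2)[of 0] by simp
  obtain f where f: "\<And>x. (FC g \<rhd> x, f x) \<in> T" "\<And>x. norm (f x) = norm (FC (\<lambda>t. t * g t) \<rhd> x)"
    using T_FC[OF g tg(1)] by metis
  have uniq: "y = f x" if "(FC g \<rhd> x, y) \<in> T" for x y
    using linear_operator_unique[OF linT that f(1)] .
  have add: "f (x + y) = f x + f y" for x y
    using uniq[of "x + y" "f x + f y"] linear_operator_add[OF linT f(1)[of x] f(1)[of y]]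
    by (simp add: bapp_simps)
  have scale: "f (a *\<^sub>C x) = a *\<^sub>C f x" for a x
    using uniq[of "a *\<^sub>C x" "a *\<^sub>C f x"] linear_operator_scaleC[OF linT f(1)[of x], of a]
    by (simp add: bapp_simps)
  have nf: "norm (f x) \<le> c * norm x" for x
  proof -
    have "norm (f x) \<le> norm (FC (\<lambda>t. t * g t)) * norm x" unfolding f(2) by (rule norm_bapp)
    also have "\<dots> \<le> c * norm x" by (intro mult_right_mono FC_norm tg) auto
    finally show ?thesis .
  qed
  have "bounded_clinear f"
    unfolding bounded_clinear_def
    by (auto intro!: bounded_linear_intro[where K = c] simp: add scale scaleR_eq_scaleC nf mult.commute)
  hence uf: "Bop f \<rhd> x = f x" for x by (simp add: bapp_Bop)
  have "Bop f \<in> alg"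
    unfolding alg_iff
  proof
    fix C assume C: "C \<in> comm"
    show "Bop f * C = C * Bop f"
    proof (rule bop_eqI)
      fix x
      have "(C \<rhd> FC g \<rhd> x, C \<rhd> f x) \<in> T" by (rule T_comm[OF C f(1)])
      moreover have "C \<rhd> FC g \<rhd> x = FC g \<rhd> C \<rhd> x"
        using FC_alg[OF g] C by (simp add: bapp_mult[symmetric] alg_iff)
      ultimately have "C \<rhd> f x = f (C \<rhd> x)" using uniq by simp
      thus "(Bop f * C) \<rhd> x = (C * Bop f) \<rhd> x" by (simp add: bapp_mult uf)
    qed
  qed
  moreover have "norm (Bop f) \<le> c" by (rule norm_bop_le[OF c0]) (simp add: uf nf)
  ultimately show ?thesis using f(1) uf by (intro bexI[of _ "Bop f"]) auto
qed

lemma FC_lower: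
  assumes f: "bounded_borel f" "\<And>t. \<delta> \<le> f t"
  shows "pos (FC f - \<delta> *\<^sub>R 1)"
proof -
  have "pos (FC (\<lambda>t. f t - \<delta>))" using f by (intro FC_pos bounded_borel_diff bounded_borel_const) auto
  thus ?thesis using f by (simp add: FC_diff FC_const bounded_borel_const)
qed

text \<open>Expanded about the upper bound c of f, both sides are the series in g = 1 - f/c. Since 0
  \<le> g \<le> \<open>q\<close> < 1, integration termwise is justified.\<close>

lemma ld_FC:
  assumes f: "bounded_borel f" and \<delta>: "0 < \<delta>" "\<And>t. \<delta> \<le> f t"
  shows "pd (FC f)" "ld (FC f) = (\<integral>t. ln (f t) \<partial>\<nu>)" "bounded_borel (\<lambda>t. ln (f t))"
proof -
  interpret P: prob_space \<nu> by (rule prob_space_\<nu>)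
  have prob: "measure \<nu> UNIV = 1" using P.prob_space by simp
  show pd: "pd (FC f)" by (rule pdI[OF FC_alg[OF f] \<delta>(1) FC_lower[OF f \<delta>(2)]])
  obtain c where c: "\<And>t. \<bar>f t\<bar> \<le> c" using f by (auto simp: bounded_borel_def)
  have fc: "f t \<le> c" for t using c[of t] by linarith
  have c0: "0 < c" "\<delta> \<le> c" using \<delta>(1) \<delta>(2)[of 0] fc[of 0] by linarith+
  have f0: "0 < f t" for t using \<delta>(1) \<delta>(2)[of t] by linarith
  show bln: "bounded_borel (\<lambda>t. ln (f t))"
  proof (rule bounded_borelI)
    show "\<bar>ln (f t)\<bar> \<le> \<bar>ln \<delta>\<bar> + \<bar>ln c\<bar>" for t
      using ln_le_cancel_iff[OF \<delta>(1) f0[of t]] ln_le_cancel_iff[OF f0[of t] c0(1)] fc[of t] \<delta>(2)[of t] by auto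
  qed (use bounded_borel_measurable[OF f] in measurable)
  define g where "g t = 1 - (1 / c) * f t" for t
  define q where "q = 1 - \<delta> / c"
  have q: "0 \<le> q" "q < 1" using c0 \<delta>(1) by (simp_all add: q_def)
  have g: "0 \<le> g t" "g t \<le> q" for t
    using fc[of t] \<delta>(2)[of t] c0 by (simp_all add: g_def q_def divide_simps)
  have bg: "bounded_borel g"
    unfolding g_def by (intro bounded_borel_diff bounded_borel_const bounded_borel_scale f)
  have "1 - (1 / c) *\<^sub>R FC f = FC g"
    unfolding g_def FC_diff[OF bounded_borel_const bounded_borel_scale[OF f]] FC_scale[OF f] FC_one ..
  moreover have "rt (FC g ^ Suc n) = (\<integral>t. g t ^ Suc n \<partial>\<nu>)" for n
    unfolding FC_power[OF bg, symmetric] by (rule rt_FC[OF bounded_borel_power[OF bg]])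
  ultimately have L: "lser (1 - (1 / c) *\<^sub>R FC f) = (\<Sum>n. \<integral>t. g t ^ Suc n / real (Suc n) \<partial>\<nu>)"
    by (simp add: lser_def del: power_Suc of_nat_Suc)
  have gbound: "g t ^ Suc n / real (Suc n) \<le> q ^ n" "0 \<le> g t ^ Suc n / real (Suc n)" for n t
  proof -
    have "g t ^ Suc n / real (Suc n) \<le> g t ^ Suc n / 1" using g[of t] by (intro divide_left_mono) auto
    also have "\<dots> \<le> q ^ Suc n" using g[of t] by (simp del: power_Suc add: power_mono)
    also have "\<dots> \<le> q ^ n" using q by (auto intro: mult_left_le_one_le)
    finally show "g t ^ Suc n / real (Suc n) \<le> q ^ n" .
  qed (use g in simp)
  have gnorm: "norm (g t ^ Suc n / real (Suc n)) \<le> q ^ n" for n t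
    unfolding real_norm_def abs_of_nonneg[OF gbound(2)] by (rule gbound(1))
  have bgn: "bounded_borel (\<lambda>t. g t ^ Suc n / real (Suc n))" for n
    using bounded_borel_scale[OF bounded_borel_power[OF bg, of "Suc n"], of "1 / real (Suc n)"]
    by (simp del: power_Suc of_nat_Suc)
  have sq: "summable (\<lambda>n. q ^ n)" using q by (auto intro: summable_geometric)
  have "(\<lambda>n. \<integral>t. g t ^ Suc n / real (Suc n) \<partial>\<nu>) sums (\<integral>t. (\<Sum>n. g t ^ Suc n / real (Suc n)) \<partial>\<nu>)"
  proof (rule sums_integral[OF integrable_\<nu>[OF bgn]])
    show "AE t in \<nu>. summable (\<lambda>n. norm (g t ^ Suc n / real (Suc n)))"
    proof (rule AE_I2, rule summable_comparison_test'[OF sq, of 0])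
      show "norm (norm (g t ^ Suc n / real (Suc n))) \<le> q ^ n" for t n
        using gnorm[of t n] by (simp only: real_norm_def abs_idempotent)
    qed
    show "summable (\<lambda>n. \<integral>t. norm (g t ^ Suc n / real (Suc n)) \<partial>\<nu>)"
    proof (rule summable_comparison_test'[OF sq, of 0])
      fix n
      have "(\<integral>t. norm (g t ^ Suc n / real (Suc n)) \<partial>\<nu>) \<le> (\<integral>t. q ^ n \<partial>\<nu>)"
        by (rule integral_mono[OF integrable_norm[OF integrable_\<nu>[OF bgn]] _ gnorm]) simp
      thus "norm (\<integral>t. norm (g t ^ Suc n / real (Suc n)) \<partial>\<nu>) \<le> q ^ n"
        by (simp add: prob del: power_Suc of_nat_Suc)
    qed
  qed
  moreover have "(\<Sum>n. g t ^ Suc n / real (Suc n)) = ln c - ln (f t)" for t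
  proof -
    have "(\<lambda>n. g t ^ Suc n / real (Suc n)) sums - ln (1 - g t)"
      using g[of t] q by (intro ln_one_minus_sums) auto
    moreover have "1 - g t = f t / c" by (simp add: g_def)
    ultimately show ?thesis using f0[of t] c0 by (simp add: sums_iff ln_div)
  qed
  ultimately have "lser (1 - (1 / c) *\<^sub>R FC f) = (\<integral>t. ln c - ln (f t) \<partial>\<nu>)"
    unfolding L by (simp add: sums_iff)
  also have "\<dots> = ln c - (\<integral>t. ln (f t) \<partial>\<nu>)"
    using integrable_\<nu>[OF bln] by (simp add: prob)
  finally show "ld (FC f) = (\<integral>t. ln (f t) \<partial>\<nu>)"
    using ld_eq_ldk[OF pd FC_norm[OF f c]] by (simp add: ldk_def)
qed

end

section \<open>A pointwise bound for the determinant of a shifted operator\<close>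

context tracial_algebra
begin

text \<open>Formally det G^2 = det(G B^{-1} G) det B \<le> det X det B. The summand \<eta> keeps the
  arguments of \<open>ld\<close> away from 0, and B \<ge> \<delta> replaces \<eta> B by a
  scalar.\<close>

lemma ld_Schur_complement:
  assumes G: "G \<in> N" "star G = G" and B: "pd B" "pos (B - \<delta> *\<^sub>R 1)" and \<delta>: "0 < \<delta>"
    and X: "X \<in> N" "pos X" "pos (X - G * binv B * G)" and \<eta>: "0 < \<eta>"
  shows "ld (G * G + (\<eta> * \<delta>) *\<^sub>R 1) \<le> ld (X + \<eta> *\<^sub>R 1) + ld B"
proof -
  note V = binv_pd[OF B(1)]
  have GG: "pos (G * G)" using pos_star_mult[of G] G by simp
  have GVG: "pos (G * binv B * G)" using pos_conj[OF V(4), of G] G by simp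
  have "pos (\<eta> *\<^sub>R (B - \<delta> *\<^sub>R 1))" using B \<eta> by (intro pos_scaleR) auto
  hence le1: "pos ((G * G + \<eta> *\<^sub>R B) - (G * G + (\<eta> * \<delta>) *\<^sub>R 1))" by (simp add: algebra_simps)
  have le2: "pos ((X + \<eta> *\<^sub>R 1) - (G * binv B * G + \<eta> *\<^sub>R 1))" using X by simp
  have "ld (G * G + (\<eta> * \<delta>) *\<^sub>R 1) \<le> ld (G * G + \<eta> *\<^sub>R B)"
    using G GG B \<eta> \<delta> by (intro ld_mono[OF _ _ le1] pd_pos_add pd_scaleR_one pd_scaleR) auto
  also have "\<dots> = ld (G * binv B * G + \<eta> *\<^sub>R 1) + ld B"
    using ld_Sylvester[OF B(1) G(1) \<eta>] G by simp
  also have "\<dots> \<le> ld (X + \<eta> *\<^sub>R 1) + ld B"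
    using G GVG V X \<eta> by (intro add_right_mono ld_mono[OF _ _ le2] pd_pos_add pd_scaleR_one) auto
  finally show ?thesis .
qed

lemma binv_commute:
  assumes "pd B" "G * B = B * G"
  shows "G * binv B = binv B * G"
  using inverse_push_through[of "binv B" B B "binv B" G G] binv_pd[OF assms(1)] assms(2) by simp

text \<open>With \<open>C = \<zeta>G\<close>, \<open>A = (1 - C\<^sup>*C)\<^sup>-\<^sup>1\<close> and \<open>F = 1 - C\<^sup>*u\<close> one has
  \<open>F\<^sup>*AF - (u - C)\<^sup>*A(u - C) = 1 - u\<^sup>*u\<close>: up to conjugation with \<open>A\<^sup>1\<^sup>/\<^sup>2\<close>, the operator
  \<open>(u - C)(1 - C\<^sup>*u)\<^sup>-\<^sup>1\<close> is a Moebius transform of \<open>u\<close> and hence a contraction. The determinant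
  of \<open>A\<close> cancels.\<close>

lemma ld_Moebius:
  assumes G: "G \<in> N" "star G = G" and u: "u \<in> N" "norm u \<le> 1"
    and c: "0 \<le> c" "c < 1" "cmod \<zeta> * norm G \<le> c" and \<eta>: "0 < \<eta>"
  defines "Z \<equiv> u - cscale \<zeta> G" and "S \<equiv> cscale (cnj \<zeta>) (G * u)"
  shows "norm S \<le> c"
    "ld (star Z * Z + (\<eta> * (1 - c\<^sup>2)) *\<^sub>R 1) \<le> ln (1 + \<eta> / (1 - c)\<^sup>2) - 2 * lser S"
proof -
  define r where "r = cmod \<zeta>"
  have nrG: "norm (r *\<^sub>R G) \<le> c" using c by (simp add: r_def)
  have "norm S \<le> r * (norm G * norm u)"
    unfolding S_def norm_cscale complex_mod_cnj r_def by (intro mult_left_mono norm_mult_ineq) simp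
  also have "\<dots> \<le> r * (norm G * 1)" using u by (intro mult_left_mono) (auto simp: r_def)
  also have "\<dots> \<le> c" using c by (simp add: r_def)
  finally show nS: "norm S \<le> c" .
  have S: "S \<in> N" "norm S < 1" using G u nS c by (auto simp: S_def)
  define B where "B = 1 - (r *\<^sub>R G) * (r *\<^sub>R G)"
  have nGG: "norm ((r *\<^sub>R G) * (r *\<^sub>R G)) \<le> c\<^sup>2"
    unfolding power2_eq_square by (rule order_trans[OF norm_mult_ineq mult_mono[OF nrG nrG]]) (use c in auto)
  have saGG: "star ((r *\<^sub>R G) * (r *\<^sub>R G)) = (r *\<^sub>R G) * (r *\<^sub>R G)" using G by (simp add: star_simps)
  have c2: "c\<^sup>2 < 1" using c by (simp add: power_less_one_iff abs_square_less_1)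
  have "pos (c\<^sup>2 *\<^sub>R 1 - (r *\<^sub>R G) * (r *\<^sub>R G))" by (rule pos_norm_diff[OF saGG nGG])
  hence Blow: "pos (B - (1 - c\<^sup>2) *\<^sub>R 1)" by (simp add: B_def algebra_simps)
  have B: "pd B" using G c2 by (intro pdI[OF _ _ Blow]) (auto simp: B_def)
  have Bup: "pos (1 - B)" using pos_star_mult[of "r *\<^sub>R G"] G by (simp add: B_def star_simps)
  define A where "A = binv B"
  have A: "A \<in> N" "pos A" "A * B = 1" using binv_pd[OF B] by (simp_all add: A_def)
  have AG: "G * A = A * G"
    unfolding A_def using B by (rule binv_commute) (simp add: B_def algebra_simps)
  define F where "F = 1 - S"
  have Z: "Z \<in> N" using G u by (auto simp: Z_def)
  have F: "F \<in> N" using S by (auto simp: F_def)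
  have id: "star F * A * F - star Z * A * Z = 1 - star u * u"
  proof -
    let ?C = "cscale \<zeta> G" and ?C' = "cscale (cnj \<zeta>) G"
    have rr: "\<zeta> * cnj \<zeta> = of_real (r\<^sup>2)" unfolding r_def complex_norm_square ..
    have CAC: "?C * A * ?C' = r\<^sup>2 *\<^sub>R (A * G * G)" "?C' * A * ?C = r\<^sup>2 *\<^sub>R (A * G * G)"
      by (simp_all only: cscale_mult_left cscale_mult_right cscale_cscale AG rr cscale_of_real mult.commute[of "cnj \<zeta>"])
    have CA: "?C * A = A * ?C" "?C' * A = A * ?C'" by (simp_all add: cscale_mult_left cscale_mult_right AG)
    \<comment> \<open>This is A B = 1 written out. It collapses the terms that remain once the mixed
      ones have cancelled by commutation of A with G.\<close>
    have one: "A - r\<^sup>2 *\<^sub>R (A * G * G) = 1"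
      using A(3) by (simp add: B_def algebra_simps power2_eq_square)
    have F': "F = 1 - ?C' * u" "star F = 1 - star u * ?C"
      using G by (simp_all add: F_def S_def star_simps cscale_mult_left cscale_mult_right)
    have Z': "star Z = star u - ?C'" using G by (simp add: Z_def star_simps)
    have P: "star F * A * F = A - star u * (?C * A) - (A * ?C') * u + star u * (?C * A * ?C') * u"
      unfolding F'(2) unfolding F'(1) by (simp add: algebra_simps)
    have Q: "star Z * A * Z = star u * A * u - star u * (A * ?C) - (?C' * A) * u + ?C' * A * ?C"
      unfolding Z' unfolding Z_def by (simp add: algebra_simps)
    have "star F * A * F - star Z * A * Z
        = (A - r\<^sup>2 *\<^sub>R (A * G * G)) - star u * (A - r\<^sup>2 *\<^sub>R (A * G * G)) * u"
      unfolding P Q CAC unfolding CA by (simp add: algebra_simps)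
    thus ?thesis unfolding one by simp
  qed
  have "norm (star u * u) \<le> 1"
    using order_trans[OF norm_mult_ineq, of "star u" u 1] u mult_mono[of "norm (star u)" 1 "norm u" 1] by simp
  hence "pos (1 *\<^sub>R 1 - star u * u)" by (intro pos_norm_diff) (simp add: star_simps)
  hence FZ: "pos ((star F * A * F + \<eta> *\<^sub>R 1) - (star Z * A * Z + \<eta> *\<^sub>R 1))" using id by simp
  have ps: "pos (star Y * A * Y)" "pos (Y * star Y)" "pos (star Y * Y)" for Y
    using pos_conj[OF A(2)] pos_star_mult[of Y] pos_star_mult[of "star Y"] by simp_all
  have \<eta>c: "0 < \<eta> * (1 - c\<^sup>2)" using \<eta> c2 by simp
  have "pos (\<eta> *\<^sub>R (B - (1 - c\<^sup>2) *\<^sub>R 1))" using Blow \<eta> by (intro pos_scaleR) auto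
  hence 1: "pos ((Z * star Z + \<eta> *\<^sub>R B) - (Z * star Z + (\<eta> * (1 - c\<^sup>2)) *\<^sub>R 1))"
    by (simp add: algebra_simps)
  have "pos (\<eta> *\<^sub>R (1 - B))" using Bup \<eta> by (intro pos_scaleR) auto
  hence 2: "pos ((F * star F + \<eta> *\<^sub>R 1) - (F * star F + \<eta> *\<^sub>R B))" by (simp add: algebra_simps)
  have FF: "pos (star F * F - ((1 - norm S)\<^sup>2) *\<^sub>R 1)" unfolding F_def by (rule pos_one_minus[OF S(2)])
  have "(1 - c)\<^sup>2 \<le> (1 - norm S)\<^sup>2" using nS c by (intro power_mono) auto
  hence FF': "pos (star F * F - ((1 - c)\<^sup>2) *\<^sub>R 1)" using pos_lower_mono[OF FF] by simp
  \<comment> \<open>Chosen so that k F*F \<ge> \<eta>, which absorbs the additive regulariser into a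
    multiple of F*F.\<close>
  define k where "k = \<eta> / (1 - c)\<^sup>2"
  have k: "0 < k" "k * (1 - c)\<^sup>2 = \<eta>" using \<eta> c by (simp_all add: k_def)
  have "pos (k *\<^sub>R (star F * F - ((1 - c)\<^sup>2) *\<^sub>R 1))" using FF' k by (intro pos_scaleR) auto
  hence 3: "pos ((1 + k) *\<^sub>R (star F * F) - (star F * F + \<eta> *\<^sub>R 1))"
    using k by (simp add: algebra_simps)
  have pdF: "pd (star F * F)" unfolding F_def by (rule pd_one_minus[OF S])
  \<comment> \<open>\<open>ld_Sylvester\<close> is applied once to Z and once, backwards, to F, so
    that \<open>ld B\<close> drops out. The bounds 1 - c^2 \<le> B \<le> 1 trade \<eta> B for
    scalars at the two ends.\<close>
  have "ld (star Z * Z + (\<eta> * (1 - c\<^sup>2)) *\<^sub>R 1) = ld (Z * star Z + (\<eta> * (1 - c\<^sup>2)) *\<^sub>R 1)"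
    by (rule ld_star_commute[OF Z \<eta>c])
  also have "\<dots> \<le> ld (Z * star Z + \<eta> *\<^sub>R B)"
    using Z ps B \<eta> \<eta>c by (intro ld_mono[OF _ _ 1] pd_pos_add pd_scaleR pd_scaleR_one) auto
  also have "\<dots> = ld (star Z * A * Z + \<eta> *\<^sub>R 1) + ld B"
    unfolding A_def by (rule ld_Sylvester[OF B Z \<eta>, symmetric])
  also have "\<dots> \<le> ld (star F * A * F + \<eta> *\<^sub>R 1) + ld B"
    using Z F A ps \<eta> by (intro add_right_mono ld_mono[OF _ _ FZ] pd_pos_add pd_scaleR_one) auto
  also have "\<dots> = ld (F * star F + \<eta> *\<^sub>R B)"
    unfolding A_def by (rule ld_Sylvester[OF B F \<eta>])
  also have "\<dots> \<le> ld (F * star F + \<eta> *\<^sub>R 1)"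
    using F ps B \<eta> by (intro ld_mono[OF _ _ 2] pd_pos_add pd_scaleR pd_scaleR_one) auto
  also have "\<dots> = ld (star F * F + \<eta> *\<^sub>R 1)" by (rule ld_star_commute[OF F \<eta>, symmetric])
  also have "\<dots> \<le> ld ((1 + k) *\<^sub>R (star F * F))"
    using F ps pdF k \<eta> by (intro ld_mono[OF _ _ 3] pd_pos_add pd_scaleR pd_scaleR_one) auto
  also have "\<dots> = ln (1 + k) + ld (star F * F)" using k pdF by (intro ld_scaleR) auto
  also have "ld (star F * F) = - 2 * lser S" unfolding F_def by (rule ld_one_minus[OF S])
  finally show "ld (star Z * Z + (\<eta> * (1 - c\<^sup>2)) *\<^sub>R 1) \<le> ln (1 + \<eta> / (1 - c)\<^sup>2) - 2 * lser S"
    by (simp add: k_def)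
qed

end

lemma shift_apply: "(x, y) \<in> T \<Longrightarrow> (x, y - c *\<^sub>C x) \<in> shift T c"
  by (auto simp: shift_def)

text \<open>The form inequality \<open>2 Re \<langle>Gx, y\<rangle> \<le> \<parallel>Zx\<parallel>\<^sup>2 + \<epsilon>\<parallel>Gx\<parallel>\<^sup>2 + \<langle>by, y\<rangle>\<close> for \<open>Z = TG\<close> and
  \<open>b = (T\<^sup>*T + \<epsilon>)\<^sup>-\<^sup>1\<close> expresses that \<open>G b\<^sup>-\<^sup>1 G \<le> Z\<^sup>*Z + \<epsilon>G\<^sup>2\<close>.\<close>

lemma (in affiliated_modulus) resolvent_form_bound:
  assumes G: "star G = G" and Z: "\<And>x. (G \<rhd> x, Z \<rhd> x) \<in> T" and \<epsilon>: "0 < \<epsilon>" and \<delta>: "0 < \<delta>"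
  defines "B \<equiv> FC (res \<epsilon>) + \<delta> *\<^sub>R 1"
  shows "pd B" "pos (B - \<delta> *\<^sub>R 1)" "pos (star Z * Z + \<epsilon> *\<^sub>R (G * G) - G * binv B * G)"
proof -
  define b where "b = FC (res \<epsilon>)"
  have bb: "bounded_borel (res \<epsilon>)" by (rule bounded_borel_res[OF \<epsilon>])
  have b: "b \<in> alg" "pos b"
    unfolding b_def using res_bounds(1)[OF \<epsilon>] by (auto intro!: FC_alg FC_pos bb less_imp_le)
  show low: "pos (B - \<delta> *\<^sub>R 1)" using b by (simp add: B_def b_def)
  show B: "pd B" using b \<delta> by (intro pdI[OF _ \<delta> low]) (auto simp: B_def b_def)
  note V = binv_pd[OF B]
  show "pos (star Z * Z + \<epsilon> *\<^sub>R (G * G) - G * binv B * G)"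
    unfolding pos_iff
  proof (intro conjI allI)
    show "star (star Z * Z + \<epsilon> *\<^sub>R (G * G) - G * binv B * G) = star Z * Z + \<epsilon> *\<^sub>R (G * G) - G * binv B * G"
      using G pos_star[OF V(4)] by (simp add: star_simps mult.assoc)
    fix x
    \<comment> \<open>At this y the form inequality is sharp enough to isolate G B^{-1} G: its value
      at x is the quantity \<open>g\<close> below.\<close>
    define y where "y = binv B \<rhd> G \<rhd> x"
    define w where "w = b \<rhd> y"
    define g where "g = Re (cinner (G \<rhd> x) y)"
    have "(w, y - \<epsilon> *\<^sub>R w) \<in> T O adj T" using A_res[OF \<epsilon>, of y] by (simp add: square_eq w_def b_def)
    then obtain v where v: "(w, v) \<in> T" "(v, y - \<epsilon> *\<^sub>R w) \<in> adj T" by blast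
    have "cinner (Z \<rhd> x) v = cinner (G \<rhd> x) (y - \<epsilon> *\<^sub>R w)" by (rule adjD[OF v(2) Z])
    hence 1: "g = inner (Z \<rhd> x) v + \<epsilon> * inner (G \<rhd> x) w"
      by (simp add: g_def cinner_simps Re_cinner[symmetric])
    have "cinner v v = cinner w (y - \<epsilon> *\<^sub>R w)" by (rule adjD[OF v(2,1)])
    hence "Re (cinner w y) = Re (of_real ((norm v)\<^sup>2) + \<epsilon> * of_real ((norm w)\<^sup>2))"
      by (simp add: cinner_simps cinner_self)
    hence 2: "Re (cinner w y) = (norm v)\<^sup>2 + \<epsilon> * (norm w)\<^sup>2" by simp
    have "B \<rhd> y = G \<rhd> x" unfolding y_def
      by (simp add: bapp_mult[symmetric] inverse_mult_cancel[OF V(1)])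
    moreover have "B \<rhd> y = w + \<delta> *\<^sub>R y" by (simp add: B_def b_def w_def bapp_simps)
    ultimately have "cinner (G \<rhd> x) y = cinner w y + of_real (\<delta> * (norm y)\<^sup>2)"
      by (metis cinner_add_left cinner_scaleR_left cinner_self of_real_mult)
    hence "g = Re (cinner w y) + \<delta> * (norm y)\<^sup>2" unfolding g_def by simp
    hence 3: "Re (cinner w y) \<le> g" using \<delta> by simp
    have 4: "2 * inner a c \<le> (norm a)\<^sup>2 + (norm c)\<^sup>2" for a c :: 'h
    proof -
      have "0 \<le> (norm (a - c))\<^sup>2" by simp
      also have "\<dots> = (norm a)\<^sup>2 + (norm c)\<^sup>2 - 2 * inner a c"
        by (simp add: power2_norm_eq_inner inner_simps inner_commute)
      finally show ?thesis by simp
    qed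
    have "2 * (\<epsilon> * inner (G \<rhd> x) w) \<le> \<epsilon> * ((norm (G \<rhd> x))\<^sup>2 + (norm w)\<^sup>2)"
      using mult_left_mono[OF 4[of "G \<rhd> x" w], of \<epsilon>] \<epsilon> by simp
    \<comment> \<open>The squares of v and w add up to Re \<open>cinner w y\<close>, at most
      \<open>g\<close> by the preceding step, so one of the two copies of \<open>g\<close>
      cancels.\<close>
    hence "2 * g \<le> (norm (Z \<rhd> x))\<^sup>2 + \<epsilon> * (norm (G \<rhd> x))\<^sup>2 + g"
      using 1 2 3 4[of "Z \<rhd> x" v] by (simp add: distrib_left)
    moreover have "Re (cinner ((star Z * Z + \<epsilon> *\<^sub>R (G * G)) \<rhd> x) x) = (norm (Z \<rhd> x))\<^sup>2 + \<epsilon> * (norm (G \<rhd> x))\<^sup>2"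
      using cinner_star[of "star Z"] cinner_star[of G] G by (simp add: bapp_simps cinner_simps cinner_self)
    moreover have "Re (cinner ((G * binv B * G) \<rhd> x) x) = g"
      using cinner_star[of G "binv B \<rhd> G \<rhd> x" x] G by (simp add: bapp_mult g_def y_def Re_cinner inner_commute)
    ultimately show "0 \<le> Re (cinner ((star Z * Z + \<epsilon> *\<^sub>R (G * G) - G * binv B * G) \<rhd> x) x)"
      by (simp add: bapp_diff_left cinner_diff_left)
  qed
qed

text \<open>The cut-off max(t, r), extended evenly because spectral measures are taken on the whole
  line.\<close>

definition level :: "real \<Rightarrow> real \<Rightarrow> real" where "level s t = max \<bar>t\<bar> s"

lemma level_pos: "0 < s \<Longrightarrow> 0 < level s t" "s \<le> level s t" "\<bar>t\<bar> \<le> level s t"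
  by (auto simp: level_def)

lemma bounded_borel_level:
  assumes s: "0 < s" and q: "0 < q"
  shows "bounded_borel (\<lambda>t. 1 / (q * level s t))" "\<bar>1 / (q * level s t)\<bar> \<le> 1 / (q * s)"
    "bounded_borel (\<lambda>t. t * (1 / (q * level s t)))" "\<bar>t * (1 / (q * level s t))\<bar> \<le> 1 / q"
proof -
  have m: "(\<lambda>t. level s t) \<in> borel_measurable borel" unfolding level_def by measurable
  have lp: "0 < level s t" "s \<le> level s t" "\<bar>t\<bar> \<le> level s t" for t using level_pos s by auto
  show 1: "\<bar>1 / (q * level s t)\<bar> \<le> 1 / (q * s)" for t
    using lp[of t] s q by (simp add: abs_of_pos divide_left_mono)
  show 2: "\<bar>t * (1 / (q * level s t))\<bar> \<le> 1 / q" for t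
    using lp[of t] q by (simp add: abs_mult abs_of_pos divide_simps)
  show "bounded_borel (\<lambda>t. 1 / (q * level s t))"
    by (rule bounded_borelI[OF _ 1]) (use m in measurable)
  show "bounded_borel (\<lambda>t. t * (1 / (q * level s t)))"
    by (rule bounded_borelI[OF _ 2]) (use m in measurable)
qed

section \<open>The determinant of T - \<zeta> against that of the cut-off modulus\<close>

context affiliated_modulus
begin

text \<open>The left side regularises log \<Delta>(T - \<zeta>), since -log(1/(t^2 + \<epsilon>) +
  \<epsilon>)/2 tends to log t; the term with \<open>lser\<close> is log \<Delta>(1 - \<zeta>*Gu).
  The Schur complement splits off the resolvent, and the Moebius estimate bounds what is left.
  \<open>K\<close> does not depend on \<epsilon>.\<close>

lemma shifted_determinant_bound:
  assumes S: "affiliated_modulus M \<tau> (shift T \<zeta>) A' E'"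
    and G: "G = FC (\<lambda>t. 1 / (q * level r t))"
    and u: "u \<in> alg" "norm u \<le> 1 / q" "\<And>x. (G \<rhd> x, u \<rhd> x) \<in> T"
    and q: "1 < q" and r: "0 < r" "cmod \<zeta> = r" and \<epsilon>: "0 < \<epsilon>"
    and int: "integrable \<nu> (\<lambda>t. ln (q * level r t))"
  defines "K \<equiv> (1 / (q * r)\<^sup>2 + 1) / ((1 - (1 / q)\<^sup>2) * (1 - 1 / q)\<^sup>2)"
  shows "- (\<integral>t. ln (res \<epsilon> t + \<epsilon>) \<partial>affiliated_modulus.\<nu> \<tau> E') / 2 \<le>
    (\<integral>t. ln (q * level r t) \<partial>\<nu>) - lser (cscale (cnj \<zeta>) (G * u)) + ln (1 + K * \<epsilon>) / 2"
proof -
  interpret S: affiliated_modulus M \<tau> "shift T \<zeta>" A' E' by fact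
  have q0: "0 < q" using q by simp
  note bl = bounded_borel_level[OF r(1) q0]
  let ?g = "\<lambda>t. 1 / (q * level r t)"
  have sG: "star G = G" "G \<in> alg" using bl by (simp_all add: G star_FC FC_alg)
  have nG: "norm G \<le> 1 / (q * r)" unfolding G by (rule FC_norm[OF bl(1,2)])
  define Z where "Z = u - cscale \<zeta> G"
  have Z: "(G \<rhd> x, Z \<rhd> x) \<in> shift T \<zeta>" for x
    using shift_apply[OF u(3)[of x], of \<zeta>] by (simp add: Z_def bapp_simps)
  have Zalg: "Z \<in> alg" using u sG by (auto simp: Z_def)
  define B where "B = S.FC (res \<epsilon>) + \<epsilon> *\<^sub>R 1"
  note form = S.resolvent_form_bound[OF sG(1) Z \<epsilon> \<epsilon>, folded B_def]
  define X where "X = star Z * Z + \<epsilon> *\<^sub>R (G * G)"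
  have GG: "pos (G * G)" using pos_star_mult[of G] sG by simp
  have X: "X \<in> alg" "pos X" using Zalg sG GG \<epsilon> by (auto simp: X_def intro!: pos_add pos_star_mult pos_scaleR)
  have step1: "ld (G * G + (\<epsilon> * \<epsilon>) *\<^sub>R 1) \<le> ld (X + \<epsilon> *\<^sub>R 1) + ld B"
    using ld_Schur_complement[OF sG(2,1) form(1,2) \<epsilon> X _ \<epsilon>] form(3) by (simp add: X_def)
  define c where "c = 1 / q"
  have c: "0 \<le> c" "c < 1" "cmod \<zeta> * norm G \<le> c"
    using q r mult_left_mono[OF nG, of r] by (simp_all add: c_def)
  have c2: "0 < 1 - c\<^sup>2" using c by (simp add: power_less_one_iff abs_square_less_1)
  \<comment> \<open>\<open>ld_Moebius\<close> is applied with \<eta> = m; then m (1 - c^2) dominates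
    \<epsilon>G^2 + \<epsilon>, as G^2 \<le> 1/(q r)^2.\<close>
  define m where "m = (\<epsilon> / (q * r)\<^sup>2 + \<epsilon>) / (1 - c\<^sup>2)"
  have m: "0 < m" unfolding m_def using \<epsilon> c2 q r by (intro divide_pos_pos add_pos_pos) auto
  have mc: "m * (1 - c\<^sup>2) = \<epsilon> / (q * r)\<^sup>2 + \<epsilon>" using c2 by (simp add: m_def)
  have "norm (G * G) \<le> (1 / (q * r))\<^sup>2"
    unfolding power2_eq_square by (rule order_trans[OF norm_mult_ineq mult_mono[OF nG nG]]) (use q r in auto)
  hence "pos ((1 / (q * r))\<^sup>2 *\<^sub>R 1 - G * G)" using sG by (intro pos_norm_diff) (simp_all add: star_simps)
  hence "pos (\<epsilon> *\<^sub>R ((1 / (q * r))\<^sup>2 *\<^sub>R 1 - G * G))" using \<epsilon> by (intro pos_scaleR) auto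
  hence le: "pos ((star Z * Z + (m * (1 - c\<^sup>2)) *\<^sub>R 1) - (X + \<epsilon> *\<^sub>R 1))"
    unfolding mc by (simp add: X_def algebra_simps power_divide)
  have "ld (X + \<epsilon> *\<^sub>R 1) \<le> ld (star Z * Z + (m * (1 - c\<^sup>2)) *\<^sub>R 1)"
    using X Zalg \<epsilon> m c2 by (intro ld_mono[OF _ _ le] pd_pos_add pd_scaleR_one pos_star_mult) auto
  also have "\<dots> \<le> ln (1 + m / (1 - c)\<^sup>2) - 2 * lser (cscale (cnj \<zeta>) (G * u))"
    unfolding Z_def using u q by (intro ld_Moebius(2)[OF sG(2,1) u(1) _ c m]) (auto intro: order_trans)
  also have "m / (1 - c)\<^sup>2 = K * \<epsilon>"
    by (simp add: m_def K_def c_def divide_simps) (simp add: algebra_simps)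
  finally have step2: "ld (X + \<epsilon> *\<^sub>R 1) \<le> ln (1 + K * \<epsilon>) - 2 * lser (cscale (cnj \<zeta>) (G * u))" .
  have bb: "bounded_borel (res \<epsilon>)" by (rule bounded_borel_res[OF \<epsilon>])
  have "B = S.FC (\<lambda>t. res \<epsilon> t + \<epsilon>)"
    by (simp add: B_def S.FC_add bb bounded_borel_const S.FC_const)
  hence step3: "ld B = (\<integral>t. ln (res \<epsilon> t + \<epsilon>) \<partial>S.\<nu>)"
    using S.ld_FC(2)[of "\<lambda>t. res \<epsilon> t + \<epsilon>" \<epsilon>] \<epsilon> bb res_bounds(1)[OF \<epsilon>]
    by (simp add: bounded_borel_add bounded_borel_const less_imp_le)
  let ?f = "\<lambda>t. ?g t * ?g t + \<epsilon> * \<epsilon>"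
  have bf: "bounded_borel ?f" by (intro bounded_borel_add bounded_borel_mult bl bounded_borel_const)
  have "G * G + (\<epsilon> * \<epsilon>) *\<^sub>R 1 = FC ?f"
    unfolding G by (simp only: FC_add[OF bounded_borel_mult[OF bl(1) bl(1)] bounded_borel_const] FC_mult[OF bl(1) bl(1)] FC_const)
  hence "ld (G * G + (\<epsilon> * \<epsilon>) *\<^sub>R 1) = (\<integral>t. ln (?f t) \<partial>\<nu>)"
    using ld_FC(2)[OF bf, of "\<epsilon> * \<epsilon>"] \<epsilon> by simp
  \<comment> \<open>Dropping \<epsilon>^2 under the logarithm leaves minus twice the logarithm of
    the cut-off.\<close>
  moreover have "(\<integral>t. - 2 * ln (q * level r t) \<partial>\<nu>) \<le> (\<integral>t. ln (?f t) \<partial>\<nu>)"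
  proof (rule integral_mono)
    show "integrable \<nu> (\<lambda>t. - 2 * ln (q * level r t))" using int by simp
    show "integrable \<nu> (\<lambda>t. ln (?f t))"
      using ld_FC(3)[OF bf, of "\<epsilon> * \<epsilon>"] \<epsilon> by (intro integrable_\<nu>) simp
    fix t
    have l: "0 < q * level r t" using level_pos(1)[OF r(1)] q0 by simp
    have "- 2 * ln (q * level r t) = ln (?g t * ?g t)" using l by (simp add: ln_mult ln_div)
    also have "\<dots> \<le> ln (?f t)" using l \<epsilon> by (intro ln_mono) (auto intro: add_pos_pos)
    finally show "- 2 * ln (q * level r t) \<le> ln (?f t)" .
  qed
  ultimately have "- 2 * (\<integral>t. ln (q * level r t) \<partial>\<nu>) \<le> ld (G * G + (\<epsilon> * \<epsilon>) *\<^sub>R 1)" by simp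
  thus ?thesis using step1 step2 unfolding step3 by (simp add: field_simps)
qed

end

section \<open>Logarithmic potentials\<close>

lemma e2ennreal_elog: "e2ennreal (elog t) = (if t \<le> 0 then 0 else ennreal (ln t))"
  by (simp add: elog_def e2ennreal_neg)

lemma e2ennreal_minus_elog: "e2ennreal (- elog t) = (if t \<le> 0 then \<infinity> else ennreal (- ln t))"
  by (simp add: elog_def)

lemma elog_measurable [measurable]: "elog \<in> borel_measurable borel"
  unfolding elog_def[abs_def] by measurable

lemma e2ennreal_minus_elog_measurable: "(\<lambda>t. e2ennreal (- elog t)) \<in> borel_measurable borel"
  unfolding e2ennreal_minus_elog by measurable

lemma ext_integral_elog_eq:
  fixes f :: "'a \<Rightarrow> real"
  assumes int: "integrable m (\<lambda>x. ln (f x))" and pos: "AE x in m. 0 < f x"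
  shows "ext_integral m (\<lambda>x. elog (f x)) = ereal (\<integral>x. ln (f x) \<partial>m)"
proof -
  have p: "(\<integral>\<^sup>+x. e2ennreal (elog (f x)) \<partial>m) = (\<integral>\<^sup>+x. ennreal (ln (f x)) \<partial>m)"
    using pos by (intro nn_integral_cong_AE) (auto simp: e2ennreal_elog)
  have n: "(\<integral>\<^sup>+x. e2ennreal (- elog (f x)) \<partial>m) = (\<integral>\<^sup>+x. ennreal (- ln (f x)) \<partial>m)"
    using pos by (intro nn_integral_cong_AE) (auto simp: e2ennreal_minus_elog)
  obtain r q where rq: "0 \<le> r" "0 \<le> q" "(\<integral>\<^sup>+x. ennreal (ln (f x)) \<partial>m) = ennreal r"
    "(\<integral>\<^sup>+x. ennreal (- ln (f x)) \<partial>m) = ennreal q" "(\<integral>x. ln (f x) \<partial>m) = r - q"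
    using integrableE[OF int] by metis
  show ?thesis unfolding ext_integral_def p n rq(3,4,5) using rq(1,2) by (simp add: enn2ereal_ennreal)
qed

text \<open>With the positive part finite, an extended integral other than minus infinity has a
  finite negative part as well. That part is infinite wherever f \<le> 0, so f is positive almost
  everywhere.\<close>

lemma ext_integral_elog_finite:
  fixes f :: "'a \<Rightarrow> real"
  assumes f: "f \<in> borel_measurable m" and fin: "(\<integral>\<^sup>+x. e2ennreal (elog (f x)) \<partial>m) < \<infinity>"
    and ne: "ext_integral m (\<lambda>x. elog (f x)) \<noteq> -\<infinity>"
  shows "integrable m (\<lambda>x. ln (f x))" "AE x in m. 0 < f x"
proof -
  have m: "(\<lambda>x. e2ennreal (- elog (f x))) \<in> borel_measurable m"
    using measurable_compose[OF f e2ennreal_minus_elog_measurable] by simp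
  have neg: "(\<integral>\<^sup>+x. e2ennreal (- elog (f x)) \<partial>m) \<noteq> \<infinity>"
  proof
    assume "(\<integral>\<^sup>+x. e2ennreal (- elog (f x)) \<partial>m) = \<infinity>"
    hence "ext_integral m (\<lambda>x. elog (f x)) = -\<infinity>"
      using fin unfolding ext_integral_def by (cases "\<integral>\<^sup>+x. e2ennreal (elog (f x)) \<partial>m") (auto simp: enn2ereal_ennreal)
    thus False using ne by simp
  qed
  have "AE x in m. e2ennreal (- elog (f x)) \<noteq> \<infinity>"
    using neg by (rule nn_integral_noteq_infinite[OF m])
  thus pos: "AE x in m. 0 < f x"
    by eventually_elim (auto simp: e2ennreal_minus_elog split: if_splits)
  show "integrable m (\<lambda>x. ln (f x))"
  proof (rule integrableI_bounded)
    have "(\<integral>\<^sup>+x. ennreal (norm (ln (f x))) \<partial>m) = (\<integral>\<^sup>+x. e2ennreal (elog (f x)) + e2ennreal (- elog (f x)) \<partial>m)"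
      using pos by (intro nn_integral_cong_AE, eventually_elim)
        (auto simp: e2ennreal_elog e2ennreal_minus_elog abs_if ennreal_neg)
    also have "\<dots> = (\<integral>\<^sup>+x. e2ennreal (elog (f x)) \<partial>m) + (\<integral>\<^sup>+x. e2ennreal (- elog (f x)) \<partial>m)"
      by (rule nn_integral_add[OF _ m]) (use f in measurable)
    also have "\<dots> < \<infinity>" using fin neg by (simp add: less_top)
    finally show "(\<integral>\<^sup>+x. ennreal (norm (ln (f x))) \<partial>m) < \<infinity>" .
  qed (use f in measurable)
qed

text \<open>The expression is half the logarithm of y = (t^2 + \<epsilon>)/(1 + \<epsilon>(t^2 +
  \<epsilon>)), which lies between min(t^2, 1)/3 and 3 max(t^2, 1) uniformly in \<epsilon> \<le> 1.
  It provides the majorant for the limit \<epsilon> to 0.\<close>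

lemma ln_regularized_bounds:
  fixes t :: real
  assumes t: "0 < t" and \<epsilon>: "0 < \<epsilon>" "\<epsilon> \<le> 1"
  shows "\<bar>- ln (1 / (t\<^sup>2 + \<epsilon>) + \<epsilon>) / 2\<bar> \<le> \<bar>ln t\<bar> + ln 3"
proof -
  define y where "y = (t\<^sup>2 + \<epsilon>) / (1 + \<epsilon> * (t\<^sup>2 + \<epsilon>))"
  have t2: "0 < t\<^sup>2 + \<epsilon>" using t \<epsilon> by (simp add: add_pos_pos)
  have den: "1 \<le> 1 + \<epsilon> * (t\<^sup>2 + \<epsilon>)" using t2 \<epsilon> by simp
  have y0: "0 < y" unfolding y_def using t2 den by (intro divide_pos_pos) auto
  have "1 / (t\<^sup>2 + \<epsilon>) + \<epsilon> = 1 / y" using t2 by (simp add: y_def field_simps)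
  hence eq: "- ln (1 / (t\<^sup>2 + \<epsilon>) + \<epsilon>) / 2 = ln y / 2" using y0 by (simp add: ln_div)
  have \<epsilon>2: "\<epsilon> * \<epsilon> \<le> 1" using mult_mono[of \<epsilon> 1 \<epsilon> 1] \<epsilon> by simp
  have "y \<le> (t\<^sup>2 + \<epsilon>) / 1" unfolding y_def using t2 den by (intro divide_left_mono) auto
  also have "\<dots> \<le> 3 * max (t\<^sup>2) 1" using \<epsilon> by (simp add: max_def)
  finally have up: "y \<le> 3 * max (t\<^sup>2) 1" .
  have low: "min (t\<^sup>2) 1 / 3 \<le> y"
  proof (cases "t\<^sup>2 \<le> 1")
    case True
    have "\<epsilon> * t\<^sup>2 \<le> 1" using mult_mono[of \<epsilon> 1 "t\<^sup>2" 1] True \<epsilon> by simp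
    hence "1 + \<epsilon> * (t\<^sup>2 + \<epsilon>) \<le> 3" using \<epsilon>2 by (simp add: algebra_simps)
    hence "t\<^sup>2 / 3 \<le> t\<^sup>2 / (1 + \<epsilon> * (t\<^sup>2 + \<epsilon>))" using den by (intro divide_left_mono) auto
    also have "\<dots> \<le> y" unfolding y_def using den \<epsilon> by (intro divide_right_mono) auto
    finally show ?thesis using True by simp
  next
    case False
    have "\<epsilon> * t\<^sup>2 \<le> t\<^sup>2" using \<epsilon> by (simp add: mult_left_le_one_le)
    hence "1 + \<epsilon> * (t\<^sup>2 + \<epsilon>) \<le> 3 * (t\<^sup>2 + \<epsilon>)" using \<epsilon>2 False \<epsilon>(1) by (simp add: algebra_simps)
    hence "1 / 3 \<le> y" using den by (simp add: y_def divide_simps)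
    thus ?thesis using False by simp
  qed
  have "ln y \<le> ln (3 * max (t\<^sup>2) 1)" using up y0 by (intro ln_mono) auto
  also have "\<dots> = ln 3 + max (2 * ln t) 0"
    using t by (auto simp: ln_mult max_def ln_realpow power_le_one_iff abs_le_square_iff)
  finally have 1: "ln y \<le> ln 3 + 2 * \<bar>ln t\<bar>" by (simp add: max_def abs_if split: if_splits)
  have m0: "0 < min (t\<^sup>2) 1" using t by (simp add: min_def)
  have "ln (min (t\<^sup>2) 1 / 3) \<le> ln y" by (rule ln_mono[OF low]) (use m0 in linarith)
  moreover have "ln (min (t\<^sup>2) 1 / 3) = ln (min (t\<^sup>2) 1) - ln 3" using ln_div[of "min (t\<^sup>2) 1" 3] less_imp_neq[OF m0] by (simp only: if_True) simp
  moreover have "- 2 * \<bar>ln t\<bar> \<le> ln (min (t\<^sup>2) 1)"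
    using t by (auto simp: min_def ln_realpow abs_if)
  ultimately have 2: "- ln 3 - 2 * \<bar>ln t\<bar> \<le> ln y" by linarith
  have "0 \<le> ln (3::real)" by simp
  thus ?thesis unfolding eq using 1 2 by linarith
qed

text \<open>If the extended integral is minus infinity there is nothing to show. Otherwise
  \<open>ln\<close> is integrable and dominates the regularised logarithms along \<epsilon> = 1/(n +
  1).\<close>

lemma ext_integral_elog_le:
  fixes \<nu> :: "real measure"
  assumes \<nu>: "prob_space \<nu>" "sets \<nu> = sets borel" and fin: "(\<integral>\<^sup>+t. e2ennreal (elog t) \<partial>\<nu>) < \<infinity>"
    and le: "\<And>\<epsilon>. 0 < \<epsilon> \<Longrightarrow> - (\<integral>t. ln (1 / (t\<^sup>2 + \<epsilon>) + \<epsilon>) \<partial>\<nu>) / 2 \<le> R + ln (1 + K * \<epsilon>) / 2"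
  shows "ext_integral \<nu> elog \<le> ereal R"
proof (cases "ext_integral \<nu> elog = -\<infinity>")
  case False
  interpret prob_space \<nu> by fact
  have bm: "borel_measurable \<nu> = borel_measurable borel" by (rule measurable_cong_sets) (use \<nu> in auto)
  have int: "integrable \<nu> ln" and pos: "AE t in \<nu>. 0 < t"
    using ext_integral_elog_finite[of "\<lambda>t. t" \<nu>] fin False by (simp_all add: bm)
  let ?e = "\<lambda>n. 1 / real (Suc n)" and ?f = "\<lambda>n t. - ln (1 / (t\<^sup>2 + 1 / real (Suc n)) + 1 / real (Suc n)) / 2"
  have e: "?e \<longlonglongrightarrow> 0" by (rule LIMSEQ_Suc[OF lim_1_over_n])
  have "(\<lambda>n. \<integral>t. ?f n t \<partial>\<nu>) \<longlonglongrightarrow> (\<integral>t. ln t \<partial>\<nu>)"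
  proof (rule integral_dominated_convergence[where w = "\<lambda>t. \<bar>ln t\<bar> + ln 3"])
    show "integrable \<nu> (\<lambda>t. \<bar>ln t\<bar> + ln 3)" using int by simp
    show "AE t in \<nu>. (\<lambda>n. ?f n t) \<longlonglongrightarrow> ln t"
      using pos
    proof eventually_elim
      case (elim t)
      have "(\<lambda>n. ?f n t) \<longlonglongrightarrow> - ln (1 / (t\<^sup>2 + 0) + 0) / 2"
        using elim by (intro tendsto_intros e) auto
      also have "- ln (1 / (t\<^sup>2 + 0) + 0) / 2 = ln t" using elim by (simp add: ln_div ln_realpow)
      finally show ?case .
    qed
    show "AE t in \<nu>. norm (?f n t) \<le> \<bar>ln t\<bar> + ln 3" for n
      using pos by eventually_elim (unfold real_norm_def, rule ln_regularized_bounds, auto)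
  qed (auto simp: bm)
  moreover have "(\<lambda>n. R + ln (1 + K * ?e n) / 2) \<longlonglongrightarrow> R + ln (1 + K * 0) / 2"
    by (intro tendsto_intros e) auto
  moreover have "(\<integral>t. ?f n t \<partial>\<nu>) \<le> R + ln (1 + K * ?e n) / 2" for n
    using le[of "?e n"] by simp
  ultimately have "(\<integral>t. ln t \<partial>\<nu>) \<le> R + ln (1 + K * 0) / 2" by (intro LIMSEQ_le) auto
  thus ?thesis using ext_integral_elog_eq[OF int pos] by simp
qed simp

subsection \<open>Circular means\<close>

definition circle :: "real measure" where
  "circle = density lborel (\<lambda>x. ennreal (indicator {0..2 * pi} x / (2 * pi)))"

lemma sets_circle [simp, measurable_cong]: "sets circle = sets borel"
  by (simp add: circle_def)

lemma space_circle [simp]: "space circle = UNIV"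
  by (simp add: circle_def)

lemma prob_space_circle: "prob_space circle"
proof (rule prob_spaceI)
  have "emeasure circle (space circle) = (\<integral>\<^sup>+x. ennreal (1 / (2 * pi)) * indicator {0..2 * pi} x \<partial>lborel)"
    by (simp add: circle_def emeasure_density) (auto intro!: nn_integral_cong simp: indicator_def)
  also have "\<dots> = ennreal (1 / (2 * pi)) * ennreal (2 * pi)" by (simp add: nn_integral_cmult_indicator)
  also have "\<dots> = 1" by (simp add: ennreal_mult[symmetric])
  finally show "emeasure circle (space circle) = 1" .
qed

lemma measurable_circle: "borel_measurable circle = borel_measurable borel"
  by (rule measurable_cong_sets) auto

lemma integrable_circle_bounded:
  fixes f :: "real \<Rightarrow> real"
  assumes "f \<in> borel_measurable borel" "\<And>t. \<bar>f t\<bar> \<le> c"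
  shows "integrable circle f"
proof -
  interpret prob_space circle by (rule prob_space_circle)
  show ?thesis using assms by (intro integrable_const_bound[where B = c]) (auto simp: measurable_circle)
qed

lemma cis_measurable [measurable]: "cis \<in> borel_measurable borel"
  by (intro borel_measurable_continuous_onI continuous_intros)

lemma circle_integral_cis:
  assumes "0 < n"
  shows "(\<integral>t. Re (a * cis (real n * t)) \<partial>circle) = 0"
proof -
  let ?f = "\<lambda>t. Re a * cos (real n * t) - Im a * sin (real n * t)"
  let ?F = "\<lambda>t. (Re a * sin (real n * t) + Im a * cos (real n * t)) / real n"
  have "(\<integral>t. Re (a * cis (real n * t)) \<partial>circle) = (\<integral>t. (indicator {0..2 * pi} t / (2 * pi)) *\<^sub>R ?f t \<partial>lborel)"
    unfolding circle_def by (subst integral_density) auto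
  also have "\<dots> = (\<integral>t. (1 / (2 * pi)) * (?f t * indicator {0..2 * pi} t) \<partial>lborel)"
    by (intro Bochner_Integration.integral_cong) auto
  also have "\<dots> = (1 / (2 * pi)) * (\<integral>t. ?f t * indicator {0..2 * pi} t \<partial>lborel)" by simp
  also have "(\<integral>t. ?f t * indicator {0..2 * pi} t \<partial>lborel) = ?F (2 * pi) - ?F 0"
  proof (rule integral_FTC_Icc_real)
    fix t show "(?F has_real_derivative ?f t) (at t)"
      using assms by (auto intro!: derivative_eq_intros simp: field_simps)
    show "isCont ?f t" by (intro continuous_intros)
  qed simp
  also have "sin (real n * (2 * pi)) = 0" using sin_int_2pin[of "int n"] by (simp add: mult_ac)
  also have "cos (real n * (2 * pi)) = 1" using cos_int_2pin[of "int n"] by (simp add: mult_ac)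
  finally show ?thesis by simp
qed

text \<open>Absolute summability allows integration termwise, and the frequencies start at 1, so
  every term has mean 0.\<close>

lemma circle_integral_series:
  fixes a :: "nat \<Rightarrow> complex"
  assumes a: "summable (\<lambda>n. cmod (a n))"
  defines "f \<equiv> \<lambda>t. \<Sum>n. Re (a n * cis (real (Suc n) * t))"
  shows "integrable circle f" "(\<integral>t. f t \<partial>circle) = 0"
proof -
  interpret prob_space circle by (rule prob_space_circle)
  have prob: "measure circle UNIV = 1" using prob_space by simp
  have le: "norm (Re (a n * cis (real (Suc n) * t))) \<le> cmod (a n)" for n t
    using abs_Re_le_cmod[of "a n * cis (real (Suc n) * t)"] by (simp add: norm_mult)
  have int: "integrable circle (\<lambda>t. Re (a n * cis (real (Suc n) * t)))" for n
    by (rule integrable_circle_bounded[OF _ le[unfolded real_norm_def]]) measurable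
  have s1: "AE t in circle. summable (\<lambda>n. norm (Re (a n * cis (real (Suc n) * t))))"
    using le by (intro AE_I2 summable_comparison_test'[OF a, of 0]) auto
  have s2: "summable (\<lambda>n. \<integral>t. norm (Re (a n * cis (real (Suc n) * t))) \<partial>circle)"
  proof (rule summable_comparison_test'[OF a, of 0])
    fix n
    have "(\<integral>t. norm (Re (a n * cis (real (Suc n) * t))) \<partial>circle) \<le> (\<integral>t. cmod (a n) \<partial>circle)"
      by (rule integral_mono[OF integrable_norm[OF int] _ le]) simp
    thus "norm (\<integral>t. norm (Re (a n * cis (real (Suc n) * t))) \<partial>circle) \<le> cmod (a n)"
      by (simp add: prob)
  qed
  show "integrable circle f" unfolding f_def by (rule integrable_suminf[OF int s1 s2])
  have "(\<integral>t. f t \<partial>circle) = (\<Sum>n. \<integral>t. Re (a n * cis (real (Suc n) * t)) \<partial>circle)"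
    unfolding f_def by (rule integral_suminf[OF int s1 s2])
  also have "\<dots> = 0" by (simp only: circle_integral_cis[OF zero_less_Suc] suminf_zero)
  finally show "(\<integral>t. f t \<partial>circle) = 0" .
qed

lemma ln_cmod_one_minus_sums:
  assumes "cmod z < 1"
  shows "(\<lambda>n. Re (- (z ^ Suc n / of_nat (Suc n)))) sums ln (cmod (1 - z))"
proof -
  have "(\<lambda>n. - (z ^ n / of_nat n)) sums Ln (1 - z)"
    using Ln_series'[of "- z"] assms by simp
  hence "(\<lambda>n. - (z ^ Suc n / of_nat (Suc n))) sums Ln (1 - z)"
    using sums_iff_shift[of "\<lambda>n. - (z ^ n / of_nat n)" 1 "Ln (1 - z)"] by simp
  hence "(\<lambda>n. Re (- (z ^ Suc n / of_nat (Suc n)))) sums Re (Ln (1 - z))"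
    by (rule bounded_linear.sums[OF bounded_linear_Re])
  moreover have "Re (Ln (1 - z)) = ln (cmod (1 - z))" using assms by (intro Re_Ln) auto
  ultimately show ?thesis by (simp only:)
qed

lemma circle_integral_ln_one_minus:
  assumes w: "cmod w < 1"
  shows "integrable circle (\<lambda>t. ln (cmod (1 - w * cis t)))" "(\<integral>t. ln (cmod (1 - w * cis t)) \<partial>circle) = 0"
proof -
  let ?a = "\<lambda>n. - (w ^ Suc n / of_nat (Suc n))"
  have a: "summable (\<lambda>n. cmod (?a n))"
  proof (rule summable_comparison_test'[of "\<lambda>n. cmod w ^ n" 0])
    show "summable (\<lambda>n. cmod w ^ n)" using w by (auto intro: summable_geometric)
    fix n
    have "cmod (?a n) = cmod w ^ Suc n / real (Suc n)"
      by (simp only: norm_minus_cancel norm_divide norm_power norm_of_nat)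
    also have "\<dots> \<le> cmod w ^ Suc n / 1" by (intro divide_left_mono) auto
    also have "\<dots> \<le> cmod w ^ n" using w by (auto intro: mult_left_le_one_le)
    finally show "norm (cmod (?a n)) \<le> cmod w ^ n" by (simp only: real_norm_def abs_norm_cancel)
  qed
  have "ln (cmod (1 - w * cis t)) = (\<Sum>n. Re (?a n * cis (real (Suc n) * t)))" for t
  proof -
    have "(w * cis t) ^ Suc n / of_nat (Suc n) = w ^ Suc n / of_nat (Suc n) * cis (real (Suc n) * t)" for n
      by (simp only: power_mult_distrib Complex.DeMoivre times_divide_eq_left)
    thus ?thesis
      using ln_cmod_one_minus_sums[of "w * cis t"] w by (simp add: norm_mult sums_iff del: power_Suc of_nat_Suc)
  qed
  thus "integrable circle (\<lambda>t. ln (cmod (1 - w * cis t)))" "(\<integral>t. ln (cmod (1 - w * cis t)) \<partial>circle) = 0"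
    using circle_integral_series[OF a] by (simp_all del: power_Suc of_nat_Suc)
qed

text \<open>Jensen's formula for a linear polynomial. The larger of r and |z| is factored out,
  leaving |1 - w e^{it}| with |w| < 1, whose logarithm has mean 0.\<close>

lemma circle_integral_ln_dist:
  assumes r: "0 < r" and z: "cmod z \<noteq> r"
  shows "integrable circle (\<lambda>t. ln (cmod (of_real r * cis t - z)))"
    "(\<integral>t. ln (cmod (of_real r * cis t - z)) \<partial>circle) = ln (max r (cmod z))"
proof -
  interpret prob_space circle by (rule prob_space_circle)
  have prob: "measure circle UNIV = 1" using prob_space by simp
  obtain w where w: "cmod w < 1" "\<And>t. cmod (of_real r * cis t - z) = max r (cmod z) * cmod (1 - w * cis t)"
  proof (cases "cmod z < r")
    case True
    show thesis
    proof (rule that[of "cnj z / of_real r"])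
      show "cmod (cnj z / of_real r) < 1" using True r by (simp add: norm_divide)
      fix t
      \<comment> \<open>The conjugate leaves the modulus unchanged and turns
        \<open>cis (- t)\<close> into \<open>cis t\<close>, so both cases share one power
        series.\<close>
      have "of_real r * cis t - z = (of_real r * cis t) * cnj (1 - cnj z / of_real r * cis t)"
        using r by (simp add: right_diff_distrib cis_cnj cis_mult)
      also have "cmod \<dots> = r * cmod (1 - cnj z / of_real r * cis t)"
        using r by (simp only: norm_mult complex_mod_cnj) simp
      finally show "cmod (of_real r * cis t - z) = max r (cmod z) * cmod (1 - cnj z / of_real r * cis t)"
        using True by simp
    qed
  next
    case False
    hence zr: "r < cmod z" "z \<noteq> 0" using z r by auto
    show thesis
    proof (rule that[of "of_real r / z"])
      show "cmod (of_real r / z) < 1" using zr r by (simp add: norm_divide)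
      fix t
      have "of_real r * cis t - z = - z * (1 - of_real r / z * cis t)"
        using zr by (simp add: field_simps)
      hence "cmod (of_real r * cis t - z) = cmod z * cmod (1 - of_real r / z * cis t)"
        by (simp only: norm_mult norm_minus_cancel)
      thus "cmod (of_real r * cis t - z) = max r (cmod z) * cmod (1 - of_real r / z * cis t)"
        using zr by simp
    qed
  qed
  have "1 - w * cis t \<noteq> 0" for t
  proof
    assume "1 - w * cis t = 0"
    hence "cmod (w * cis t) = 1" by simp
    thus False using w(1) by (simp add: norm_mult)
  qed
  hence eq: "ln (cmod (of_real r * cis t - z)) = ln (max r (cmod z)) + ln (cmod (1 - w * cis t))" for t
    using r by (simp add: w(2) ln_mult less_max_iff_disj)
  show "integrable circle (\<lambda>t. ln (cmod (of_real r * cis t - z)))"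
    "(\<integral>t. ln (cmod (of_real r * cis t - z)) \<partial>circle) = ln (max r (cmod z))"
    unfolding eq using circle_integral_ln_one_minus[OF w(1)] by (simp_all add: prob)
qed

text \<open>Averaging the potential bound over the circle and exchanging integrals turns log|r
  e^{it} - z| into log max(r, |z|). The work lies in joint integrability, as the logarithm is
  unbounded below.\<close>

lemma integral_ln_max_le:
  fixes \<mu> :: "complex measure"
  assumes \<mu>: "prob_space \<mu>" "sets \<mu> = sets borel"
    and fin: "(\<integral>\<^sup>+z. e2ennreal (elog (cmod z)) \<partial>\<mu>) < \<infinity>"
    and r: "0 < r" and null: "AE z in \<mu>. cmod z \<noteq> r"
    and R: "integrable circle R" "\<And>t. ext_integral \<mu> (\<lambda>z. elog (cmod (of_real r * cis t - z))) \<le> ereal (R t)"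
  shows "integrable \<mu> (\<lambda>z. ln (max r (cmod z)))" "(\<integral>z. ln (max r (cmod z)) \<partial>\<mu>) \<le> (\<integral>t. R t \<partial>circle)"
proof -
  interpret \<mu>: prob_space \<mu> by fact
  interpret C: prob_space circle by (rule prob_space_circle)
  interpret pair_sigma_finite \<mu> circle ..
  have bm: "borel_measurable \<mu> = borel_measurable borel" by (rule measurable_cong_sets) (use \<mu> in auto)
  define L where "L z = ln (max 1 (cmod z))" for z :: complex
  have L: "integrable \<mu> L"
  proof (rule integrableI_nonneg)
    show "AE z in \<mu>. 0 \<le> L z" by (simp add: L_def)
    have "ennreal (L z) = e2ennreal (elog (cmod z))" for z
      by (simp add: L_def e2ennreal_elog max_def ennreal_neg)
    thus "(\<integral>\<^sup>+z. ennreal (L z) \<partial>\<mu>) < \<infinity>" using fin by simp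
    show "L \<in> borel_measurable \<mu>" unfolding bm L_def by measurable
  qed
  define U where "U z = ln (2 + r) + L z" for z
  have U: "integrable \<mu> U" unfolding U_def using L by simp
  have Ubound: "ln (1 + r + cmod z) \<le> U z" for z
  proof -
    have "1 + r + cmod z \<le> (2 + r) * max 1 (cmod z)"
      using mult_left_mono[of 1 "max 1 (cmod z)" "1 + r"] r by (simp add: distrib_right)
    hence "ln (1 + r + cmod z) \<le> ln ((2 + r) * max 1 (cmod z))" using r by (intro ln_mono) (auto intro: add_pos_nonneg)
    also have "\<dots> = U z" using r by (simp add: U_def L_def ln_mult less_max_iff_disj)
    finally show ?thesis .
  qed
  let ?f = "\<lambda>z t. ln (cmod (of_real r * cis t - z))"
  have U0: "0 \<le> U z" for z using r by (simp add: U_def L_def)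
  have fU: "?f z t \<le> U z" for z t
  proof -
    have "cmod (of_real r * cis t - z) \<le> r + cmod z"
      using norm_triangle_ineq4[of "of_real r * cis t" z] r by (simp add: norm_mult)
    hence "cmod (of_real r * cis t - z) \<le> 1 + r + cmod z" by simp
    \<comment> \<open>The second alternative covers a vanishing distance, where
      \<open>ln 0 = 0\<close> by convention; \<open>U\<close> is nonnegative and dominates it
      too.\<close>
    hence "?f z t \<le> ln (1 + r + cmod z) \<or> ?f z t = 0"
      using ln_mono[of "cmod (of_real r * cis t - z)" "1 + r + cmod z"]
      by (cases "cmod (of_real r * cis t - z) = 0") auto
    thus "?f z t \<le> U z" using Ubound[of z] U0[of z] by linarith
  qed
  \<comment> \<open>An upper bound controls the absolute value through the mean: the circle average
    of \<open>?f\<close> is known explicitly, so that of 2 U - \<open>?f\<close> is as well.\<close>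
  have fabs: "norm (?f z t) \<le> 2 * U z - ?f z t" for z t
    using fU[of t z] U0[of z] by (simp add: abs_if)
  have mf: "(\<lambda>(z, t). ?f z t) \<in> borel_measurable (\<mu> \<Otimes>\<^sub>M circle)"
  proof -
    have eq: "(borel_measurable (\<mu> \<Otimes>\<^sub>M circle) :: (complex \<times> real \<Rightarrow> real) set)
        = borel_measurable (borel \<Otimes>\<^sub>M borel)"
      by (intro measurable_cong_sets sets_pair_measure_cong) (use \<mu> in auto)
    show ?thesis unfolding eq by measurable
  qed
  have intC: "AE z in \<mu>. integrable circle (?f z)"
    using null by eventually_elim (rule circle_integral_ln_dist(1)[OF r])
  have mN: "(\<lambda>z. \<integral>t. norm (?f z t) \<partial>circle) \<in> borel_measurable \<mu>"
    using C.borel_measurable_lebesgue_integral[of "\<lambda>z t. norm (?f z t)" \<mu>] mf by (simp add: split_beta')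
  have prodint: "integrable (\<mu> \<Otimes>\<^sub>M circle) (\<lambda>(z, t). ?f z t)"
  proof (rule Fubini_integrable[OF mf])
    show "AE z in \<mu>. integrable circle (\<lambda>t. case (z, t) of (z, t) \<Rightarrow> ?f z t)" using intC by simp
    have "integrable \<mu> (\<lambda>z. \<integral>t. norm (?f z t) \<partial>circle)"
    proof (rule Bochner_Integration.integrable_bound[of \<mu> "\<lambda>z. 2 * U z + \<bar>ln r\<bar>"])
      show "integrable \<mu> (\<lambda>z. 2 * U z + \<bar>ln r\<bar>)" using U by simp
      show "AE z in \<mu>. norm (\<integral>t. norm (?f z t) \<partial>circle) \<le> norm (2 * U z + \<bar>ln r\<bar>)"
        using null
      proof eventually_elim
        case (elim z)
        note c = circle_integral_ln_dist[OF r elim]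
        have "(\<integral>t. norm (?f z t) \<partial>circle) \<le> (\<integral>t. 2 * U z - ?f z t \<partial>circle)"
          using c(1) fabs by (intro integral_mono integrable_norm) auto
        also have "\<dots> = 2 * U z - ln (max r (cmod z))" using c C.prob_space by simp
        also have "\<dots> \<le> 2 * U z + \<bar>ln r\<bar>"
          using ln_mono[OF max.cobounded1[of r "cmod z"] r] by linarith
        finally show ?case using U0[of z] by simp
      qed
    qed (rule mN)
    thus "integrable \<mu> (\<lambda>z. \<integral>t. norm (case (z, t) of (z, t) \<Rightarrow> ?f z t) \<partial>circle)" by simp
  qed
  have AEpos: "AE z in \<mu>. 0 < cmod (of_real r * cis t - z)" for t
    using null by eventually_elim (use r in \<open>auto simp: norm_mult\<close>)
  have eqL: "AE z in \<mu>. (\<integral>t. ?f z t \<partial>circle) = ln (max r (cmod z))"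
    using null by eventually_elim (rule circle_integral_ln_dist(2)[OF r])
  show "integrable \<mu> (\<lambda>z. ln (max r (cmod z)))"
  proof (rule Bochner_Integration.integrable_bound[of \<mu> "\<lambda>z. U z + \<bar>ln r\<bar>"])
    show "integrable \<mu> (\<lambda>z. U z + \<bar>ln r\<bar>)" using U by simp
    show "AE z in \<mu>. norm (ln (max r (cmod z))) \<le> norm (U z + \<bar>ln r\<bar>)"
    proof (rule AE_I2)
      fix z
      have "ln r \<le> ln (max r (cmod z))" using r by (intro ln_mono) auto
      moreover have "ln (max r (cmod z)) \<le> ln (1 + r + cmod z)" using r by (intro ln_mono) (auto simp: less_max_iff_disj)
      ultimately show "norm (ln (max r (cmod z))) \<le> norm (U z + \<bar>ln r\<bar>)"
        using Ubound[of z] U0[of z] unfolding real_norm_def by linarith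
    qed
  qed (simp add: bm)
  have "(\<integral>z. ln (max r (cmod z)) \<partial>\<mu>) = (\<integral>z. (\<integral>t. ?f z t \<partial>circle) \<partial>\<mu>)"
    using eqL prodint by (intro integral_cong_AE) (auto simp: bm intro: borel_measurable_integrable integrable_fst)
  also have "\<dots> = (\<integral>t. (\<integral>z. ?f z t \<partial>\<mu>) \<partial>circle)" by (rule Fubini_integral[OF prodint, symmetric])
  also have "\<dots> \<le> (\<integral>t. R t \<partial>circle)"
  proof (rule integral_mono_AE[OF integrable_snd[OF prodint] R(1)])
    \<comment> \<open>Fubini makes the inner integral an ordinary one for almost every t, where it
      agrees with the extended integral bounded by R.\<close>
    show "AE t in circle. (\<integral>z. ?f z t \<partial>\<mu>) \<le> R t"
      using AE_integrable_snd[OF prodint]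
    proof eventually_elim
      case (elim t)
      show ?case using R(2)[of t] ext_integral_elog_eq[OF elim AEpos] by simp
    qed
  qed
  finally show "(\<integral>z. ln (max r (cmod z)) \<partial>\<mu>) \<le> (\<integral>t. R t \<partial>circle)" .
qed

section \<open>Weyl's inequality for the Brown measure\<close>

lemma elog_Delta:
  assumes fin: "(\<integral>\<^sup>+t. e2ennreal (elog t) \<partial>modulus_distribution \<tau> T) < \<infinity>"
  shows "elog (Delta \<tau> T) = ext_integral (modulus_distribution \<tau> T) elog"
proof -
  let ?L = "ext_integral (modulus_distribution \<tau> T) elog"
  have "?L \<noteq> \<infinity>"
    using fin unfolding ext_integral_def
    by (cases "\<integral>\<^sup>+t. e2ennreal (elog t) \<partial>modulus_distribution \<tau> T";
        cases "\<integral>\<^sup>+t. e2ennreal (- elog t) \<partial>modulus_distribution \<tau> T")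
       (auto simp: enn2ereal_ennreal)
  thus ?thesis by (cases ?L) (auto simp: Delta_def Let_def elog_def)
qed

lemma (in affiliated_modulus) Delta_eq:
  assumes "(\<integral>\<^sup>+t. e2ennreal (elog t) \<partial>\<nu>) < \<infinity>"
  shows "elog (Delta \<tau> T) = ext_integral \<nu> elog"
  using elog_Delta[of \<tau> T] assms by (simp add: modulus_distribution_eq)

text \<open>Opens the existentials in \<open>M_Delta\<close>, so that the modulus, its spectral
  measure and integrability of the positive logarithm become available together.\<close>

lemma M_Delta_cases:
  assumes "tracial_von_neumann_algebra M \<tau>" "T \<in> M_Delta M \<tau>"
  obtains A E where "affiliated_modulus M \<tau> T A E"
    "(\<integral>\<^sup>+t. e2ennreal (elog t) \<partial>affiliated_modulus.\<nu> \<tau> E) < \<infinity>"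
proof -
  interpret tracial_von_neumann_algebra M \<tau> by fact
  from assms(2) obtain \<nu>' A E where *: "T \<in> affiliated M" "(\<integral>\<^sup>+t. e2ennreal (elog t) \<partial>\<nu>') < \<infinity>"
    "is_modulus T A" "is_spectral_measure A E"
    "\<nu>' = measure_of UNIV (sets borel) (\<lambda>B. ennreal (Re (\<tau> (E B))))"
    unfolding M_Delta_def is_modulus_distribution_def by blast
  interpret S: affiliated_modulus M \<tau> T A E by unfold_locales (use * in auto)
  have "\<nu>' = S.\<nu>" by (simp add: * S.\<nu>_def)
  thus thesis using that[OF S.affiliated_modulus_axioms] * by simp
qed

lemma Re_of_real_mult: "Re (of_real r * z) = r * Re z"
  by simp

lemma shift_zero: "shift T 0 = T"
  by (auto simp: shift_def)

text \<open>The Brown measure turns log \<Delta>(T - \<zeta>) into a logarithmic potential, and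
  \<epsilon> tends to 0 in the regularised bound.\<close>

lemma shift_elog_le:
  assumes M: "tracial_von_neumann_algebra M \<tau>" and brown: "is_brown_measure M \<tau> T \<mu>"
    and O: "affiliated_modulus M \<tau> T A E" and G: "G = spectral_pvm.FC E (\<lambda>t. 1 / (q * level r t))"
    and u: "u \<in> tracial_von_neumann_algebra.alg M" "norm u \<le> 1 / q" "\<And>x. (G \<rhd> x, u \<rhd> x) \<in> T"
    and q: "1 < q" and r: "0 < r" "cmod \<zeta> = r"
    and int: "integrable (affiliated_modulus.\<nu> \<tau> E) (\<lambda>t. ln (q * level r t))"
  shows "ext_integral \<mu> (\<lambda>z. elog (cmod (\<zeta> - z))) \<le>
    ereal ((\<integral>t. ln (q * level r t) \<partial>affiliated_modulus.\<nu> \<tau> E)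
      - tracial_algebra.lser (tracial_von_neumann_algebra.tr \<tau>) (cscale (cnj \<zeta>) (G * u)))"
proof -
  interpret O: affiliated_modulus M \<tau> T A E by fact
  have "shift T \<zeta> \<in> M_Delta M \<tau>" using brown by (simp add: is_brown_measure_def)
  then obtain A' E' where S: "affiliated_modulus M \<tau> (shift T \<zeta>) A' E'"
    and fin: "(\<integral>\<^sup>+t. e2ennreal (elog t) \<partial>affiliated_modulus.\<nu> \<tau> E') < \<infinity>"
    using M_Delta_cases[OF M] by blast
  interpret S: affiliated_modulus M \<tau> "shift T \<zeta>" A' E' by fact
  have "ext_integral \<mu> (\<lambda>z. elog (cmod (\<zeta> - z))) = elog (Delta \<tau> (shift T \<zeta>))"
    using brown by (simp add: is_brown_measure_def)
  also have "\<dots> = ext_integral S.\<nu> elog" by (rule S.Delta_eq[OF fin])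
  also have "\<dots> \<le> ereal ((\<integral>t. ln (q * level r t) \<partial>O.\<nu>) - O.lser (cscale (cnj \<zeta>) (G * u)))"
  proof (rule ext_integral_elog_le[OF S.prob_space_\<nu> S.sets_\<nu> fin])
    fix \<epsilon> :: real assume "0 < \<epsilon>"
    from O.shifted_determinant_bound[OF S G u q r this int]
    show "- (\<integral>t. ln (1 / (t\<^sup>2 + \<epsilon>) + \<epsilon>) \<partial>S.\<nu>) / 2 \<le>
        (\<integral>t. ln (q * level r t) \<partial>O.\<nu>) - O.lser (cscale (cnj \<zeta>) (G * u))
        + ln (1 + (1 / (q * r)\<^sup>2 + 1) / ((1 - (1 / q)\<^sup>2) * (1 - 1 / q)\<^sup>2) * \<epsilon>) / 2"
      unfolding res_def .
  qed
  finally show ?thesis .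
qed

section \<open>Circular means of the bound and submajorization\<close>

context affiliated_modulus
begin

lemma integrable_ln_max:
  assumes fin: "(\<integral>\<^sup>+t. e2ennreal (elog t) \<partial>\<nu>) < \<infinity>"
  shows "integrable \<nu> (\<lambda>t. ln (max 1 \<bar>t\<bar>))"
proof (rule integrableI_nonneg)
  have "AE t in \<nu>. 0 \<le> t"
    by (rule AE_I[of _ _ "{..<0}"]) (auto simp: \<nu>_negative)
  hence "AE t in \<nu>. ennreal (ln (max 1 \<bar>t\<bar>)) = e2ennreal (elog t)"
    by eventually_elim (auto simp: e2ennreal_elog max_def ennreal_neg)
  hence "(\<integral>\<^sup>+t. ennreal (ln (max 1 \<bar>t\<bar>)) \<partial>\<nu>) = (\<integral>\<^sup>+t. e2ennreal (elog t) \<partial>\<nu>)"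
    by (rule nn_integral_cong_AE)
  thus "(\<integral>\<^sup>+t. ennreal (ln (max 1 \<bar>t\<bar>)) \<partial>\<nu>) < \<infinity>" using fin by simp
qed (auto simp: measurable_\<nu>)

lemma integrable_ln_level:
  assumes fin: "(\<integral>\<^sup>+t. e2ennreal (elog t) \<partial>\<nu>) < \<infinity>" and r: "0 < r"
  shows "integrable \<nu> (\<lambda>t. ln (level r t))"
proof (rule Bochner_Integration.integrable_bound[of \<nu> "\<lambda>t. ln (max 1 \<bar>t\<bar>) + ln (1 + r) + \<bar>ln r\<bar>"])
  interpret P: prob_space \<nu> by (rule prob_space_\<nu>)
  show "integrable \<nu> (\<lambda>t. ln (max 1 \<bar>t\<bar>) + ln (1 + r) + \<bar>ln r\<bar>)"
    using integrable_ln_max[OF fin] by simp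
  show "(\<lambda>t. ln (level r t)) \<in> borel_measurable \<nu>"
    unfolding measurable_\<nu> level_def by measurable
  show "AE t in \<nu>. norm (ln (level r t)) \<le> norm (ln (max 1 \<bar>t\<bar>) + ln (1 + r) + \<bar>ln r\<bar>)"
  proof (rule AE_I2)
    fix t :: real
    have m: "1 \<le> max 1 \<bar>t\<bar>" by simp
    have l: "level r t \<le> max 1 \<bar>t\<bar> * (1 + r)"
    proof -
      have "r \<le> max 1 \<bar>t\<bar> * r" using mult_right_mono[OF m, of r] r by simp
      moreover have "\<bar>t\<bar> \<le> max 1 \<bar>t\<bar>" by simp
      ultimately have "\<bar>t\<bar> \<le> max 1 \<bar>t\<bar> + max 1 \<bar>t\<bar> * r" "r \<le> max 1 \<bar>t\<bar> + max 1 \<bar>t\<bar> * r"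
        using m r by linarith+
      thus ?thesis by (simp only: level_def distrib_left mult_1_right max.bounded_iff)
    qed
    have lp: "0 < level r t" "r \<le> level r t" using level_pos r by auto
    have "ln (level r t) \<le> ln (max 1 \<bar>t\<bar> * (1 + r))" by (rule ln_mono[OF l lp(1)])
    also have "\<dots> = ln (max 1 \<bar>t\<bar>) + ln (1 + r)" using r m by (simp add: ln_mult)
    finally have 1: "ln (level r t) \<le> ln (max 1 \<bar>t\<bar>) + ln (1 + r)" .
    have 2: "ln r \<le> ln (level r t)" by (rule ln_mono[OF lp(2) r])
    have "0 \<le> ln (max 1 \<bar>t\<bar>)" "0 \<le> ln (1 + r)" using r by simp_all
    thus "norm (ln (level r t)) \<le> norm (ln (max 1 \<bar>t\<bar>) + ln (1 + r) + \<bar>ln r\<bar>)"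
      using 1 2 unfolding real_norm_def by linarith
  qed
qed

text \<open>Powers of the conjugate of \<zeta> produce negative frequencies; conjugating under the
  real part makes them positive, at the price of conjugated coefficients.\<close>

lemma lser_cis_series:
  assumes W: "W \<in> alg" and r: "0 < r" "r * norm W < 1"
  defines "a \<equiv> \<lambda>n. of_real (r ^ Suc n / real (Suc n)) * cnj (tr (W ^ Suc n))"
  shows "summable (\<lambda>n. cmod (a n))"
    "lser (cscale (cnj (of_real r * cis t)) W) = (\<Sum>n. Re (a n * cis (real (Suc n) * t)))"
proof -
  show "summable (\<lambda>n. cmod (a n))"
  proof (rule summable_comparison_test'[of "\<lambda>n. (r * norm W) ^ n" 0])
    show "summable (\<lambda>n. (r * norm W) ^ n)" using r by (auto intro: summable_geometric)
    fix n
    have "cmod (tr (W ^ Suc n)) \<le> norm W ^ Suc n"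
      using order_trans[OF cmod_tr_le norm_power_bop_le, of W "Suc n"] power_mem[OF W] by blast
    hence "cmod (a n) \<le> r ^ Suc n / real (Suc n) * norm W ^ Suc n"
      unfolding a_def norm_mult norm_of_real complex_mod_cnj using r
      by (intro mult_mono) (auto simp del: power_Suc of_nat_Suc)
    also have "\<dots> = (r * norm W) ^ Suc n / real (Suc n)" by (simp only: power_mult_distrib times_divide_eq_left)
    also have "\<dots> \<le> (r * norm W) ^ Suc n / 1" using r by (intro divide_left_mono) (auto simp del: power_Suc)
    also have "\<dots> \<le> (r * norm W) ^ n" using r by (auto intro: mult_left_le_one_le)
    finally show "norm (cmod (a n)) \<le> (r * norm W) ^ n" by (simp only: real_norm_def abs_norm_cancel)
  qed
  have "rt (cscale (cnj (of_real r * cis t)) W ^ Suc n) / real (Suc n) = Re (a n * cis (real (Suc n) * t))" for n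
  proof -
    have "rt (cscale (cnj (of_real r * cis t)) W ^ Suc n) = Re (cnj (of_real r * cis t) ^ Suc n * tr (W ^ Suc n))"
      unfolding cscale_power rt_def using power_mem[OF W] by (simp only: tr_cscale)
    also have "\<dots> = Re (cnj (cnj (of_real r * cis t) ^ Suc n * tr (W ^ Suc n)))" by (rule cnj.simps(1)[symmetric])
    also have "cnj (cnj (of_real r * cis t) ^ Suc n * tr (W ^ Suc n))
        = of_real (r ^ Suc n) * (cnj (tr (W ^ Suc n)) * cis (real (Suc n) * t))"
      by (simp only: complex_cnj_mult complex_cnj_power complex_cnj_cnj power_mult_distrib Complex.DeMoivre of_real_power mult_ac)
    finally have e: "rt (cscale (cnj (of_real r * cis t)) W ^ Suc n) = r ^ Suc n * Re (cnj (tr (W ^ Suc n)) * cis (real (Suc n) * t))"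
      by (simp only: Re_of_real_mult)
    have "Re (a n * cis (real (Suc n) * t)) = r ^ Suc n / real (Suc n) * Re (cnj (tr (W ^ Suc n)) * cis (real (Suc n) * t))"
      unfolding a_def mult.assoc by (simp only: Re_of_real_mult)
    thus ?thesis unfolding e by simp
  qed
  thus "lser (cscale (cnj (of_real r * cis t)) W) = (\<Sum>n. Re (a n * cis (real (Suc n) * t)))"
    by (simp only: lser_def)
qed

text \<open>For each q > 1 the series term has mean 0 over the circle, so only the constant log q +
  \<open>(\<integral>t. ln (level r t) \<partial>\<nu>)\<close> survives, and q is let tend to
  1.\<close>

lemma brown_integral_ln_max_le:
  assumes brown: "is_brown_measure M \<tau> T \<mu>" and fin: "(\<integral>\<^sup>+t. e2ennreal (elog t) \<partial>\<nu>) < \<infinity>"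
    and r: "0 < r" and null: "AE z in \<mu>. cmod z \<noteq> r"
  shows "integrable \<mu> (\<lambda>z. ln (max r (cmod z)))" "(\<integral>z. ln (max r (cmod z)) \<partial>\<mu>) \<le> (\<integral>t. ln (level r t) \<partial>\<nu>)"
proof -
  interpret P: prob_space \<nu> by (rule prob_space_\<nu>)
  interpret C: prob_space circle by (rule prob_space_circle)
  have \<mu>: "prob_space \<mu>" "sets \<mu> = sets borel" "(\<integral>\<^sup>+z. e2ennreal (elog (cmod z)) \<partial>\<mu>) < \<infinity>"
    using brown by (simp_all add: is_brown_measure_def)
  have main: "integrable \<mu> (\<lambda>z. ln (max r (cmod z)))"
    "(\<integral>z. ln (max r (cmod z)) \<partial>\<mu>) \<le> ln q + (\<integral>t. ln (level r t) \<partial>\<nu>)" if q: "1 < q" for q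
  proof -
    have q0: "0 < q" using q by simp
    note bl = bounded_borel_level[OF r q0]
    define G where "G = FC (\<lambda>t. 1 / (q * level r t))"
    have G: "G \<in> alg" "norm G \<le> 1 / (q * r)" unfolding G_def by (intro FC_alg FC_norm bl)+
    obtain u where u: "u \<in> alg" "norm u \<le> 1 / q" "\<And>x. (G \<rhd> x, u \<rhd> x) \<in> T"
      using T_FC_bounded[OF bl(1,3,4)] unfolding G_def by blast
    have lnq: "ln (q * level r t) = ln q + ln (level r t)" for t
      using level_pos(1)[OF r, of t] q0 by (simp add: ln_mult)
    have intl: "integrable \<nu> (\<lambda>t. ln (level r t))" by (rule integrable_ln_level[OF fin r])
    hence int: "integrable \<nu> (\<lambda>t. ln (q * level r t))" unfolding lnq by simp
    define H where "H = (\<integral>t. ln (q * level r t) \<partial>\<nu>)"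
    have H: "H = ln q + (\<integral>t. ln (level r t) \<partial>\<nu>)"
      unfolding H_def lnq using intl P.prob_space by simp
    define R where "R t = H - lser (cscale (cnj (of_real r * cis t)) (G * u))" for t
    \<comment> \<open>The radius cancels against the bound 1/(q r) on \<open>norm G\<close>; what
      remains is 1/q^2.\<close>
    have "r * norm (G * u) \<le> r * (1 / (q * r) * (1 / q))"
      using G u r q0 by (intro mult_left_mono order_trans[OF norm_mult_ineq mult_mono]) auto
    also have "\<dots> = (1 / q) * (1 / q)" using r by simp
    also have "\<dots> < 1 * 1" using q by (intro mult_strict_mono) auto
    finally have rW: "r * norm (G * u) < 1" by simp
    have W: "G * u \<in> alg" using G u by auto
    note ser = lser_cis_series[OF W r rW]
    note cs = circle_integral_series[OF ser(1), folded ser(2)]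
    have Rint: "integrable circle R" "(\<integral>t. R t \<partial>circle) = H"
      unfolding R_def using cs C.prob_space by simp_all
    have le: "ext_integral \<mu> (\<lambda>z. elog (cmod (of_real r * cis t - z))) \<le> ereal (R t)" for t
    proof -
      have "cmod (of_real r * cis t) = r" using r by (simp add: norm_mult)
      from shift_elog_le[OF tracial_von_neumann_algebra_axioms brown affiliated_modulus_axioms G_def u q r this int]
      show ?thesis by (simp only: R_def H_def)
    qed
    show "integrable \<mu> (\<lambda>z. ln (max r (cmod z)))" by (rule integral_ln_max_le(1)[OF \<mu> r null Rint(1) le])
    show "(\<integral>z. ln (max r (cmod z)) \<partial>\<mu>) \<le> ln q + (\<integral>t. ln (level r t) \<partial>\<nu>)"
      using integral_ln_max_le(2)[OF \<mu> r null Rint(1) le] Rint(2) H by simp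
  qed
  show "integrable \<mu> (\<lambda>z. ln (max r (cmod z)))" using main(1)[of 2] by simp
  show "(\<integral>z. ln (max r (cmod z)) \<partial>\<mu>) \<le> (\<integral>t. ln (level r t) \<partial>\<nu>)"
  proof (rule field_le_epsilon)
    fix e :: real assume "0 < e"
    thus "(\<integral>z. ln (max r (cmod z)) \<partial>\<mu>) \<le> (\<integral>t. ln (level r t) \<partial>\<nu>) + e"
      \<comment> \<open>q = \<open>exp e\<close> exceeds 1 and makes the error term log q equal to
        e.\<close>
      using main(2)[of "exp e"] by simp
  qed
qed

text \<open>Subtracting log r from both probability averages gives nonnegative integrands, the form
  in which the radius can be integrated out by Tonelli.\<close>

lemma brown_log_submajorization:
  assumes brown: "is_brown_measure M \<tau> T \<mu>" and fin: "(\<integral>\<^sup>+t. e2ennreal (elog t) \<partial>\<nu>) < \<infinity>"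
    and r: "0 < r" and null: "AE z in \<mu>. cmod z \<noteq> r"
  shows "(\<integral>\<^sup>+z. ennreal (ln (max 1 (cmod z / r))) \<partial>\<mu>) \<le> (\<integral>\<^sup>+t. ennreal (ln (max 1 (\<bar>t\<bar> / r))) \<partial>\<nu>)"
proof -
  interpret P: prob_space \<nu> by (rule prob_space_\<nu>)
  interpret \<mu>: prob_space \<mu> using brown by (simp add: is_brown_measure_def)
  have eq: "ln (max 1 (a / r)) = ln (max r a) - ln r" for a
  proof -
    have "max 1 (a / r) = max r a / r" using r by (simp add: max_def field_simps)
    thus ?thesis using r by (simp add: ln_div less_max_iff_disj)
  qed
  note b = brown_integral_ln_max_le[OF assms]
  have lev: "level r = (\<lambda>t. max r \<bar>t\<bar>)" by (auto simp: level_def max.commute)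
  have i1: "integrable \<mu> (\<lambda>z. ln (max 1 (cmod z / r)))" unfolding eq using b(1) by simp
  have i2: "integrable \<nu> (\<lambda>t. ln (max 1 (\<bar>t\<bar> / r)))"
    unfolding eq using integrable_ln_level[OF fin r] by (simp add: lev)
  have "(\<integral>\<^sup>+z. ennreal (ln (max 1 (cmod z / r))) \<partial>\<mu>) = ennreal (\<integral>z. ln (max 1 (cmod z / r)) \<partial>\<mu>)"
    by (rule nn_integral_eq_integral[OF i1]) simp
  also have "\<dots> \<le> ennreal (\<integral>t. ln (max 1 (\<bar>t\<bar> / r)) \<partial>\<nu>)"
    unfolding eq using b integrable_ln_level[OF fin r] \<mu>.prob_space P.prob_space
    by (intro ennreal_leI) (simp add: lev)
  also have "\<dots> = (\<integral>\<^sup>+t. ennreal (ln (max 1 (\<bar>t\<bar> / r))) \<partial>\<nu>)"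
    by (rule nn_integral_eq_integral[OF i2, symmetric]) simp
  finally show ?thesis .
qed

end

text \<open>The substitution \<open>r = exp (-s)\<close> in \<open>a\<^sup>p = \<integral> p\<^sup>2 r\<^sup>p\<^sup>-\<^sup>1 log\<^sup>+ (a / r) dr\<close>, which avoids the endpoint
  \<open>r = 0\<close>.\<close>

lemma powr_eq_nn_integral:
  fixes p a :: real
  assumes p: "0 < p" and a: "0 \<le> a"
  shows "(\<integral>\<^sup>+s. ennreal (p\<^sup>2 * exp (- p * s) * ln (max 1 (a / exp (- s)))) \<partial>lborel) = ennreal (a powr p)"
proof (cases "a = 0")
  case False
  hence a0: "0 < a" using a by simp
  let ?f = "\<lambda>s. p\<^sup>2 * exp (- p * s) * (ln a + s)" and ?F = "\<lambda>s. - exp (- p * s) * (1 + p * (ln a + s))"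
  have ln: "ln (max 1 (a / exp (- s))) = max 0 (ln a + s)" for s
  proof -
    have "a / exp (- s) = exp (ln a + s)" using a0 by (simp add: exp_add exp_minus field_simps)
    moreover have "max 1 (exp (ln a + s)) = exp (max 0 (ln a + s))" by (simp add: max_def)
    ultimately show ?thesis by simp
  qed
  have "(\<integral>\<^sup>+s. ennreal (p\<^sup>2 * exp (- p * s) * ln (max 1 (a / exp (- s)))) \<partial>lborel)
      = (\<integral>\<^sup>+s. ennreal (?f s) * indicator {- ln a..} s \<partial>lborel)"
    unfolding ln by (intro nn_integral_cong) (auto simp: indicator_def max_def)
  also have "\<dots> = ennreal (0 - ?F (- ln a))"
  proof (rule nn_integral_FTC_atLeast)
    show "(?F has_real_derivative ?f s) (at s)" for s
      by (auto intro!: derivative_eq_intros simp: algebra_simps power2_eq_square)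
    show "0 \<le> ?f s" if "- ln a \<le> s" for s using that by simp
    have "((\<lambda>x. - ((1 + p * ln a) * (x ^ 0 / exp x) + x ^ 1 / exp x)) \<longlongrightarrow> - ((1 + p * ln a) * 0 + 0)) at_top"
      by (intro tendsto_intros tendsto_power_div_exp_0)
    moreover have "filterlim (\<lambda>s. p * s) at_top at_top"
      by (rule filterlim_tendsto_pos_mult_at_top[OF tendsto_const p filterlim_ident])
    ultimately have "((\<lambda>s. - ((1 + p * ln a) * ((p * s) ^ 0 / exp (p * s)) + (p * s) ^ 1 / exp (p * s)))
        \<longlongrightarrow> - ((1 + p * ln a) * 0 + 0)) at_top"
      by (rule filterlim_compose)
    thus "(?F \<longlongrightarrow> 0) at_top" by (simp add: exp_minus field_simps)
  qed measurable
  also have "0 - ?F (- ln a) = a powr p" using a0 by (simp add: powr_def)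
  finally show ?thesis .
qed (use p in simp)

text \<open>Circles carrying mass are atoms of the law of |z|, and a finite measure has only
  countably many. Such radii, excluded from the Jensen step, are thus negligible.\<close>

lemma countable_null_levels:
  assumes "prob_space \<mu>" "sets \<mu> = sets borel"
  shows "countable {r. \<not> (AE z in \<mu>. cmod z \<noteq> r)}"
proof -
  interpret prob_space \<mu> by fact
  have m: "cmod \<in> measurable \<mu> borel" by (simp add: measurable_cong_sets[OF assms(2) refl])
  interpret D: finite_measure "distr \<mu> borel cmod" by (rule finite_measure_distr[OF m])
  have "{r. \<not> (AE z in \<mu>. cmod z \<noteq> r)} \<subseteq> {r. measure (distr \<mu> borel cmod) {r} \<noteq> 0}"
  proof safe
    fix r assume not: "\<not> (AE z in \<mu>. cmod z \<noteq> r)" and "measure (distr \<mu> borel cmod) {r} = 0"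
    hence "measure \<mu> (cmod -` {r} \<inter> space \<mu>) = 0" using m by (simp add: measure_distr)
    moreover have "cmod -` {r} \<inter> space \<mu> \<in> sets \<mu>" using m by (rule measurable_sets) simp
    ultimately have "AE z in \<mu>. z \<notin> cmod -` {r} \<inter> space \<mu>" by (simp add: prob_eq_0)
    hence "AE z in \<mu>. cmod z \<noteq> r" using AE_space by eventually_elim auto
    thus False using not by simp
  qed
  thus ?thesis using D.countable_support by (rule countable_subset)
qed

theorem theorem2p19:
  fixes M :: "('h::complex_hilbert \<Rightarrow> 'h) set" and \<tau> :: "('h \<Rightarrow> 'h) \<Rightarrow> complex"
    and T :: "'h operator" and \<mu> :: "complex measure" and p :: real
  assumes "tracial_von_neumann_algebra M \<tau>"
    and "0 < p"
    and "T \<in> Lp_space M \<tau> p"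
    and "is_brown_measure M \<tau> T \<mu>"
  shows "(\<integral>\<^sup>+z. ennreal (cmod z powr p) \<partial>\<mu>) \<le> Lp_norm_powr \<tau> p T"
proof -
  \<comment> \<open>The Brown measure relation at the origin supplies the spectral data of |T| and
    integrability of its positive logarithm.\<close>
  have "shift T 0 \<in> M_Delta M \<tau>" using assms(4) unfolding is_brown_measure_def by blast
  hence "T \<in> M_Delta M \<tau>" by (simp only: shift_zero)
  then obtain A E where T: "affiliated_modulus M \<tau> T A E"
    and fin: "(\<integral>\<^sup>+t. e2ennreal (elog t) \<partial>affiliated_modulus.\<nu> \<tau> E) < \<infinity>"
    using M_Delta_cases[OF assms(1)] by blast
  interpret affiliated_modulus M \<tau> T A E by (rule T)
  have \<mu>: "prob_space \<mu>" "sets \<mu> = sets borel" using assms(4) by (simp_all add: is_brown_measure_def)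
  interpret \<mu>: prob_space \<mu> by fact
  interpret P: prob_space \<nu> by (rule prob_space_\<nu>)
  interpret \<mu>L: pair_sigma_finite \<mu> "lborel :: real measure" ..
  interpret \<nu>L: pair_sigma_finite \<nu> "lborel :: real measure" ..
  define w where "w a s = ennreal (p\<^sup>2 * exp (- p * s) * ln (max 1 (a / exp (- s))))" for a s :: real
  have w: "(\<integral>\<^sup>+s. w a s \<partial>lborel) = ennreal (a powr p)" if "0 \<le> a" for a
    unfolding w_def by (rule powr_eq_nn_integral[OF assms(2) that])
  have wsplit: "w a s = ennreal (p\<^sup>2 * exp (- p * s)) * ennreal (ln (max 1 (a / exp (- s))))" for a s
    by (simp add: w_def ennreal_mult)
  have m\<mu>: "(\<lambda>(z, s). w (cmod z) s) \<in> borel_measurable (\<mu> \<Otimes>\<^sub>M lborel)"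
  proof -
    have eq: "(borel_measurable (\<mu> \<Otimes>\<^sub>M lborel) :: (complex \<times> real \<Rightarrow> ennreal) set)
        = borel_measurable (borel \<Otimes>\<^sub>M borel)"
      by (intro measurable_cong_sets sets_pair_measure_cong) (use \<mu> in auto)
    show ?thesis unfolding eq w_def by measurable
  qed
  have m\<nu>: "(\<lambda>(t, s). w \<bar>t\<bar> s) \<in> borel_measurable (\<nu> \<Otimes>\<^sub>M lborel)"
  proof -
    have eq: "(borel_measurable (\<nu> \<Otimes>\<^sub>M lborel) :: (real \<times> real \<Rightarrow> ennreal) set)
        = borel_measurable (borel \<Otimes>\<^sub>M borel)"
      by (intro measurable_cong_sets sets_pair_measure_cong) auto
    show ?thesis unfolding eq w_def by measurable
  qed
  have meas\<mu>: "(\<lambda>z. ennreal (ln (max 1 (cmod z / exp (- s))))) \<in> borel_measurable \<mu>" for s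
    by (simp add: measurable_cong_sets[OF \<mu>(2) refl])
  have meas\<nu>: "(\<lambda>t. ennreal (ln (max 1 (\<bar>t\<bar> / exp (- s))))) \<in> borel_measurable \<nu>" for s
    by (simp add: measurable_cong_sets[OF sets_\<nu> refl])
  have le: "AE s in lborel. (\<integral>\<^sup>+z. w (cmod z) s \<partial>\<mu>) \<le> (\<integral>\<^sup>+t. w \<bar>t\<bar> s \<partial>\<nu>)"
  proof -
    let ?D = "{r. \<not> (AE z in \<mu>. cmod z \<noteq> r)}"
    \<comment> \<open>The substitution r = \<open>exp (- s)\<close> is injective, so the excluded
      values of s are countable too and Lebesgue-null.\<close>
    have "countable ((\<lambda>s. exp (- s)) -` ?D)"
      by (rule countable_image_inj_on[OF countable_subset[OF image_vimage_subset countable_null_levels[OF \<mu>]]])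
         (auto intro!: inj_onI)
    hence "AE s in lborel. s \<notin> (\<lambda>s. exp (- s)) -` ?D"
      by (intro AE_not_in countable_imp_null_set_lborel)
    thus ?thesis
    proof eventually_elim
      case (elim s)
      hence "(\<integral>\<^sup>+z. ennreal (ln (max 1 (cmod z / exp (- s)))) \<partial>\<mu>) \<le> (\<integral>\<^sup>+t. ennreal (ln (max 1 (\<bar>t\<bar> / exp (- s)))) \<partial>\<nu>)"
        by (intro brown_log_submajorization[OF assms(4) fin]) auto
      thus ?case
        unfolding wsplit using meas\<mu> meas\<nu> by (simp add: nn_integral_cmult mult_left_mono)
    qed
  qed
  have "(\<integral>\<^sup>+z. ennreal (cmod z powr p) \<partial>\<mu>) = (\<integral>\<^sup>+z. (\<integral>\<^sup>+s. w (cmod z) s \<partial>lborel) \<partial>\<mu>)"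
    by (simp add: w)
  also have "\<dots> = (\<integral>\<^sup>+s. (\<integral>\<^sup>+z. w (cmod z) s \<partial>\<mu>) \<partial>lborel)"
    by (rule \<mu>L.Fubini'[OF m\<mu>, symmetric])
  also have "\<dots> \<le> (\<integral>\<^sup>+s. (\<integral>\<^sup>+t. w \<bar>t\<bar> s \<partial>\<nu>) \<partial>lborel)" by (rule nn_integral_mono_AE[OF le])
  also have "\<dots> = (\<integral>\<^sup>+t. (\<integral>\<^sup>+s. w \<bar>t\<bar> s \<partial>lborel) \<partial>\<nu>)" by (rule \<nu>L.Fubini'[OF m\<nu>])
  also have "\<dots> = (\<integral>\<^sup>+t. ennreal (\<bar>t\<bar> powr p) \<partial>\<nu>)" by (simp add: w)
  also have "\<dots> = (\<integral>\<^sup>+t. ennreal (t powr p) \<partial>\<nu>)"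
  proof (rule nn_integral_cong_AE)
    \<comment> \<open>The absolute value can be removed because the distribution of |T| has no mass
      on the negative axis.\<close>
    have "AE t in \<nu>. t \<notin> {..<0}" by (rule AE_not_in) (auto simp: null_sets_def \<nu>_negative)
    thus "AE t in \<nu>. ennreal (\<bar>t\<bar> powr p) = ennreal (t powr p)" by eventually_elim simp
  qed
  finally show ?thesis by (simp add: Lp_norm_powr_def modulus_distribution_eq)
qed

end
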